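(* For uniformity testing of distributions on $\{1,\dots,d\}$ with distance parameter $\varepsilon$, the quantum query complexity (in the purified quantum query access model) is $\Omega\!\left(d^{1/3}+\frac{d^{1/4}}{\varepsilon}\right)$.
   Context: Purified quantum query access to a distribution $P=(p_1,\dots,p_d)$: a unitary $U$ on two registers $\mathsf{A},\mathsf{B}$ with $U\ket{0}_{\mathsf A}\ket{0}_{\mathsf B}=\sum_{i=1}^d\sqrt{p_i}\ket{i}_{\mathsf A}\ket{\psi_i}_{\mathsf B}$ for some orthonormal set $\{\ket{\psi_i}\}$; one query means one application of $U$, $U^\dagger$, controlled-$U$ or controlled-$U^\dagger$. The quantum query complexity of a task is the minimum number of queries needed by a quantum algorithm that succeeds with probability at least $2/3$ on every valid input. Uniformity testing: given purified query access to an unknown distribution $P$ on $d$ elements, decide whether $P$ is the uniform distribution $U_d$ or $\|P-U_d\|_1\ge\varepsilon$ (promised one holds), where $\|\cdot\|_1$ is the $\ell_1$ norm. *)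

theory Defs
  imports Complex_Main
begin

definition mat_apply :: "nat \<Rightarrow> (nat \<Rightarrow> nat \<Rightarrow> complex) \<Rightarrow> (nat \<Rightarrow> complex) \<Rightarrow> (nat \<Rightarrow> complex)" where
  "mat_apply n A v = (\<lambda>i. \<Sum>j<n. A i j * v j)"

definition unitary_on :: "nat \<Rightarrow> (nat \<Rightarrow> nat \<Rightarrow> complex) \<Rightarrow> bool" where
  "unitary_on n A \<longleftrightarrow>
     (\<forall>i<n. \<forall>j<n. (\<Sum>l<n. cnj (A l i) * A l j) = (if i = j then 1 else 0))"

definition basis_vec :: "nat \<Rightarrow> (nat \<Rightarrow> complex)" where
  "basis_vec k = (\<lambda>i. if i = k then 1 else 0)"

text \<open>Probability distributions on {0..<d} (the paper's {1..d}).\<close>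
definition is_distribution :: "nat \<Rightarrow> (nat \<Rightarrow> real) \<Rightarrow> bool" where
  "is_distribution d p \<longleftrightarrow> (\<forall>i<d. p i \<ge> 0) \<and> (\<Sum>i<d. p i) = 1"

definition l1_dist_uniform :: "nat \<Rightarrow> (nat \<Rightarrow> real) \<Rightarrow> real" where
  "l1_dist_uniform d p = (\<Sum>i<d. \<bar>p i - 1 / real d\<bar>)"

text \<open>U acts on A (dim d) tensor B (dim m); basis index of |a>|b> is a*m+b, so |0>|0> is index 0.
  U is a purified query oracle for p if U|0>|0> = sum_i sqrt(p_i)|i>|psi_i> with orthonormal psi_i.\<close>
definition purified_oracle :: "nat \<Rightarrow> nat \<Rightarrow> (nat \<Rightarrow> real) \<Rightarrow> (nat \<Rightarrow> nat \<Rightarrow> complex) \<Rightarrow> bool" where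
  "purified_oracle d m p U \<longleftrightarrow>
     unitary_on (d * m) U \<and>
     (\<exists>\<psi> :: nat \<Rightarrow> nat \<Rightarrow> complex.
        (\<forall>i<d. \<forall>j<d. (\<Sum>b<m. cnj (\<psi> i b) * \<psi> j b) = (if i = j then 1 else 0)) \<and>
        (\<forall>a<d. \<forall>b<m. mat_apply (d * m) U (basis_vec 0) (a * m + b)
                        = complex_of_real (sqrt (p a)) * \<psi> a b))"

datatype query = Fwd | Inv | CFwd | CInv

text \<open>Total space: control qubit c (dim 2) tensor A tensor B tensor workspace W (dim k);
  basis index ((c*d + a)*m + b)*k + w.  A query applies U, U^dagger, controlled-U or
  controlled-U^dagger (controlled on c) to the A,B registers, identity elsewhere.\<close>
definition oracle_op :: "nat \<Rightarrow> nat \<Rightarrow> nat \<Rightarrow> (nat \<Rightarrow> nat \<Rightarrow> complex) \<Rightarrow> query \<Rightarrow> nat \<Rightarrow> nat \<Rightarrow> complex" where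
  "oracle_op d m k U q i j =
     (if i div (d * m * k) = j div (d * m * k) \<and> i mod k = j mod k then
        (let c = i div (d * m * k); x = (i div k) mod (d * m); y = (j div k) mod (d * m);
             \<delta> = (if x = y then 1 else 0) in
         case q of
           Fwd \<Rightarrow> U x y
         | Inv \<Rightarrow> cnj (U y x)
         | CFwd \<Rightarrow> (if c = 1 then U x y else \<delta>)
         | CInv \<Rightarrow> (if c = 1 then cnj (U y x) else \<delta>))
      else 0)"

fun run_steps :: "nat \<Rightarrow> (query \<Rightarrow> nat \<Rightarrow> nat \<Rightarrow> complex) \<Rightarrow> (query \<times> (nat \<Rightarrow> nat \<Rightarrow> complex)) list
                   \<Rightarrow> (nat \<Rightarrow> complex) \<Rightarrow> (nat \<Rightarrow> complex)" where
  "run_steps N Or [] s = s"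
| "run_steps N Or ((q, V) # rest) s = run_steps N Or rest (mat_apply N V (mat_apply N (Or q) s))"

text \<open>Algorithm: start in |0>, apply V0, then for each step a query followed by a unitary;
  finally measure in the computational basis and answer "uniform" iff the outcome lies in S.
  The number of queries is the length of the step list.\<close>
definition accept_prob :: "nat \<Rightarrow> nat \<Rightarrow> nat \<Rightarrow> (nat \<Rightarrow> nat \<Rightarrow> complex)
      \<Rightarrow> (nat \<Rightarrow> nat \<Rightarrow> complex) \<Rightarrow> (query \<times> (nat \<Rightarrow> nat \<Rightarrow> complex)) list \<Rightarrow> nat set \<Rightarrow> real" where
  "accept_prob d m k U V0 steps S =
     (let N = 2 * d * m * k;
          \<phi> = run_steps N (oracle_op d m k U) steps (mat_apply N V0 (basis_vec 0))
      in \<Sum>j\<in>S \<inter> {..<N}. (cmod (\<phi> j))\<^sup>2)"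

definition uniformity_tester :: "nat \<Rightarrow> nat \<Rightarrow> nat \<Rightarrow> real
      \<Rightarrow> (nat \<Rightarrow> nat \<Rightarrow> complex) \<Rightarrow> (query \<times> (nat \<Rightarrow> nat \<Rightarrow> complex)) list \<Rightarrow> nat set \<Rightarrow> bool" where
  "uniformity_tester d m k \<epsilon> V0 steps S \<longleftrightarrow>
     unitary_on (2 * d * m * k) V0 \<and>
     (\<forall>qV\<in>set steps. unitary_on (2 * d * m * k) (snd qV)) \<and>
     (\<forall>p U. is_distribution d p \<and> purified_oracle d m p U \<longrightarrow>
        ((\<forall>i<d. p i = 1 / real d) \<longrightarrow> accept_prob d m k U V0 steps S \<ge> 2/3) \<and>
        (l1_dist_uniform d p \<ge> \<epsilon> \<longrightarrow> accept_prob d m k U V0 steps S \<le> 1/3))"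

end

theory Submission
  imports Defs "HOL-Analysis.L2_Norm" "HOL-Computational_Algebra.Polynomial"
begin

text \<open>
  Both lower bounds use oracles of the form \<open>U = I - |v\<rangle>\<langle>v|\<close> with \<open>v = |0\<rangle> - \<Phi>\<close>, where
  \<open>\<Phi> = \<Sum>\<^sub>e \<Phi>\<^sub>e |e\<rangle>|e + 1 mod d\<rangle>\<close> is orthogonal to \<open>|0\<rangle>\<close>; such a \<open>U\<close> is self-adjoint and
  exchanges \<open>|0\<rangle>\<close> and \<open>\<Phi>\<close>, so all four kinds of query are of the same type.

  For the bound \<open>d\<^sup>1\<^sup>/\<^sup>4 / \<epsilon>\<close>, pair up the elements and choose a random sign \<open>s\<^sub>i\<close> for each pair.
  The amplitudes \<open>(a \<plusminus> b s\<^sub>i) / \<surd>d\<close> give a distribution that is far from uniform, while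
  \<open>(a \<plusminus> \<i> b s\<^sub>i) / \<surd>d\<close> have constant modulus and give the uniform one. Regard the signs as a register
  of qubits in a uniform superposition. A rotation \<open>J\<close> of every qubit fixes the initial state and
  turns multiplication by \<open>s\<^sub>i\<close> into \<open>\<i> s\<^sub>i\<close> followed by a flip of \<open>s\<^sub>i\<close>; on states that do not depend
  on \<open>s\<^sub>i\<close> this agrees with multiplication by \<open>\<i> s\<^sub>i\<close>. Hence a query separates the two runs only as
  far as the state already depends on the sign it touches. After \<open>t\<close> queries the square root of the
  total influence is \<open>O(b t)\<close>, so the next query contributes \<open>O(b / \<surd>d) \<cdot> O(b t + 1)\<close>, and the sum
  \<open>O((b\<^sup>2 T\<^sup>2 + b T) / \<surd>d)\<close> has to be bounded below by a constant.

  For the bound \<open>d\<^sup>1\<^sup>/\<^sup>3\<close>, average the acceptance probability over the uniform distributions on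
  \<open>r\<close>-element subsets, with random signs of the amplitudes. The signs kill all monomials with an odd
  exponent, so the average is a polynomial of degree at most \<open>2 T\<close> in \<open>1 / r\<close>, bounded by \<open>1\<close> for
  \<open>r = 1, \<dots>, d\<close>. Lagrange interpolation at \<open>d / r \<approx> 1 + 100 j\<^sup>2\<close> shows that such a polynomial can
  distinguish \<open>r = d\<close> from \<open>r = \<lfloor>d / 2\<rfloor>\<close> only if \<open>T\<^sup>3 = \<Omega>(d)\<close>.
\<close>

section \<open>Reflection oracles\<close>

lemma mat_apply_diff: "mat_apply n A (\<lambda>i. f i - g i) = (\<lambda>i. mat_apply n A f i - mat_apply n A g i)"
  by (simp add: mat_apply_def sum_subtractf algebra_simps)

lemma mat_apply_norm:
  assumes "unitary_on n A"
  shows "(\<Sum>i<n. (cmod (mat_apply n A f i))\<^sup>2) = (\<Sum>i<n. (cmod (f i))\<^sup>2)"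
proof -
  have "complex_of_real (\<Sum>l<n. (cmod (mat_apply n A f l))\<^sup>2)
      = (\<Sum>l<n. cnj (\<Sum>i<n. A l i * f i) * (\<Sum>j<n. A l j * f j))"
    by (simp add: mat_apply_def complex_norm_square mult.commute del: of_real_power)
  also have "\<dots> = (\<Sum>l<n. \<Sum>i<n. \<Sum>j<n. cnj (f i) * f j * (cnj (A l i) * A l j))"
    unfolding cnj_sum sum_product by (intro sum.cong refl) (simp add: algebra_simps)
  also have "\<dots> = (\<Sum>i<n. \<Sum>j<n. \<Sum>l<n. cnj (f i) * f j * (cnj (A l i) * A l j))"
    by (subst sum.swap, rule sum.cong[OF refl], subst sum.swap, rule refl)
  also have "\<dots> = (\<Sum>i<n. \<Sum>j<n. cnj (f i) * f j * (\<Sum>l<n. cnj (A l i) * A l j))"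
    by (simp add: sum_distrib_left)
  also have "\<dots> = (\<Sum>i<n. \<Sum>j<n. cnj (f i) * f j * (if i = j then 1 else 0))"
    using assms unfolding unitary_on_def by (intro sum.cong refl) auto
  also have "\<dots> = (\<Sum>i<n. cnj (f i) * f i)"
    by (simp add: if_distrib cong: if_cong)
  also have "\<dots> = complex_of_real (\<Sum>i<n. (cmod (f i))\<^sup>2)"
    by (simp add: complex_norm_square mult.commute del: of_real_power)
  finally show ?thesis using of_real_eq_iff by blast
qed

lemma Cauchy_Schwarz_sum:
  fixes f g :: "'a \<Rightarrow> real"
  shows "(\<Sum>i\<in>A. f i * g i)\<^sup>2 \<le> (\<Sum>i\<in>A. (f i)\<^sup>2) * (\<Sum>i\<in>A. (g i)\<^sup>2)"
proof -
  have "\<bar>\<Sum>i\<in>A. f i * g i\<bar> \<le> L2_set f A * L2_set g A"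
    by (rule order_trans[OF sum_abs]) (simp add: abs_mult L2_set_mult_ineq)
  then have "(\<Sum>i\<in>A. f i * g i)\<^sup>2 \<le> (L2_set f A * L2_set g A)\<^sup>2"
    using abs_le_square_iff by (metis abs_mult abs_of_nonneg L2_set_nonneg)
  then show ?thesis by (simp add: L2_set_def power_mult_distrib sum_nonneg)
qed

text \<open>\<open>d \<le> m\<close> gives register B enough basis states to label all elements;
  \<open>2 \<le> d\<close> keeps the shift e \<mapsto> e + 1 mod d from fixing 0, so that index 0
  stays free.\<close>

locale purified_model =
  fixes d m k :: nat
  assumes d2: "2 \<le> d" and dm: "d \<le> m"
begin

text \<open>The second component is shifted so that no element sits at index 0, the initial state of the oracle.\<close>
definition pos :: "nat \<Rightarrow> nat" where "pos e = e * m + (e + 1) mod d"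

lemma shift_less: "(e + 1) mod d < m"
  using d2 dm by (meson less_le_trans mod_less_divisor pos2 order_less_le_trans)

lemma pos_div: "pos e div m = e" and pos_mod: "pos e mod m = (e + 1) mod d"
  using shift_less[of e] by (auto simp: pos_def)

lemma pos_less: "e < d \<Longrightarrow> pos e < d * m"
  using shift_less[of e] by (metis div_less_iff_less_mult pos_div less_nat_zero_code neq0_conv)

lemma pos_nonzero: "pos e \<noteq> 0"
proof
  assume "pos e = 0"
  then have "e * m = 0" "(e + 1) mod d = 0" by (simp_all add: pos_def)
  then show False using d2 dm by auto
qed

lemma pos_inj: "inj pos"
  by (metis injI pos_div)

lemma sum_support:
  fixes F :: "nat \<Rightarrow> 'a::comm_monoid_add"
  assumes "\<And>x. x < d * m \<Longrightarrow> x \<noteq> 0 \<Longrightarrow> x \<notin> pos ` {..<d} \<Longrightarrow> F x = 0"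
  shows "(\<Sum>x<d*m. F x) = F 0 + (\<Sum>e<d. F (pos e))"
proof -
  have "(\<Sum>x<d*m. F x) = (\<Sum>x\<in>insert 0 (pos ` {..<d}). F x)"
    using assms d2 dm by (intro sum.mono_neutral_right) (auto intro: pos_less)
  also have "\<dots> = F 0 + (\<Sum>x\<in>pos ` {..<d}. F x)"
    using pos_nonzero by (subst sum.insert) (auto simp: image_iff dest: sym)
  also have "(\<Sum>x\<in>pos ` {..<d}. F x) = (\<Sum>e<d. F (pos e))"
    by (subst sum.reindex) (auto intro: inj_on_subset[OF pos_inj])
  finally show ?thesis .
qed

text \<open>The vector v = |0> - \<Phi>; the quotient \<open>x div m\<close> recovers e from
  \<open>pos e\<close>.\<close>

definition vec :: "(nat \<Rightarrow> complex) \<Rightarrow> nat \<Rightarrow> complex" where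
  "vec \<Phi> x = (if x = 0 then 1 else if x \<in> pos ` {..<d} then - \<Phi> (x div m) else 0)"

lemma vec_simps: "vec \<Phi> 0 = 1" "e < d \<Longrightarrow> vec \<Phi> (pos e) = - \<Phi> e"
  by (auto simp: vec_def pos_nonzero pos_div)

lemma vec_zero: "x \<noteq> 0 \<Longrightarrow> x \<notin> pos ` {..<d} \<Longrightarrow> vec \<Phi> x = 0"
  by (auto simp: vec_def)

definition ip :: "(nat \<Rightarrow> complex) \<Rightarrow> (nat \<Rightarrow> complex) \<Rightarrow> complex" where
  "ip \<Phi> y = (\<Sum>x<d*m. cnj (vec \<Phi> x) * y x)"

lemma ip_eq: "ip \<Phi> y = y 0 - (\<Sum>e<d. cnj (\<Phi> e) * y (pos e))"
  unfolding ip_def by (subst sum_support) (auto simp: vec_zero vec_simps sum_negf)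

definition unit_amp :: "(nat \<Rightarrow> complex) \<Rightarrow> bool" where
  "unit_amp \<Phi> \<longleftrightarrow> (\<Sum>e<d. (cmod (\<Phi> e))\<^sup>2) = 1"

lemma vec_norm: "unit_amp \<Phi> \<Longrightarrow> (\<Sum>x<d*m. (cmod (vec \<Phi> x))\<^sup>2) = 2"
  by (subst sum_support) (auto simp: vec_zero vec_simps unit_amp_def)

lemma ip_bound:
  assumes "unit_amp \<Phi>"
  shows "(cmod (ip \<Phi> y))\<^sup>2 \<le> 2 * (\<Sum>x<d*m. (cmod (y x))\<^sup>2)"
proof -
  have "cmod (ip \<Phi> y) \<le> (\<Sum>x<d*m. cmod (vec \<Phi> x) * cmod (y x))"
    unfolding ip_def by (rule order_trans[OF norm_sum]) (simp add: norm_mult)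
  then have "(cmod (ip \<Phi> y))\<^sup>2 \<le> (\<Sum>x<d*m. cmod (vec \<Phi> x) * cmod (y x))\<^sup>2"
    by (simp add: power_mono)
  also have "\<dots> \<le> (\<Sum>x<d*m. (cmod (vec \<Phi> x))\<^sup>2) * (\<Sum>x<d*m. (cmod (y x))\<^sup>2)"
    by (rule Cauchy_Schwarz_sum)
  finally show ?thesis using vec_norm[OF assms] by simp
qed

text \<open>For unit amplitudes v has squared norm 2, so this is the Householder reflection I -
  2|v><v| / <v|v>.\<close>

definition refl_mat :: "(nat \<Rightarrow> complex) \<Rightarrow> nat \<Rightarrow> nat \<Rightarrow> complex" where
  "refl_mat \<Phi> x y = (if x = y then 1 else 0) - vec \<Phi> x * cnj (vec \<Phi> y)"

lemma refl_mat_herm: "cnj (refl_mat \<Phi> y x) = refl_mat \<Phi> x y"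
  by (auto simp: refl_mat_def)

lemma refl_mat_apply:
  "x < d * m \<Longrightarrow> (\<Sum>y<d*m. refl_mat \<Phi> x y * f y) = f x - vec \<Phi> x * ip \<Phi> f"
proof -
  assume x: "x < d * m"
  have "(\<Sum>y<d*m. refl_mat \<Phi> x y * f y)
      = (\<Sum>y<d*m. (if x = y then f y else 0) - vec \<Phi> x * (cnj (vec \<Phi> y) * f y))"
    by (intro sum.cong refl) (auto simp: refl_mat_def algebra_simps)
  then show ?thesis using x by (simp add: sum_subtractf ip_def sum_distrib_left)
qed

lemma refl_mat_unitary:
  assumes "unit_amp \<Phi>"
  shows "unitary_on (d*m) (refl_mat \<Phi>)"
  unfolding unitary_on_def
proof (intro allI impI)
  fix i j assume i: "i < d * m" and j: "j < d * m"
  have v2: "(\<Sum>l<d*m. cnj (vec \<Phi> l) * vec \<Phi> l) = 2"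
    using vec_norm[OF assms]
    by (metis (no_types, lifting) complex_norm_square mult.commute of_real_numeral of_real_sum sum.cong)
  \<comment> \<open>The reflection maps v to -v; numerically this is 1 - 2 = -1, the 2 being the
    squared norm of v.\<close>
  have ipj: "ip \<Phi> (\<lambda>l. refl_mat \<Phi> l j) = - cnj (vec \<Phi> j)"
  proof -
    have "ip \<Phi> (\<lambda>l. refl_mat \<Phi> l j)
        = (\<Sum>l<d*m. (if l = j then cnj (vec \<Phi> l) else 0) - cnj (vec \<Phi> l) * vec \<Phi> l * cnj (vec \<Phi> j))"
      unfolding ip_def refl_mat_def by (intro sum.cong) (auto simp: algebra_simps)
    also have "\<dots> = cnj (vec \<Phi> j) - 2 * cnj (vec \<Phi> j)"
      using j by (simp add: sum_subtractf v2 flip: sum_distrib_right)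
    finally show ?thesis by simp
  qed
  have "(\<Sum>l<d*m. cnj (refl_mat \<Phi> l i) * refl_mat \<Phi> l j)
      = (\<Sum>l<d*m. refl_mat \<Phi> i l * refl_mat \<Phi> l j)"
    by (simp add: refl_mat_herm)
  also have "\<dots> = refl_mat \<Phi> i j - vec \<Phi> i * ip \<Phi> (\<lambda>l. refl_mat \<Phi> l j)"
    by (rule refl_mat_apply[OF i])
  also have "\<dots> = (if i = j then 1 else 0)"
    unfolding ipj by (simp add: refl_mat_def)
  finally show "(\<Sum>l<d*m. cnj (refl_mat \<Phi> l i) * refl_mat \<Phi> l j) = (if i = j then 1 else 0)" .
qed

text \<open>Column 0 of the reflection is \<Phi>, and the phases \<open>u\<close> are absorbed into
  the orthonormal states of register B. One distribution therefore has many oracles, one for each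
  choice of signs or phases of its amplitudes.\<close>

lemma refl_mat_purified_oracle:
  assumes p: "is_distribution d p"
    and \<Phi>: "\<And>e. e < d \<Longrightarrow> \<Phi> e = complex_of_real (sqrt (p e)) * u e"
    and u: "\<And>e. e < d \<Longrightarrow> cmod (u e) = 1"
  shows "purified_oracle d m p (refl_mat \<Phi>)" and "unit_amp \<Phi>"
proof -
  show ua: "unit_amp \<Phi>"
  proof -
    have "(\<Sum>e<d. (cmod (\<Phi> e))\<^sup>2) = (\<Sum>e<d. p e)"
      using p unfolding is_distribution_def
      by (intro sum.cong) (auto simp: \<Phi> u norm_mult)
    then show ?thesis using p by (simp add: unit_amp_def is_distribution_def)
  qed
  define \<psi> where "\<psi> e b = (if b = (e + 1) mod d then u e else 0)" for e b
  have orth: "(\<Sum>b<m. cnj (\<psi> i b) * \<psi> j b) = (if i = j then 1 else 0)" if "i < d" "j < d" for i j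
  proof -
    have sh: "(i + 1) mod d = (j + 1) mod d \<longleftrightarrow> i = j"
      using that by (auto simp: mod_Suc split: if_splits)
    have "(\<Sum>b<m. cnj (\<psi> i b) * \<psi> j b)
        = (\<Sum>b<m. if b = (i + 1) mod d then cnj (u i) * (if i = j then u j else 0) else 0)"
      using sh by (intro sum.cong) (auto simp: \<psi>_def)
    also have "\<dots> = cnj (u i) * (if i = j then u j else 0)"
      using shift_less[of i] by simp
    also have "\<dots> = (if i = j then 1 else 0)"
      using u[OF that(1)] complex_norm_square[of "u i"] by (auto simp: mult.commute)
    finally show ?thesis .
  qed
  have col: "mat_apply (d * m) (refl_mat \<Phi>) (basis_vec 0) (a * m + b)
      = complex_of_real (sqrt (p a)) * \<psi> a b" if "a < d" "b < m" for a b
  proof -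
    have m0: "0 < d * m" using d2 dm by simp
    have "(\<Sum>y<d*m. refl_mat \<Phi> (a*m+b) y * basis_vec 0 y)
        = (\<Sum>y<d*m. if y = 0 then refl_mat \<Phi> (a*m+b) y else 0)"
      by (intro sum.cong) (auto simp: basis_vec_def)
    then have 1: "mat_apply (d * m) (refl_mat \<Phi>) (basis_vec 0) (a * m + b) = refl_mat \<Phi> (a*m+b) 0"
      using m0 by (simp add: mat_apply_def)
    have dv: "(a * m + b) div m = a" "(a * m + b) mod m = b" using that by auto
    have mem: "a * m + b \<in> pos ` {..<d} \<longleftrightarrow> b = (a + 1) mod d"
    proof
      assume "a * m + b \<in> pos ` {..<d}"
      then obtain e where "a * m + b = pos e" by auto
      then show "b = (a + 1) mod d" using dv pos_div pos_mod by metis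
    next
      assume "b = (a + 1) mod d"
      then have "a * m + b = pos a" by (simp add: pos_def)
      then show "a * m + b \<in> pos ` {..<d}" using that by auto
    qed
    have nz: "b = (a + 1) mod d \<Longrightarrow> a * m + b \<noteq> 0" using pos_nonzero[of a] by (simp add: pos_def)
    show ?thesis
    proof (cases "b = (a + 1) mod d")
      case True
      then have "a * m + b = pos a" by (simp add: pos_def)
      then have "refl_mat \<Phi> (a * m + b) 0 = \<Phi> a"
        using pos_nonzero[of a] by (simp add: refl_mat_def vec_simps that)
      then show ?thesis unfolding 1 using True by (simp add: \<psi>_def \<Phi>[OF that(1)])
    next
      case False
      \<comment> \<open>This covers index 0 as well, where the entry is 1 - 1 = 0.\<close>
      then show ?thesis unfolding 1
        using mem by (simp add: refl_mat_def vec_def dv \<psi>_def del: add_is_0)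
    qed
  qed
  show "purified_oracle d m p (refl_mat \<Phi>)"
    unfolding purified_oracle_def using refl_mat_unitary[OF ua] orth col by blast
qed

section \<open>Decomposition of the total space into slices\<close>

definition idx :: "nat \<Rightarrow> nat \<Rightarrow> nat \<Rightarrow> nat" where
  "idx c w x = (c * (d * m) + x) * k + w"

lemma idx_decode:
  assumes "w < k" "x < d * m"
  shows "idx c w x div (d * m * k) = c" "idx c w x mod k = w" "(idx c w x div k) mod (d * m) = x"
proof -
  show "idx c w x mod k = w" using assms by (simp add: idx_def)
  have dk: "idx c w x div k = c * (d * m) + x" using assms by (simp add: idx_def)
  then show "(idx c w x div k) mod (d * m) = x" using assms by simp
  have "idx c w x div (d * m * k) = (idx c w x div k) div (d * m)"
    by (metis div_mult2_eq mult.commute)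
  then show "idx c w x div (d * m * k) = c" using dk assms
    by (metis div_less div_mult_self3 add.right_neutral add.commute mult_0_right less_nat_zero_code)
qed

lemma idx_less:
  assumes "c < 2" "w < k" "x < d * m"
  shows "idx c w x < 2 * d * m * k"
proof -
  have "idx c w x div (d * m * k) < 2" using idx_decode[OF assms(2,3)] assms(1) by simp
  moreover have "0 < d * m * k" using assms by (cases k) auto
  ultimately show ?thesis by (simp add: div_less_iff_less_mult mult.assoc)
qed

lemma sum_idx:
  fixes F :: "nat \<Rightarrow> 'a::comm_monoid_add"
  shows "(\<Sum>j<2*d*m*k. F j) = (\<Sum>c<2. \<Sum>w<k. \<Sum>x<d*m. F (idx c w x))"
proof -
  let ?g = "\<lambda>(c, w, x). idx c w x" let ?A = "{..<2::nat} \<times> {..<k} \<times> {..<d*m}"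
  have inj: "inj_on ?g ?A"
    by (rule inj_onI) (clarsimp, metis idx_decode)
  have "?g ` ?A = {..<2*d*m*k}"
  proof (rule card_subset_eq)
    show "?g ` ?A \<subseteq> {..<2*d*m*k}" using idx_less by auto
    show "card (?g ` ?A) = card {..<2*d*m*k}" by (simp add: card_image[OF inj])
  qed auto
  then have "(\<Sum>j<2*d*m*k. F j) = (\<Sum>t\<in>?A. F (?g t))"
    by (metis (no_types, lifting) sum.reindex[OF inj, of F] comp_def sum.cong)
  then show ?thesis by (simp add: sum.cartesian_product split_def)
qed

lemma sum_idx_swap:
  fixes F :: "'b \<Rightarrow> nat \<Rightarrow> 'a::comm_monoid_add"
  shows "(\<Sum>s\<in>A. \<Sum>j<2*d*m*k. F s j) = (\<Sum>c<2. \<Sum>w<k. \<Sum>s\<in>A. \<Sum>x<d*m. F s (idx c w x))"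
  unfolding sum_idx by (subst sum.swap, rule sum.cong[OF refl], subst sum.swap, rule refl)

text \<open>Since the reflection is its own adjoint, the direction of a query is irrelevant; all
  that matters is whether it acts at control value c.\<close>

definition active :: "query \<Rightarrow> nat \<Rightarrow> bool" where
  "active q c \<longleftrightarrow> q = Fwd \<or> q = Inv \<or> c = 1"

abbreviation qop :: "(nat \<Rightarrow> complex) \<Rightarrow> query \<Rightarrow> nat \<Rightarrow> nat \<Rightarrow> complex" where
  "qop \<Phi> \<equiv> oracle_op d m k (refl_mat \<Phi>)"

text \<open>A query is block diagonal over the pairs (c, w), and each block is either the reflection
  or the identity.\<close>

lemma qop_apply:
  assumes "c < 2" "w < k" "x < d * m"
  shows "mat_apply (2*d*m*k) (qop \<Phi> q) f (idx c w x)
       = f (idx c w x) - (if active q c then vec \<Phi> x * ip \<Phi> (\<lambda>y. f (idx c w y)) else 0)"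
proof -
  define B where "B y = (if active q c then refl_mat \<Phi> x y else if x = y then 1 else 0)" for y
  have ent: "qop \<Phi> q (idx c w x) (idx c' w' y) = (if c' = c \<and> w' = w then B y else 0)"
    if "c' < 2" "w' < k" "y < d * m" for c' w' y
    using that assms by (cases q)
      (auto simp: oracle_op_def idx_decode Let_def B_def active_def refl_mat_herm)
  have "mat_apply (2*d*m*k) (qop \<Phi> q) f (idx c w x)
     = (\<Sum>c'<2. \<Sum>w'<k. \<Sum>y<d*m. (if c' = c \<and> w' = w then B y else 0) * f (idx c' w' y))"
    unfolding mat_apply_def sum_idx by (intro sum.cong refl) (simp add: ent)
  also have "\<dots> = (\<Sum>c'<2. if c' = c then \<Sum>w'<k. if w' = w then \<Sum>y<d*m. B y * f (idx c w y) else 0 else 0)"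
  proof (rule sum.cong[OF refl])
    fix c' :: nat
    have "(\<Sum>y<d*m. (if c' = c \<and> w' = w then B y else 0) * f (idx c' w' y))
        = (if c' = c then if w' = w then \<Sum>y<d*m. B y * f (idx c w y) else 0 else 0)" for w'
      by simp
    then show "(\<Sum>w'<k. \<Sum>y<d*m. (if c' = c \<and> w' = w then B y else 0) * f (idx c' w' y))
        = (if c' = c then \<Sum>w'<k. if w' = w then \<Sum>y<d*m. B y * f (idx c w y) else 0 else 0)"
      by simp
  qed
  also have "\<dots> = (\<Sum>w'<k. if w' = w then \<Sum>y<d*m. B y * f (idx c w y) else 0)" using assms by simp
  also have "\<dots> = (\<Sum>y<d*m. B y * f (idx c w y))" using assms by simp
  also have "\<dots> = f (idx c w x) - (if active q c then vec \<Phi> x * ip \<Phi> (\<lambda>y. f (idx c w y)) else 0)"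
    using assms refl_mat_apply[of x \<Phi> "\<lambda>y. f (idx c w y)"]
    by (auto simp: B_def if_distrib[of "\<lambda>z. z * _"] cong: if_cong)
  finally show ?thesis .
qed

lemma refl_slice_norm:
  assumes "unit_amp \<Phi>"
  shows "(\<Sum>x<d*m. (cmod (y x - vec \<Phi> x * ip \<Phi> y))\<^sup>2) = (\<Sum>x<d*m. (cmod (y x))\<^sup>2)"
proof -
  have "(\<Sum>x<d*m. (cmod (y x - vec \<Phi> x * ip \<Phi> y))\<^sup>2)
      = (\<Sum>x<d*m. (cmod (mat_apply (d*m) (refl_mat \<Phi>) y x))\<^sup>2)"
    by (intro sum.cong refl) (simp add: mat_apply_def refl_mat_apply)
  then show ?thesis using mat_apply_norm[OF refl_mat_unitary[OF assms]] by simp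
qed

lemma qop_norm:
  assumes "unit_amp \<Phi>"
  shows "(\<Sum>j<2*d*m*k. (cmod (mat_apply (2*d*m*k) (qop \<Phi> q) f j))\<^sup>2) = (\<Sum>j<2*d*m*k. (cmod (f j))\<^sup>2)"
  unfolding sum_idx
proof (rule sum.cong[OF refl], rule sum.cong[OF refl])
  fix c w assume "c \<in> {..<2::nat}" "w \<in> {..<k}"
  then show "(\<Sum>x<d*m. (cmod (mat_apply (2*d*m*k) (qop \<Phi> q) f (idx c w x)))\<^sup>2)
      = (\<Sum>x<d*m. (cmod (f (idx c w x)))\<^sup>2)"
    using refl_slice_norm[OF assms, of "\<lambda>x. f (idx c w x)"]
    by (cases "active q c") (simp_all add: qop_apply)
qed

end

section \<open>The sign register and its rotation\<close>

text \<open>A sign vector is encoded as the set of coordinates carrying +1, so flipping a sign is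
  toggling membership.\<close>

definition tog :: "nat \<Rightarrow> nat set \<Rightarrow> nat set" where
  "tog i s = (if i \<in> s then s - {i} else insert i s)"

definition sg :: "nat set \<Rightarrow> nat \<Rightarrow> complex" where
  "sg s i = (if i \<in> s then 1 else - 1)"

lemma tog_tog [simp]: "tog i (tog i s) = s"
  by (auto simp: tog_def)

lemma tog_commute: "tog i (tog j s) = tog j (tog i s)"
  by (auto simp: tog_def)

lemma tog_Pow: "i < n \<Longrightarrow> tog i s \<in> Pow {..<n} \<longleftrightarrow> s \<in> Pow {..<n}"
  by (auto simp: tog_def split: if_splits)

lemma sg_tog: "sg (tog i s) j = (if i = j then - sg s j else sg s j)"
  by (auto simp: tog_def sg_def)

lemma sg_norm [simp]: "cmod (sg s i) = 1"
  by (simp add: sg_def)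

lemma cnj_sg [simp]: "cnj (sg s i) = sg s i"
  by (simp add: sg_def)

lemma sum_tog:
  fixes F :: "nat set \<Rightarrow> 'a::comm_monoid_add"
  assumes "i < n"
  shows "(\<Sum>s\<in>Pow {..<n}. F (tog i s)) = (\<Sum>s\<in>Pow {..<n}. F s)"
  by (rule sum.reindex_bij_witness[where i = "tog i" and j = "tog i"])
     (use tog_Pow[OF assms] in simp_all)

text \<open>On the two functions \<open>1\<close> and \<open>s\<^sub>i\<close> of the \<open>i\<close>-th sign, \<open>Jstep i\<close> acts as \<open>1\<close> and \<open>\<i>\<close>.\<close>
definition Jstep :: "nat \<Rightarrow> (nat set \<Rightarrow> complex) \<Rightarrow> nat set \<Rightarrow> complex" where
  "Jstep i f s = ((1 + \<i>) * f s + (1 - \<i>) * f (tog i s)) / 2"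

primrec Jop :: "nat \<Rightarrow> (nat set \<Rightarrow> complex) \<Rightarrow> nat set \<Rightarrow> complex" where
  "Jop 0 f = f"
| "Jop (Suc n) f = Jstep n (Jop n f)"

lemma Jop_lin: "Jop n (\<lambda>s. a * f s + b * g s) = (\<lambda>s. a * Jop n f s + b * Jop n g s)"
  by (induction n) (simp_all add: Jstep_def fun_eq_iff field_simps)

lemma Jop_add: "Jop n (\<lambda>s. f s + g s) = (\<lambda>s. Jop n f s + Jop n g s)"
  using Jop_lin[of n 1 f 1 g] by simp

lemma Jop_diff: "Jop n (\<lambda>s. f s - g s) = (\<lambda>s. Jop n f s - Jop n g s)"
  using Jop_lin[of n 1 f "-1" g] by simp

lemma Jop_scale: "Jop n (\<lambda>s. a * f s) = (\<lambda>s. a * Jop n f s)"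
  using Jop_lin[of n a f 0 f] by simp

lemma Jop_sum: "Jop n (\<lambda>s. \<Sum>x\<in>A. F x s) = (\<lambda>s. \<Sum>x\<in>A. Jop n (F x) s)"
proof (cases "finite A")
  case True
  then show ?thesis
    using Jop_scale[of n 0] by (induction A) (simp_all add: Jop_add)
qed (use Jop_scale[of n 0] in simp)

lemma Jop_tog: "Jop n (\<lambda>s. f (tog i s)) s = Jop n f (tog i s)"
  by (induction n arbitrary: s) (simp_all add: Jstep_def tog_commute)

text \<open>Rotating coordinate i turns multiplication by the sign into \<i> times that sign
  combined with a flip, while rotations of other coordinates commute with it. The branch for
  \<open>i \<ge> n\<close> describes the state before coordinate i is reached and is needed for the
  induction.\<close>

lemma Jop_sg_aux:
  "Jop n (\<lambda>s. sg s i * f s) = (\<lambda>s. if i < n then \<i> * sg s i * Jop n f (tog i s) else sg s i * Jop n f s)"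
proof (induction n)
  case (Suc n)
  show ?case
  proof
    fix s
    define g where "g = Jop n f"
    have IH: "Jop n (\<lambda>s. sg s i * f s) = (\<lambda>s. if i < n then \<i> * sg s i * g (tog i s) else sg s i * g s)"
      unfolding g_def by (rule Suc.IH)
    consider "i < n" | "i = n" | "n < i" by linarith
    then show "Jop (Suc n) (\<lambda>s. sg s i * f s) s
       = (if i < Suc n then \<i> * sg s i * Jop (Suc n) f (tog i s) else sg s i * Jop (Suc n) f s)"
      unfolding Jop.simps IH g_def[symmetric]
      by cases (simp_all add: Jstep_def sg_tog tog_commute[of i n] field_simps)
  qed
qed simp

lemma Jop_sg: "i < n \<Longrightarrow> Jop n (\<lambda>s. sg s i * f s) s = \<i> * sg s i * Jop n f (tog i s)"
  by (simp add: Jop_sg_aux)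

text \<open>On each pair s, \<open>tog i s\<close> the rotation is the unitary 2x2 matrix with
  entries (1 \<plusminus> \<i>)/2. Summing over all s counts every pair twice on both sides.\<close>

lemma Jstep_norm:
  assumes "i < n"
  shows "(\<Sum>s\<in>Pow {..<n}. (cmod (Jstep i f s))\<^sup>2) = (\<Sum>s\<in>Pow {..<n}. (cmod (f s))\<^sup>2)"
proof -
  have pt: "(cmod (Jstep i f s))\<^sup>2 + (cmod (Jstep i f (tog i s)))\<^sup>2 = (cmod (f s))\<^sup>2 + (cmod (f (tog i s)))\<^sup>2" for s
  proof -
    have "(cmod (((1 + \<i>) * x + (1 - \<i>) * y) / 2))\<^sup>2 + (cmod (((1 + \<i>) * y + (1 - \<i>) * x) / 2))\<^sup>2
        = (cmod x)\<^sup>2 + (cmod y)\<^sup>2" for x y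
      unfolding cmod_power2 by (simp add: power2_eq_square field_simps)
    then show ?thesis by (simp add: Jstep_def)
  qed
  have dbl: "2 * (\<Sum>s\<in>Pow {..<n}. F s) = (\<Sum>s\<in>Pow {..<n}. F s + F (tog i s))" for F :: "nat set \<Rightarrow> real"
    using sum_tog[OF assms, of F] by (simp add: sum.distrib)
  show ?thesis
    using dbl[of "\<lambda>s. (cmod (Jstep i f s))\<^sup>2"] dbl[of "\<lambda>s. (cmod (f s))\<^sup>2"] by (simp add: pt)
qed

lemma Jop_norm: "(\<Sum>s\<in>Pow {..<n}. (cmod (Jop n f s))\<^sup>2) = (\<Sum>s\<in>Pow {..<n}. (cmod (f s))\<^sup>2)"
proof -
  have "l \<le> n \<Longrightarrow> (\<Sum>s\<in>Pow {..<n}. (cmod (Jop l f s))\<^sup>2) = (\<Sum>s\<in>Pow {..<n}. (cmod (f s))\<^sup>2)" for l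
    by (induction l) (simp_all add: Jstep_norm)
  then show ?thesis by simp
qed

lemma norm_add_sq: "(cmod (x + y))\<^sup>2 \<le> 2 * (cmod x)\<^sup>2 + 2 * (cmod y)\<^sup>2"
proof -
  have "(cmod (x + y))\<^sup>2 \<le> (cmod x + cmod y)\<^sup>2" by (simp add: norm_triangle_ineq power_mono)
  also have "\<dots> \<le> 2 * (cmod x)\<^sup>2 + 2 * (cmod y)\<^sup>2"
    using sum_squares_ge_zero[of "cmod x - cmod y" 0] by (simp add: power2_eq_square algebra_simps)
  finally show ?thesis .
qed

lemma norm_diff_sq: "(cmod (x - y))\<^sup>2 \<le> 2 * (cmod x)\<^sup>2 + 2 * (cmod y)\<^sup>2"
  using norm_add_sq[of x "- y"] by simp

text \<open>A function that is odd in coordinate i is orthogonal to everything even in it, so only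
  the odd part of f survives.\<close>

lemma sum_odd:
  fixes f g :: "nat set \<Rightarrow> complex"
  assumes "i < n" and odd: "\<And>s. g (tog i s) = - g s"
  shows "(\<Sum>s\<in>Pow {..<n}. cnj (f s) * g s) = (\<Sum>s\<in>Pow {..<n}. cnj (f s - f (tog i s)) * g s) / 2"
proof -
  have "(\<Sum>s\<in>Pow {..<n}. cnj (f (tog i s)) * g s) = (\<Sum>s\<in>Pow {..<n}. cnj (f s) * g (tog i s))"
    using sum_tog[OF assms(1), of "\<lambda>s. cnj (f s) * g (tog i s)"] by simp
  also have "\<dots> = - (\<Sum>s\<in>Pow {..<n}. cnj (f s) * g s)" by (simp add: odd sum_negf)
  finally show ?thesis by (simp add: algebra_simps sum_subtractf)
qed

lemma sum_fold_sq:
  fixes y :: "nat set \<Rightarrow> complex"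
  assumes "i < n"
  shows "(\<Sum>s\<in>Pow {..<n}. (cmod (sg s i * (y s + y (tog i s))))\<^sup>2) \<le> 4 * (\<Sum>s\<in>Pow {..<n}. (cmod (y s))\<^sup>2)"
proof -
  have "(\<Sum>s\<in>Pow {..<n}. (cmod (sg s i * (y s + y (tog i s))))\<^sup>2)
     \<le> (\<Sum>s\<in>Pow {..<n}. 2 * (cmod (y s))\<^sup>2 + 2 * (cmod (y (tog i s)))\<^sup>2)"
    by (intro sum_mono) (simp add: norm_mult norm_add_sq)
  also have "\<dots> = 4 * (\<Sum>s\<in>Pow {..<n}. (cmod (y s))\<^sup>2)"
    using sum_tog[OF assms, of "\<lambda>s. (cmod (y s))\<^sup>2"] by (simp add: sum.distrib flip: sum_distrib_left)
  finally show ?thesis .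
qed

lemma sum_sq_expand:
  fixes u :: "nat \<Rightarrow> 'a \<Rightarrow> complex"
  shows "(\<Sum>s\<in>A. (cmod (\<Sum>i<n. u i s))\<^sup>2) = (\<Sum>i<n. \<Sum>j<n. Re (\<Sum>s\<in>A. cnj (u i s) * u j s))"
proof -
  have "(cmod (\<Sum>i<n. u i s))\<^sup>2 = (\<Sum>i<n. \<Sum>j<n. Re (cnj (u i s) * u j s))" for s
  proof -
    have "complex_of_real ((cmod (\<Sum>i<n. u i s))\<^sup>2) = (\<Sum>i<n. \<Sum>j<n. cnj (u i s) * u j s)"
      unfolding complex_norm_square by (subst mult.commute) (simp add: sum_product)
    then show ?thesis by (metis (no_types, lifting) Re_complex_of_real Re_sum sum.cong)
  qed
  then have "(\<Sum>s\<in>A. (cmod (\<Sum>i<n. u i s))\<^sup>2) = (\<Sum>s\<in>A. \<Sum>i<n. \<Sum>j<n. Re (cnj (u i s) * u j s))"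
    by simp
  also have "\<dots> = (\<Sum>i<n. \<Sum>j<n. \<Sum>s\<in>A. Re (cnj (u i s) * u j s))"
    by (subst sum.swap, rule sum.cong[OF refl], subst sum.swap, rule refl)
  finally show ?thesis by (simp only: Re_sum)
qed

text \<open>Distinct summands are nearly orthogonal: each is odd under its own flip, so an inner product
  only sees the part of the other one that depends on that coordinate.\<close>
lemma creation_bound:
  fixes w :: "nat \<Rightarrow> nat set \<Rightarrow> complex"
  shows "(\<Sum>s\<in>Pow {..<n}. (cmod (\<Sum>i<n. sg s i * (w i s + w i (tog i s))))\<^sup>2)
    \<le> (\<Sum>i<n. \<Sum>j<n. \<Sum>s\<in>Pow {..<n}. (cmod (w i s - w i (tog j s)))\<^sup>2)
      + 4 * (\<Sum>i<n. \<Sum>s\<in>Pow {..<n}. (cmod (w i s))\<^sup>2)"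
proof -
  let ?E = "Pow {..<n}"
  define u where "u i s = sg s i * (w i s + w i (tog i s))" for i s
  define A where "A i j = (\<Sum>s\<in>?E. (cmod (w i s - w i (tog j s)))\<^sup>2)" for i j
  define B where "B i = (\<Sum>s\<in>?E. (cmod (w i s))\<^sup>2)" for i
  have A0: "0 \<le> A i j" for i j by (simp add: A_def sum_nonneg)
  have odd: "u i (tog i s) = - u i s" for i s by (simp add: u_def sg_tog)
  have ud: "u i s - u i (tog j s) = sg s i * ((w i s - w i (tog j s)) + (w i (tog i s) - w i (tog j (tog i s))))"
    if "i \<noteq> j" for i j s using that by (simp add: u_def sg_tog tog_commute[of i j] algebra_simps)
  \<comment> \<open>Oddness is used twice: \<open>u j\<close> is odd in coordinate j, which replaces
    \<open>u i\<close> by its difference along j; that difference is odd in coordinate i, which does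
    the same to \<open>u j\<close>. Each use contributes a factor 1/2.\<close>
  have off: "Re (\<Sum>s\<in>?E. cnj (u i s) * u j s) \<le> (A i j + A j i) / 2" if ij: "i < n" "j < n" "i \<noteq> j" for i j
  proof -
    have odd': "u i (tog i s) - u i (tog j (tog i s)) = - (u i s - u i (tog j s))" for s
      by (simp add: odd tog_commute[of j i])
    have "(\<Sum>s\<in>?E. cnj (u i s) * u j s) = (\<Sum>s\<in>?E. cnj (u i s - u i (tog j s)) * u j s) / 2"
      by (rule sum_odd[OF ij(2)]) (rule odd)
    also have "(\<Sum>s\<in>?E. cnj (u i s - u i (tog j s)) * u j s)
        = cnj (\<Sum>s\<in>?E. cnj (u j s) * (u i s - u i (tog j s)))" by (simp add: mult.commute)
    also have "(\<Sum>s\<in>?E. cnj (u j s) * (u i s - u i (tog j s)))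
        = (\<Sum>s\<in>?E. cnj (u j s - u j (tog i s)) * (u i s - u i (tog j s))) / 2"
      by (rule sum_odd[OF ij(1)]) (rule odd')
    finally have "(\<Sum>s\<in>?E. cnj (u i s) * u j s)
        = cnj ((\<Sum>s\<in>?E. cnj (u j s - u j (tog i s)) * (u i s - u i (tog j s))) / 2) / 2" .
    then have "Re (\<Sum>s\<in>?E. cnj (u i s) * u j s)
        = Re (\<Sum>s\<in>?E. cnj (u j s - u j (tog i s)) * (u i s - u i (tog j s))) / 4"
      by (simp only: Re_divide_numeral cnj.simps)
    then have "Re (\<Sum>s\<in>?E. cnj (u i s) * u j s)
        = (\<Sum>s\<in>?E. Re (cnj (u j s - u j (tog i s)) * (u i s - u i (tog j s)))) / 4"
      by (simp only: Re_sum)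
    also have "\<dots> \<le> (\<Sum>s\<in>?E. ((cmod (u j s - u j (tog i s)))\<^sup>2 + (cmod (u i s - u i (tog j s)))\<^sup>2) / 2) / 4"
    proof (intro divide_right_mono sum_mono)
      fix s
      let ?x = "u j s - u j (tog i s)" let ?y = "u i s - u i (tog j s)"
      have "Re (cnj ?x * ?y) \<le> cmod ?x * cmod ?y"
        by (metis complex_Re_le_cmod complex_mod_cnj norm_mult)
      also have "\<dots> \<le> ((cmod ?x)\<^sup>2 + (cmod ?y)\<^sup>2) / 2"
        using sum_squares_bound[of "cmod ?x" "cmod ?y"] by simp
      finally show "Re (cnj ?x * ?y) \<le> ((cmod ?x)\<^sup>2 + (cmod ?y)\<^sup>2) / 2" .
    qed simp
    also have "\<dots> = ((\<Sum>s\<in>?E. (cmod (u j s - u j (tog i s)))\<^sup>2) + (\<Sum>s\<in>?E. (cmod (u i s - u i (tog j s)))\<^sup>2)) / 8"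
      by (simp add: sum.distrib flip: sum_divide_distrib)
    also have "\<dots> \<le> (4 * A j i + 4 * A i j) / 8"
      using sum_fold_sq[OF ij(1), of "\<lambda>s. w i s - w i (tog j s)"]
        sum_fold_sq[OF ij(2), of "\<lambda>s. w j s - w j (tog i s)"] ij(3)
      by (intro divide_right_mono add_mono) (simp_all add: ud A_def)
    finally show ?thesis by simp
  qed
  have diag: "Re (\<Sum>s\<in>?E. cnj (u i s) * u i s) \<le> 4 * B i" if "i < n" for i
  proof -
    have "Re (cnj (u i s) * u i s) = (cmod (u i s))\<^sup>2" for s
      by (metis Re_complex_of_real complex_norm_square mult.commute)
    then show ?thesis using sum_fold_sq[OF that, of "w i"]
      by (simp only: Re_sum B_def) (simp add: u_def)
  qed
  have "(\<Sum>s\<in>?E. (cmod (\<Sum>i<n. u i s))\<^sup>2) = (\<Sum>i<n. \<Sum>j<n. Re (\<Sum>s\<in>?E. cnj (u i s) * u j s))"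
    by (rule sum_sq_expand)
  also have "\<dots> \<le> (\<Sum>i<n. \<Sum>j<n. (A i j + A j i) / 2 + (if j = i then 4 * B i else 0))"
  proof (intro sum_mono)
    fix i j assume ij: "i \<in> {..<n}" "j \<in> {..<n}"
    show "Re (\<Sum>s\<in>?E. cnj (u i s) * u j s) \<le> (A i j + A j i) / 2 + (if j = i then 4 * B i else 0)"
      using off[of i j] diag[of i] ij A0[of i i] by (cases "i = j") auto
  qed
  also have "\<dots> = ((\<Sum>i<n. \<Sum>j<n. A i j) + (\<Sum>i<n. \<Sum>j<n. A j i)) / 2 + (\<Sum>i<n. 4 * B i)"
    by (simp add: sum.distrib flip: sum_divide_distrib)
  also have "(\<Sum>i<n. \<Sum>j<n. A j i) = (\<Sum>i<n. \<Sum>j<n. A i j)" by (rule sum.swap)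
  finally show ?thesis by (simp add: u_def A_def B_def flip: sum_distrib_left)
qed

section \<open>Norm and influence of states that depend on the signs\<close>

text \<open>Unnormalised in the sign register: a unit vector that is the same for all s has value
  2^n.\<close>

definition sqn :: "nat \<Rightarrow> nat \<Rightarrow> (nat set \<Rightarrow> nat \<Rightarrow> complex) \<Rightarrow> real" where
  "sqn n N \<psi> = (\<Sum>s\<in>Pow {..<n}. \<Sum>j<N. (cmod (\<psi> s j))\<^sup>2)"

text \<open>The total influence of the signs on the state, as for Boolean functions up to
  normalisation.\<close>

definition infl :: "nat \<Rightarrow> nat \<Rightarrow> (nat set \<Rightarrow> nat \<Rightarrow> complex) \<Rightarrow> real" where
  "infl n N \<psi> = (\<Sum>i<n. sqn n N (\<lambda>s j. \<psi> s j - \<psi> (tog i s) j))"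

definition Jst :: "nat \<Rightarrow> (nat set \<Rightarrow> nat \<Rightarrow> complex) \<Rightarrow> nat set \<Rightarrow> nat \<Rightarrow> complex" where
  "Jst n \<psi> s j = Jop n (\<lambda>s. \<psi> s j) s"

lemma sqn_nonneg: "0 \<le> sqn n N \<psi>"
  by (simp add: sqn_def sum_nonneg)

lemma infl_nonneg: "0 \<le> infl n N \<psi>"
  by (simp add: infl_def sum_nonneg sqn_nonneg)

lemma sqn_Jst: "sqn n N (Jst n \<psi>) = sqn n N \<psi>"
  unfolding sqn_def Jst_def by (subst (1 2) sum.swap) (simp add: Jop_norm)

lemma Jst_tog_diff: "Jst n \<psi> s j - Jst n \<psi> (tog i s) j = Jst n (\<lambda>s j. \<psi> s j - \<psi> (tog i s) j) s j"
  by (simp add: Jst_def Jop_diff Jop_tog[of n "\<lambda>s. \<psi> s j"])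

lemma infl_Jst: "infl n N (Jst n \<psi>) = infl n N \<psi>"
  unfolding infl_def Jst_tog_diff sqn_Jst ..

section \<open>Paired distributions and the effect of one query\<close>

text \<open>The condition on the squares makes each pair have total weight 2/d in both models;
  \<open>b \<le> a\<close> keeps a - b nonnegative, so that the far amplitudes are genuine square
  roots.\<close>

locale paired_model = purified_model +
  fixes a b :: real
  assumes ab1: "a\<^sup>2 + b\<^sup>2 = 1" and b0: "0 \<le> b" and ba: "b \<le> a"
begin

definition n where "n = d div 2"
definition \<beta> where "\<beta> = b / sqrt (real d)"

text \<open>Elements \<open>2 i\<close> and \<open>2 i + 1\<close> form pair \<open>i < n\<close>; for odd \<open>d\<close> the last element keeps the weight \<open>1 / d\<close>.\<close>
definition al :: "nat \<Rightarrow> real" where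
  "al e = (if e < 2 * n then a else 1) / sqrt (real d)"

text \<open>The sign of e inside its pair; the value 0 makes the leftover element of an odd d
  independent of the sign register.\<close>

definition ta :: "nat \<Rightarrow> real" where
  "ta e = (if e < 2 * n then if even e then 1 else - 1 else 0)"

definition amp_far :: "nat set \<Rightarrow> nat \<Rightarrow> complex" where
  "amp_far s e = of_real (al e) + of_real (\<beta> * ta e) * sg s (e div 2)"

definition amp_unif :: "nat set \<Rightarrow> nat \<Rightarrow> complex" where
  "amp_unif s e = of_real (al e) + \<i> * of_real (\<beta> * ta e) * sg s (e div 2)"

text \<open>These are the squared far amplitudes, because (a \<plusminus> b)^2 = 1 \<plusminus>
  2ab.\<close>

definition p_far :: "nat set \<Rightarrow> nat \<Rightarrow> real" where
  "p_far s e = (1 + 2 * a * b * ta e * (if e div 2 \<in> s then 1 else - 1)) / real d"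

lemma dpos: "0 < real d" using d2 by simp

lemma sum_d:
  fixes F :: "nat \<Rightarrow> 'a::comm_monoid_add"
  shows "(\<Sum>e<d. F e) = (\<Sum>i<n. F (2*i) + F (2*i+1)) + (if odd d then F (2*n) else 0)"
proof -
  have "(\<Sum>e<2*l. F e) = (\<Sum>i<l. F (2*i) + F (2*i+1))" for l
    by (induction l) (simp_all add: ac_simps)
  note pairs = this
  show ?thesis
  proof (cases "odd d")
    case True
    then have "d = Suc (2 * n)" by (simp add: n_def)
    then have "{..<d} = {..<Suc (2 * n)}" by (rule arg_cong)
    then show ?thesis using True by (simp only: sum.lessThan_Suc pairs if_True simp_thms)
  next
    case False
    then have "d = 2 * n" by (simp add: n_def)
    then have "{..<d} = {..<2 * n}" by (rule arg_cong)
    then show ?thesis using False by (simp only: pairs if_False add_0_right simp_thms)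
  qed
qed

lemma sum_ta:
  fixes F :: "nat \<Rightarrow> complex"
  shows "(\<Sum>e<d. of_real (ta e) * F e) = (\<Sum>i<n. F (2*i) - F (2*i+1))"
  unfolding sum_d by (simp add: ta_def)

lemma sum_ta_sq:
  fixes F :: "nat \<Rightarrow> real"
  shows "(\<Sum>e<d. (ta e)\<^sup>2 * F (e div 2)) = 2 * (\<Sum>i<n. F i)"
  unfolding sum_d by (simp add: ta_def sum_distrib_left)

lemma sum_pairs_le:
  fixes F :: "nat \<Rightarrow> real"
  assumes "\<And>e. 0 \<le> F e"
  shows "(\<Sum>i<n. F (2*i) + F (2*i+1)) \<le> (\<Sum>e<d. F e)"
  unfolding sum_d using assms by simp

lemma pos_pairs_le:
  fixes F :: "nat \<Rightarrow> real"
  assumes "\<And>x. 0 \<le> F x"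
  shows "(\<Sum>i<n. F (pos (2*i)) + F (pos (2*i+1))) \<le> (\<Sum>x<d*m. F x)"
proof -
  have "(\<Sum>i<n. F (pos (2*i)) + F (pos (2*i+1))) \<le> (\<Sum>e<d. F (pos e))"
    by (rule sum_pairs_le) (rule assms)
  also have "\<dots> = (\<Sum>x\<in>pos ` {..<d}. F x)"
    by (subst sum.reindex) (auto intro: inj_on_subset[OF pos_inj])
  also have "\<dots> \<le> (\<Sum>x<d*m. F x)"
    by (rule sum_mono2) (auto intro: pos_less assms)
  finally show ?thesis .
qed

lemma pair_diff_le:
  "(\<Sum>i<n. \<Sum>s\<in>Pow {..<n}. (cmod (\<psi> s (pos (2*i)) - \<psi> s (pos (2*i+1))))\<^sup>2) \<le> 2 * sqn n (d*m) \<psi>"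
proof -
  have "(\<Sum>i<n. (cmod (\<psi> s (pos (2*i)) - \<psi> s (pos (2*i+1))))\<^sup>2) \<le> 2 * (\<Sum>x<d*m. (cmod (\<psi> s x))\<^sup>2)" for s
  proof -
    have "(\<Sum>i<n. (cmod (\<psi> s (pos (2*i)) - \<psi> s (pos (2*i+1))))\<^sup>2)
        \<le> (\<Sum>i<n. 2 * (cmod (\<psi> s (pos (2*i))))\<^sup>2 + 2 * (cmod (\<psi> s (pos (2*i+1))))\<^sup>2)"
      by (intro sum_mono norm_diff_sq)
    also have "\<dots> = 2 * (\<Sum>i<n. (cmod (\<psi> s (pos (2*i))))\<^sup>2 + (cmod (\<psi> s (pos (2*i+1))))\<^sup>2)"
      by (simp add: sum_distrib_left)
    also have "\<dots> \<le> 2 * (\<Sum>x<d*m. (cmod (\<psi> s x))\<^sup>2)"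
      using pos_pairs_le[of "\<lambda>x. (cmod (\<psi> s x))\<^sup>2"] by simp
    finally show ?thesis .
  qed
  then show ?thesis unfolding sqn_def sum_distrib_left
    by (subst sum.swap) (intro sum_mono, simp add: sum_distrib_left)
qed

lemma ab_le1: "0 \<le> 2 * a * b" "2 * a * b \<le> 1"
proof -
  show "0 \<le> 2 * a * b" using b0 ba by simp
  show "2 * a * b \<le> 1" using sum_squares_bound[of a b] ab1 by simp
qed

lemma p_far_dist: "is_distribution d (p_far s)"
proof -
  have "0 \<le> p_far s e" for e
    using ab_le1 unfolding p_far_def ta_def by (intro divide_nonneg_nonneg) auto
  moreover have "(\<Sum>e<d. p_far s e) = 1"
  proof -
    have "(\<Sum>e<d. p_far s e) = ((\<Sum>i<n. 2) + (if odd d then 1 else 0)) / real d"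
      unfolding sum_d p_far_def by (simp add: ta_def add_divide_distrib diff_divide_distrib)
    also have "(\<Sum>i<n. 2::real) + (if odd d then 1 else 0) = real d"
    proof -
      have "d = 2 * n + (if odd d then 1 else 0)" by (simp add: n_def)
      then have "real d = real (2 * n + (if odd d then 1 else 0))" by (rule arg_cong)
      then show ?thesis by (simp split: if_splits)
    qed
    finally show ?thesis using dpos by simp
  qed
  ultimately show ?thesis by (simp add: is_distribution_def)
qed

lemma p_far_l1: "l1_dist_uniform d (p_far s) \<ge> a * b"
proof -
  have t: "\<bar>p_far s e - 1 / real d\<bar> = 2 * a * b * (ta e)\<^sup>2 / real d" for e
    using ab_le1(1) dpos by (auto simp: p_far_def ta_def add_divide_distrib diff_divide_distrib)
  have "l1_dist_uniform d (p_far s) = (\<Sum>e<d. (ta e)\<^sup>2 * (2 * a * b / real d))"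
    unfolding l1_dist_uniform_def t by (simp add: mult.commute)
  also have "\<dots> = 2 * (\<Sum>i<n. 2 * a * b / real d)"
    by (rule sum_ta_sq[of "\<lambda>_. 2 * a * b / real d"])
  also have "\<dots> = a * b * (4 * real n / real d)" by simp
  also have "\<dots> \<ge> a * b * 1"
  proof (rule mult_left_mono)
    \<comment> \<open>Even for odd d at least half of the elements are paired.\<close>
    have "d \<le> 4 * n" using d2 by (simp add: n_def)
    then show "1 \<le> 4 * real n / real d" using dpos by simp
  qed (use ab_le1 in simp)
  finally show ?thesis by simp
qed

lemma far_oracle:
  "purified_oracle d m (p_far s) (refl_mat (amp_far s))" "unit_amp (amp_far s)"
proof -
  have s: "sqrt (1 + 2 * a * b) = a + b" "sqrt (1 - 2 * a * b) = a - b"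
  proof -
    have "1 + 2 * a * b = (a + b)\<^sup>2" "1 - 2 * a * b = (a - b)\<^sup>2"
      using ab1 by (simp_all add: power2_sum power2_diff)
    then show "sqrt (1 + 2 * a * b) = a + b" "sqrt (1 - 2 * a * b) = a - b"
      using b0 ba by simp_all
  qed
  have *: "amp_far s e = complex_of_real (sqrt (p_far s e)) * 1" for e
  proof -
    have s': "sqrt (p_far s e) = al e + \<beta> * ta e * (if e div 2 \<in> s then 1 else -1)"
      by (cases "e < 2 * n"; cases "even e"; cases "e div 2 \<in> s")
         (simp_all add: p_far_def al_def ta_def \<beta>_def real_sqrt_divide s flip: add_divide_distrib diff_divide_distrib)
    show ?thesis unfolding s' by (simp add: amp_far_def sg_def)
  qed
  show "purified_oracle d m (p_far s) (refl_mat (amp_far s))" "unit_amp (amp_far s)"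
    using refl_mat_purified_oracle[OF p_far_dist[of s], of "amp_far s" "\<lambda>_. 1"] * by auto
qed

text \<open>The numbers a \<plusminus> \<i>b have modulus 1, so the signs only affect phases and
  every sign vector yields an oracle for the uniform distribution.\<close>

lemma unif_oracle:
  "purified_oracle d m (\<lambda>e. 1 / real d) (refl_mat (amp_unif s))" "unit_amp (amp_unif s)"
proof -
  have dist: "is_distribution d (\<lambda>e. 1 / real d)" using dpos by (simp add: is_distribution_def)
  define u where "u e = of_real (sqrt (real d)) * amp_unif s e" for e
  have *: "amp_unif s e = complex_of_real (sqrt (1 / real d)) * u e" for e
    using dpos by (simp add: u_def real_sqrt_divide flip: of_real_mult)
  have nu: "cmod (u e) = 1" for e
  proof -
    have "u e = of_real (if e < 2 * n then a else 1) + \<i> * of_real (b * ta e) * sg s (e div 2)"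
    proof -
      have r: "sqrt (real d) * al e = (if e < 2 * n then a else 1)" "sqrt (real d) * (\<beta> * ta e) = b * ta e"
        using dpos by (simp_all add: al_def \<beta>_def)
      have "u e = of_real (sqrt (real d) * al e) + \<i> * of_real (sqrt (real d) * (\<beta> * ta e)) * sg s (e div 2)"
        by (simp add: u_def amp_unif_def algebra_simps)
      then show ?thesis unfolding r .
    qed
    moreover have "(cmod (of_real x + \<i> * of_real y * sg s i))\<^sup>2 = x\<^sup>2 + y\<^sup>2" for x y i
      unfolding cmod_power2 by (simp add: sg_def)
    ultimately have "(cmod (u e))\<^sup>2 = (if e < 2 * n then a else 1)\<^sup>2 + (b * ta e)\<^sup>2" by metis
    also have "\<dots> = 1" using ab1 by (simp add: ta_def)
    finally have "(cmod (u e))\<^sup>2 = 1" .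
    then show ?thesis using power2_eq_imp_eq[of "cmod (u e)" 1] by simp
  qed
  show "purified_oracle d m (\<lambda>e. 1 / real d) (refl_mat (amp_unif s))" "unit_amp (amp_unif s)"
    using refl_mat_purified_oracle[OF dist, of "amp_unif s" u] * nu by auto
qed

lemma \<beta>_nonneg: "0 \<le> \<beta>" and \<beta>_sq: "\<beta>\<^sup>2 = b\<^sup>2 / real d" and \<beta>_sq_le: "\<beta>\<^sup>2 \<le> 1"
proof -
  show "0 \<le> \<beta>" using b0 by (simp add: \<beta>_def)
  show *: "\<beta>\<^sup>2 = b\<^sup>2 / real d" by (simp add: \<beta>_def power_divide)
  have "b\<^sup>2 \<le> 1" using ab1 zero_le_power2[of a] by linarith
  moreover have "1 \<le> real d" using d2 by simp
  ultimately have "b\<^sup>2 \<le> real d" by linarith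
  then show "\<beta>\<^sup>2 \<le> 1" unfolding * using dpos by simp
qed

text \<open>A flip of sign i moves only the two amplitudes of pair i, by opposite amounts of modulus
  2\<beta>.\<close>

lemma sum_amp_tog:
  "ip (amp_far s) y - ip (amp_far (tog i s)) y
     = (if i < n then - 2 * of_real \<beta> * sg s i * (y (pos (2*i)) - y (pos (2*i+1))) else 0)"
proof -
  have e: "ip (amp_far s) y = y 0 - (\<Sum>e<d. of_real (al e) * y (pos e))
      - of_real \<beta> * (\<Sum>i<n. sg s i * (y (pos (2*i)) - y (pos (2*i+1))))" for s
  proof -
    have "(\<Sum>e<d. cnj (amp_far s e) * y (pos e))
      = (\<Sum>e<d. of_real (al e) * y (pos e)) + of_real \<beta> * (\<Sum>e<d. of_real (ta e) * (sg s (e div 2) * y (pos e)))"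
      by (simp add: amp_far_def sum.distrib sum_distrib_left algebra_simps)
    then show ?thesis unfolding ip_eq sum_ta by (simp add: algebra_simps)
  qed
  have "(\<Sum>j<n. sg s j * (y (pos (2*j)) - y (pos (2*j+1)))) - (\<Sum>j<n. sg (tog i s) j * (y (pos (2*j)) - y (pos (2*j+1))))
     = (\<Sum>j<n. if j = i then 2 * sg s i * (y (pos (2*i)) - y (pos (2*i+1))) else 0)"
    unfolding sum_subtractf[symmetric] by (intro sum.cong refl) (auto simp: sg_tog algebra_simps)
  then have *: "(\<Sum>j<n. sg s j * (y (pos (2*j)) - y (pos (2*j+1)))) - (\<Sum>j<n. sg (tog i s) j * (y (pos (2*j)) - y (pos (2*j+1))))
     = (if i < n then 2 * sg s i * (y (pos (2*i)) - y (pos (2*i+1))) else 0)" by simp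
  have "ip (amp_far s) y - ip (amp_far (tog i s)) y = - of_real \<beta> *
     ((\<Sum>j<n. sg s j * (y (pos (2*j)) - y (pos (2*j+1)))) - (\<Sum>j<n. sg (tog i s) j * (y (pos (2*j)) - y (pos (2*j+1)))))"
    unfolding e by (simp add: algebra_simps)
  then show ?thesis unfolding * by simp
qed

text \<open>The change under a flip splits into a change of the state, bounded by Cauchy-Schwarz
  with the squared norm 2 of v, and a change of v. The latter sees only pair i, so that over all i
  it costs a single multiple of the norm of the state.\<close>

lemma infl_ip:
  "(\<Sum>i<n. \<Sum>s\<in>Pow {..<n}. (cmod (ip (amp_far s) (\<psi> s) - ip (amp_far (tog i s)) (\<psi> (tog i s))))\<^sup>2)
    \<le> 4 * infl n (d*m) \<psi> + 16 * \<beta>\<^sup>2 * sqn n (d*m) \<psi>"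
proof -
  let ?E = "Pow {..<n}"
  let ?w = "\<lambda>i s. \<psi> s (pos (2*i)) - \<psi> s (pos (2*i+1))"
  have pt: "(cmod (ip (amp_far s) (\<psi> s) - ip (amp_far (tog i s)) (\<psi> (tog i s))))\<^sup>2
      \<le> 4 * (\<Sum>x<d*m. (cmod (\<psi> s x - \<psi> (tog i s) x))\<^sup>2) + 8 * \<beta>\<^sup>2 * (cmod (?w i (tog i s)))\<^sup>2"
    if "i < n" for i s
  proof -
    have "ip (amp_far s) (\<psi> s) - ip (amp_far (tog i s)) (\<psi> (tog i s))
       = ip (amp_far s) (\<lambda>x. \<psi> s x - \<psi> (tog i s) x)
         + (ip (amp_far s) (\<psi> (tog i s)) - ip (amp_far (tog i s)) (\<psi> (tog i s)))"
      by (simp add: ip_def algebra_simps sum_subtractf)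
    then have "(cmod (ip (amp_far s) (\<psi> s) - ip (amp_far (tog i s)) (\<psi> (tog i s))))\<^sup>2
       \<le> 2 * (cmod (ip (amp_far s) (\<lambda>x. \<psi> s x - \<psi> (tog i s) x)))\<^sup>2
         + 2 * (cmod (- 2 * of_real \<beta> * sg s i * ?w i (tog i s)))\<^sup>2"
      using sum_amp_tog[of s "\<psi> (tog i s)" i] that by (simp only: if_True norm_add_sq)
    also have "(cmod (- 2 * of_real \<beta> * sg s i * ?w i (tog i s)))\<^sup>2 = 4 * \<beta>\<^sup>2 * (cmod (?w i (tog i s)))\<^sup>2"
      by (simp add: norm_mult power_mult_distrib)
    finally show ?thesis using ip_bound[OF far_oracle(2), of s "\<lambda>x. \<psi> s x - \<psi> (tog i s) x"] by simp
  qed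
  have "(\<Sum>i<n. \<Sum>s\<in>?E. (cmod (ip (amp_far s) (\<psi> s) - ip (amp_far (tog i s)) (\<psi> (tog i s))))\<^sup>2)
     \<le> (\<Sum>i<n. \<Sum>s\<in>?E. 4 * (\<Sum>x<d*m. (cmod (\<psi> s x - \<psi> (tog i s) x))\<^sup>2) + 8 * \<beta>\<^sup>2 * (cmod (?w i (tog i s)))\<^sup>2)"
    by (intro sum_mono pt) simp
  also have "\<dots> = 4 * infl n (d*m) \<psi> + 8 * \<beta>\<^sup>2 * (\<Sum>i<n. \<Sum>s\<in>?E. (cmod (?w i (tog i s)))\<^sup>2)"
    by (simp add: sum.distrib infl_def sqn_def sum_distrib_left)
  also have "(\<Sum>i<n. \<Sum>s\<in>?E. (cmod (?w i (tog i s)))\<^sup>2) = (\<Sum>i<n. \<Sum>s\<in>?E. (cmod (?w i s))\<^sup>2)"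
  proof (rule sum.cong[OF refl])
    fix i assume "i \<in> {..<n}"
    then show "(\<Sum>s\<in>?E. (cmod (?w i (tog i s)))\<^sup>2) = (\<Sum>s\<in>?E. (cmod (?w i s))\<^sup>2)"
      by (intro sum_tog) simp
  qed
  also have "\<dots> \<le> 2 * sqn n (d*m) \<psi>" by (rule pair_diff_le)
  finally show ?thesis by (simp add: mult_left_mono)
qed

text \<open>Rotating after a far query and querying the uniform oracle after rotating differ in two
  places: the incoming inner product (\<open>h\<close> against \<open>g\<close>) and the outgoing
  vector (\<open>X\<close>). \<open>creation_bound\<close> controls the first, the influence of
  \<open>h\<close> the second.\<close>

lemma slice_error:
  fixes \<psi> :: "nat set \<Rightarrow> nat \<Rightarrow> complex"
  shows "sqn n (d*m) (\<lambda>s x. Jst n (\<lambda>s x. \<psi> s x - vec (amp_far s) x * ip (amp_far s) (\<psi> s)) s x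
           - (Jst n \<psi> s x - vec (amp_unif s) x * ip (amp_unif s) (Jst n \<psi> s)))
       \<le> \<beta>\<^sup>2 * (24 * infl n (d*m) \<psi> + 96 * sqn n (d*m) \<psi>)"
proof -
  let ?E = "Pow {..<n}"
  define f where "f = Jst n \<psi>"
  define h1 where "h1 s = ip (amp_far s) (\<psi> s)" for s
  define h where "h = Jop n h1"
  define g where "g s = ip (amp_unif s) (f s)" for s
  \<comment> \<open>Rotating the product of \<open>amp_far\<close> and \<open>h1\<close> evaluates
    \<open>h\<close> at the flipped signs, whereas \<open>amp_unif\<close> multiplies
    \<open>h\<close> at s itself. The error disappears where \<open>h\<close> does not depend on the
    sign concerned.\<close>
  define X where "X s x = (if x \<in> pos ` {..<d} then
      \<i> * of_real (\<beta> * ta (x div m)) * sg s ((x div m) div 2) * (h (tog ((x div m) div 2) s) - h s) else 0)" for s x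
  define w where "w i s = f s (pos (2*i)) - f s (pos (2*i+1))" for i s
  have Jamp: "Jop n (\<lambda>s. amp_far s e * F s) s
      = of_real (al e) * Jop n F s + \<i> * of_real (\<beta> * ta e) * sg s (e div 2) * Jop n F (tog (e div 2) s)" for e F s
  proof -
    have "Jop n (\<lambda>s. amp_far s e * F s) s = of_real (al e) * Jop n F s
        + of_real (\<beta> * ta e) * Jop n (\<lambda>s. sg s (e div 2) * F s) s"
      using Jop_lin[of n "of_real (al e)" F "of_real (\<beta> * ta e)" "\<lambda>s. sg s (e div 2) * F s"]
      by (simp add: amp_far_def algebra_simps)
    moreover have "ta e = 0 \<or> e div 2 < n" by (auto simp: ta_def)
    ultimately show ?thesis using Jop_sg[of "e div 2" n F s] by (auto simp: algebra_simps)
  qed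
  have hs: "h s = f s 0 - (\<Sum>e<d. of_real (al e) * f s (pos e)
        + \<i> * of_real (\<beta> * ta e) * sg s (e div 2) * f (tog (e div 2) s) (pos e))" for s
  proof -
    have "h1 = (\<lambda>s. \<psi> s 0 - (\<Sum>e<d. amp_far s e * \<psi> s (pos e)))"
      by (simp add: h1_def ip_eq amp_far_def fun_eq_iff)
    then show ?thesis by (simp add: h_def Jop_diff Jop_sum Jamp f_def Jst_def)
  qed
  have gs: "g s = f s 0 - (\<Sum>e<d. of_real (al e) * f s (pos e)
        - \<i> * of_real (\<beta> * ta e) * sg s (e div 2) * f s (pos e))" for s
    by (simp add: g_def ip_eq amp_unif_def algebra_simps)
  \<comment> \<open>The inner product conjugates \<open>amp_unif\<close> and so carries -\<i>, while
    rotating the real far amplitudes produces +\<i>. Hence the two sign terms add up instead of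
    cancelling, even on states independent of the signs; the near orthogonality of the summands
    keeps the result small.\<close>
  have hg: "h s - g s = - (\<i> * of_real \<beta>) * (\<Sum>i<n. sg s i * (w i s + w i (tog i s)))" for s
  proof -
    have "h s - g s = - (\<i> * of_real \<beta>) *
        (\<Sum>e<d. of_real (ta e) * (sg s (e div 2) * (f s (pos e) + f (tog (e div 2) s) (pos e))))"
      unfolding hs gs by (simp add: sum_distrib_left algebra_simps sum.distrib sum_subtractf sum_negf)
    then show ?thesis unfolding sum_ta by (simp add: w_def algebra_simps)
  qed
  have hg_bound: "(\<Sum>s\<in>?E. (cmod (h s - g s))\<^sup>2) \<le> \<beta>\<^sup>2 * (2 * infl n (d*m) \<psi> + 8 * sqn n (d*m) \<psi>)"
  proof -
    have "(\<Sum>s\<in>?E. (cmod (h s - g s))\<^sup>2)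
        = \<beta>\<^sup>2 * (\<Sum>s\<in>?E. (cmod (\<Sum>i<n. sg s i * (w i s + w i (tog i s))))\<^sup>2)"
      unfolding hg norm_mult power_mult_distrib sum_distrib_left[symmetric] by (simp add: norm_mult)
    also have "\<dots> \<le> \<beta>\<^sup>2 * ((\<Sum>i<n. \<Sum>j<n. \<Sum>s\<in>?E. (cmod (w i s - w i (tog j s)))\<^sup>2)
        + 4 * (\<Sum>i<n. \<Sum>s\<in>?E. (cmod (w i s))\<^sup>2))"
      by (intro mult_left_mono creation_bound) simp
    also have "\<dots> \<le> \<beta>\<^sup>2 * (2 * infl n (d*m) f + 4 * (2 * sqn n (d*m) f))"
    proof (intro mult_left_mono add_mono)
      have "(\<Sum>i<n. \<Sum>j<n. \<Sum>s\<in>?E. (cmod (w i s - w i (tog j s)))\<^sup>2)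
         = (\<Sum>j<n. \<Sum>i<n. \<Sum>s\<in>?E. (cmod ((f s (pos (2*i)) - f (tog j s) (pos (2*i)))
              - (f s (pos (2*i+1)) - f (tog j s) (pos (2*i+1)))))\<^sup>2)"
        by (subst sum.swap) (simp add: w_def algebra_simps)
      also have "\<dots> \<le> (\<Sum>j<n. 2 * sqn n (d*m) (\<lambda>s x. f s x - f (tog j s) x))"
        by (intro sum_mono pair_diff_le)
      finally show "(\<Sum>i<n. \<Sum>j<n. \<Sum>s\<in>?E. (cmod (w i s - w i (tog j s)))\<^sup>2) \<le> 2 * infl n (d*m) f"
        by (simp add: infl_def sum_distrib_left)
      show "(\<Sum>i<n. \<Sum>s\<in>?E. (cmod (w i s))\<^sup>2) \<le> 2 * sqn n (d*m) f"
        unfolding w_def by (rule pair_diff_le)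
    qed simp_all
    finally show ?thesis by (simp add: f_def infl_Jst sqn_Jst)
  qed
  have h_infl: "(\<Sum>i<n. \<Sum>s\<in>?E. (cmod (h (tog i s) - h s))\<^sup>2) \<le> 4 * infl n (d*m) \<psi> + 16 * \<beta>\<^sup>2 * sqn n (d*m) \<psi>"
  proof -
    have "(\<Sum>s\<in>?E. (cmod (h (tog i s) - h s))\<^sup>2) = (\<Sum>s\<in>?E. (cmod (h1 s - h1 (tog i s)))\<^sup>2)" for i
    proof -
      have "h s - h (tog i s) = Jop n (\<lambda>s. h1 s - h1 (tog i s)) s" for s
        by (simp add: h_def Jop_diff Jop_tog)
      then have "cmod (h (tog i s) - h s) = cmod (Jop n (\<lambda>s. h1 s - h1 (tog i s)) s)" for s
        by (metis norm_minus_commute)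
      then show ?thesis by (simp add: Jop_norm)
    qed
    then show ?thesis using infl_ip[of \<psi>] by (simp add: h1_def)
  qed
  have err: "Jst n (\<lambda>s x. \<psi> s x - vec (amp_far s) x * ip (amp_far s) (\<psi> s)) s x
           - (Jst n \<psi> s x - vec (amp_unif s) x * ip (amp_unif s) (Jst n \<psi> s))
       = - vec (amp_unif s) x * (h s - g s) + X s x" for s x
  proof -
    have 1: "Jst n (\<lambda>s x. \<psi> s x - vec (amp_far s) x * ip (amp_far s) (\<psi> s)) s x
        = f s x - Jop n (\<lambda>s. vec (amp_far s) x * h1 s) s"
      by (simp add: Jst_def Jop_diff f_def h1_def)
    consider "x = 0" | e where "e < d" "x = pos e" | "x \<noteq> 0" "x \<notin> pos ` {..<d}" by auto
    then have 2: "Jop n (\<lambda>s. vec (amp_far s) x * h1 s) s = vec (amp_unif s) x * h s - X s x"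
    proof cases
      case 1
      have "0 \<notin> pos ` {..<d}" using pos_nonzero by (auto simp: image_iff dest: sym)
      then show ?thesis using 1 by (simp add: vec_simps X_def h_def)
    next
      case 2
      have "Jop n (\<lambda>s. vec (amp_far s) x * h1 s) s = - Jop n (\<lambda>s. amp_far s e * h1 s) s"
        using 2 Jop_scale[of n "-1" "\<lambda>s. amp_far s e * h1 s"] by (simp add: vec_simps)
      also have "\<dots> = vec (amp_unif s) x * h s - X s x"
        unfolding Jamp h_def[symmetric] using 2
        by (simp add: vec_simps X_def pos_div amp_unif_def algebra_simps)
      finally show ?thesis .
    next
      case 3
      then show ?thesis using Jop_scale[of n 0] by (simp add: vec_zero X_def)
    qed
    show ?thesis unfolding 1 2 f_def[symmetric] g_def[symmetric] by (simp add: algebra_simps)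
  qed
  have Xs: "(\<Sum>x<d*m. (cmod (X s x))\<^sup>2) = 2 * \<beta>\<^sup>2 * (\<Sum>i<n. (cmod (h (tog i s) - h s))\<^sup>2)" for s
  proof -
    have "(\<Sum>x<d*m. (cmod (X s x))\<^sup>2) = (\<Sum>e<d. (cmod (X s (pos e)))\<^sup>2)"
    proof -
      have "0 \<notin> pos ` {..<d}" using pos_nonzero by (auto simp: image_iff dest: sym)
      then show ?thesis by (subst sum_support) (auto simp: X_def)
    qed
    also have "\<dots> = (\<Sum>e<d. (ta e)\<^sup>2 * (\<beta>\<^sup>2 * (cmod (h (tog (e div 2) s) - h s))\<^sup>2))"
      by (intro sum.cong refl) (simp add: X_def pos_div norm_mult power_mult_distrib)
    also have "\<dots> = 2 * \<beta>\<^sup>2 * (\<Sum>i<n. (cmod (h (tog i s) - h s))\<^sup>2)"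
      by (subst sum_ta_sq[of "\<lambda>i. \<beta>\<^sup>2 * (cmod (h (tog i s) - h s))\<^sup>2"]) (simp add: sum_distrib_left mult.assoc)
    finally show ?thesis .
  qed
  have "(\<Sum>x<d*m. (cmod (- vec (amp_unif s) x * (h s - g s) + X s x))\<^sup>2)
      \<le> 4 * (cmod (h s - g s))\<^sup>2 + 4 * \<beta>\<^sup>2 * (\<Sum>i<n. (cmod (h (tog i s) - h s))\<^sup>2)" for s
  proof -
    have "(\<Sum>x<d*m. (cmod (- vec (amp_unif s) x * (h s - g s) + X s x))\<^sup>2)
       \<le> (\<Sum>x<d*m. 2 * ((cmod (vec (amp_unif s) x))\<^sup>2 * (cmod (h s - g s))\<^sup>2) + 2 * (cmod (X s x))\<^sup>2)"
      by (intro sum_mono order_trans[OF norm_add_sq]) (simp add: norm_mult power_mult_distrib)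
    also have "\<dots> = 2 * ((\<Sum>x<d*m. (cmod (vec (amp_unif s) x))\<^sup>2) * (cmod (h s - g s))\<^sup>2) + 2 * (\<Sum>x<d*m. (cmod (X s x))\<^sup>2)"
      by (simp add: sum.distrib sum_distrib_left sum_distrib_right)
    finally show ?thesis unfolding Xs vec_norm[OF unif_oracle(2)] by simp
  qed
  then have "sqn n (d*m) (\<lambda>s x. - vec (amp_unif s) x * (h s - g s) + X s x)
      \<le> (\<Sum>s\<in>?E. 4 * (cmod (h s - g s))\<^sup>2 + 4 * \<beta>\<^sup>2 * (\<Sum>i<n. (cmod (h (tog i s) - h s))\<^sup>2))"
    unfolding sqn_def by (intro sum_mono)
  also have "\<dots> = 4 * (\<Sum>s\<in>?E. (cmod (h s - g s))\<^sup>2) + 4 * \<beta>\<^sup>2 * (\<Sum>i<n. \<Sum>s\<in>?E. (cmod (h (tog i s) - h s))\<^sup>2)"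
    by (subst sum.swap) (simp add: sum.distrib sum_distrib_left)
  also have "\<dots> \<le> 4 * (\<beta>\<^sup>2 * (2 * infl n (d*m) \<psi> + 8 * sqn n (d*m) \<psi>))
      + 4 * \<beta>\<^sup>2 * (4 * infl n (d*m) \<psi> + 16 * \<beta>\<^sup>2 * sqn n (d*m) \<psi>)"
    by (intro add_mono mult_left_mono hg_bound h_infl) simp_all
  \<comment> \<open>The term of fourth order in \<beta> is absorbed by bounding one squared \<beta>
    by 1.\<close>
  also have "\<dots> \<le> 4 * (\<beta>\<^sup>2 * (2 * infl n (d*m) \<psi> + 8 * sqn n (d*m) \<psi>))
      + 4 * \<beta>\<^sup>2 * (4 * infl n (d*m) \<psi> + 16 * 1 * sqn n (d*m) \<psi>)"
    by (intro add_mono mult_left_mono mult_right_mono \<beta>_sq_le sqn_nonneg) simp_all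
  also have "\<dots> = \<beta>\<^sup>2 * (24 * infl n (d*m) \<psi> + 96 * sqn n (d*m) \<psi>)" by (simp add: algebra_simps)
  finally show ?thesis unfolding err .
qed

text \<open>Bounds the influence that one query creates by comparing two oracles with neighbouring
  signs on the same input. Each pair costs a multiple of b^2/d, and there are at most d/2
  pairs.\<close>

lemma slice_growth:
  fixes y :: "nat set \<Rightarrow> nat \<Rightarrow> complex"
  shows "(\<Sum>i<n. sqn n (d*m) (\<lambda>s x. vec (amp_far s) x * ip (amp_far s) (y (tog i s))
            - vec (amp_far (tog i s)) x * ip (amp_far (tog i s)) (y (tog i s))))
      \<le> 36 * b\<^sup>2 * sqn n (d*m) y"
proof -
  let ?E = "Pow {..<n}"
  let ?w = "\<lambda>i s. y s (pos (2*i)) - y s (pos (2*i+1))"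
  have vd: "(\<Sum>x<d*m. (cmod (vec (amp_far s) x - vec (amp_far (tog i s)) x))\<^sup>2) = 8 * \<beta>\<^sup>2" if i: "i < n" for i s
  proof -
    have "(\<Sum>x<d*m. (cmod (vec (amp_far s) x - vec (amp_far (tog i s)) x))\<^sup>2)
        = (\<Sum>e<d. (cmod (amp_far (tog i s) e - amp_far s e))\<^sup>2)"
      by (subst sum_support) (auto simp: vec_zero vec_simps)
    also have "\<dots> = (\<Sum>e<d. (ta e)\<^sup>2 * (if e div 2 = i then 4 * \<beta>\<^sup>2 else 0))"
    proof (intro sum.cong refl)
      fix e
      have "amp_far (tog i s) e - amp_far s e = of_real (ta e) * (if e div 2 = i then of_real (- 2 * \<beta>) * sg s i else 0)"
        by (auto simp: amp_far_def sg_tog)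
      then show "(cmod (amp_far (tog i s) e - amp_far s e))\<^sup>2 = (ta e)\<^sup>2 * (if e div 2 = i then 4 * \<beta>\<^sup>2 else 0)"
        by (simp add: norm_mult power_mult_distrib)
    qed
    also have "\<dots> = 8 * \<beta>\<^sup>2"
      by (subst sum_ta_sq[of "\<lambda>j. if j = i then 4 * \<beta>\<^sup>2 else 0"]) (use i in simp)
    finally show ?thesis .
  qed
  have pt: "(\<Sum>x<d*m. (cmod (vec (amp_far s) x * ip (amp_far s) (y (tog i s))
            - vec (amp_far (tog i s)) x * ip (amp_far (tog i s)) (y (tog i s))))\<^sup>2)
      \<le> 32 * \<beta>\<^sup>2 * (\<Sum>x<d*m. (cmod (y (tog i s) x))\<^sup>2) + 16 * \<beta>\<^sup>2 * (cmod (?w i (tog i s)))\<^sup>2"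
    if i: "i < n" for i s
  proof -
    let ?p = "ip (amp_far s) (y (tog i s))" let ?q = "ip (amp_far (tog i s)) (y (tog i s))"
    have pq: "(cmod (?p - ?q))\<^sup>2 = 4 * \<beta>\<^sup>2 * (cmod (?w i (tog i s)))\<^sup>2"
      using i by (simp add: sum_amp_tog norm_mult power_mult_distrib)
    have "vec (amp_far s) x * ?p - vec (amp_far (tog i s)) x * ?q
       = (vec (amp_far s) x - vec (amp_far (tog i s)) x) * ?p + vec (amp_far (tog i s)) x * (?p - ?q)" for x
      by (simp add: algebra_simps)
    then have "(\<Sum>x<d*m. (cmod (vec (amp_far s) x * ?p - vec (amp_far (tog i s)) x * ?q))\<^sup>2)
      \<le> (\<Sum>x<d*m. 2 * ((cmod (vec (amp_far s) x - vec (amp_far (tog i s)) x))\<^sup>2 * (cmod ?p)\<^sup>2)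
         + 2 * ((cmod (vec (amp_far (tog i s)) x))\<^sup>2 * (cmod (?p - ?q))\<^sup>2))"
      by (intro sum_mono) (simp only:, rule order_trans[OF norm_add_sq], simp add: norm_mult power_mult_distrib)
    also have "\<dots> = 2 * ((\<Sum>x<d*m. (cmod (vec (amp_far s) x - vec (amp_far (tog i s)) x))\<^sup>2) * (cmod ?p)\<^sup>2)
         + 2 * ((\<Sum>x<d*m. (cmod (vec (amp_far (tog i s)) x))\<^sup>2) * (cmod (?p - ?q))\<^sup>2)"
      by (simp add: sum.distrib sum_distrib_left sum_distrib_right)
    also have "\<dots> = 16 * \<beta>\<^sup>2 * (cmod ?p)\<^sup>2 + 16 * \<beta>\<^sup>2 * (cmod (?w i (tog i s)))\<^sup>2"
      unfolding vd[OF i] vec_norm[OF far_oracle(2)] pq by simp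
    also have "\<dots> \<le> 16 * \<beta>\<^sup>2 * (2 * (\<Sum>x<d*m. (cmod (y (tog i s) x))\<^sup>2)) + 16 * \<beta>\<^sup>2 * (cmod (?w i (tog i s)))\<^sup>2"
      by (intro add_right_mono mult_left_mono ip_bound far_oracle) simp
    finally show ?thesis by simp
  qed
  have "(\<Sum>i<n. sqn n (d*m) (\<lambda>s x. vec (amp_far s) x * ip (amp_far s) (y (tog i s))
            - vec (amp_far (tog i s)) x * ip (amp_far (tog i s)) (y (tog i s))))
     \<le> (\<Sum>i<n. \<Sum>s\<in>?E. 32 * \<beta>\<^sup>2 * (\<Sum>x<d*m. (cmod (y (tog i s) x))\<^sup>2) + 16 * \<beta>\<^sup>2 * (cmod (?w i (tog i s)))\<^sup>2)"
    unfolding sqn_def by (intro sum_mono pt) simp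
  also have "\<dots> = (\<Sum>i<n. \<Sum>s\<in>?E. 32 * \<beta>\<^sup>2 * (\<Sum>x<d*m. (cmod (y s x))\<^sup>2) + 16 * \<beta>\<^sup>2 * (cmod (?w i s))\<^sup>2)"
  proof (rule sum.cong[OF refl])
    fix i assume "i \<in> {..<n}"
    then show "(\<Sum>s\<in>?E. 32 * \<beta>\<^sup>2 * (\<Sum>x<d*m. (cmod (y (tog i s) x))\<^sup>2) + 16 * \<beta>\<^sup>2 * (cmod (?w i (tog i s)))\<^sup>2)
      = (\<Sum>s\<in>?E. 32 * \<beta>\<^sup>2 * (\<Sum>x<d*m. (cmod (y s x))\<^sup>2) + 16 * \<beta>\<^sup>2 * (cmod (?w i s))\<^sup>2)"
      by (intro sum_tog[of i n "\<lambda>s. 32 * \<beta>\<^sup>2 * (\<Sum>x<d*m. (cmod (y s x))\<^sup>2) + 16 * \<beta>\<^sup>2 * (cmod (?w i s))\<^sup>2"]) simp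
  qed
  also have "\<dots> = 32 * (real n * \<beta>\<^sup>2) * sqn n (d*m) y + 16 * \<beta>\<^sup>2 * (\<Sum>i<n. \<Sum>s\<in>?E. (cmod (?w i s))\<^sup>2)"
    by (simp add: sum.distrib sqn_def sum_distrib_left mult_ac)
  also have "\<dots> \<le> 32 * (b\<^sup>2 / 2) * sqn n (d*m) y + 16 * (b\<^sup>2 / 2) * (2 * sqn n (d*m) y)"
  proof -
    have "2 * real n \<le> real d" by (metis n_def of_nat_le_iff of_nat_mult of_nat_numeral times_div_less_eq_dividend)
    then have "real n * \<beta>\<^sup>2 \<le> b\<^sup>2 / 2"
      using mult_right_mono[of "2 * real n" "real d" "b\<^sup>2"] dpos by (simp add: \<beta>_sq field_simps)
    moreover have "\<beta>\<^sup>2 \<le> b\<^sup>2 / 2"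
    proof -
      have "2 \<le> real d" using d2 by simp
      then show ?thesis unfolding \<beta>_sq by (intro divide_left_mono) auto
    qed
    ultimately show ?thesis
      using pair_diff_le[of y] sqn_nonneg[of n "d*m" y]
      by (intro add_mono mult_mono) (auto intro!: sum_nonneg)
  qed
  \<comment> \<open>The sum is 32 b^2; rounding up to 36 gives the square root 6b in
    \<open>infl_step\<close>.\<close>
  also have "\<dots> \<le> 36 * b\<^sup>2 * sqn n (d*m) y"
    using sqn_nonneg[of n "d*m" y] by (simp add: algebra_simps)
  finally show ?thesis .
qed

end

section \<open>Hybrid argument\<close>

lemma sqn_cong: "(\<And>s j. j < N \<Longrightarrow> \<psi> s j = \<chi> s j) \<Longrightarrow> sqn n N \<psi> = sqn n N \<chi>"
  by (simp add: sqn_def)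

text \<open>Minkowski's inequality over all triples (i, s, j).\<close>

lemma sqn_triangle_family:
  assumes "finite I"
  shows "sqrt (\<Sum>i\<in>I. sqn n N (\<lambda>s j. A i s j + B i s j))
    \<le> sqrt (\<Sum>i\<in>I. sqn n N (A i)) + sqrt (\<Sum>i\<in>I. sqn n N (B i))"
proof -
  let ?D = "I \<times> (Pow {..<n} \<times> {..<N})"
  have e: "sqrt (\<Sum>i\<in>I. sqn n N (F i)) = L2_set (\<lambda>(i, s, j). cmod (F i s j)) ?D" for F
    unfolding sqn_def L2_set_def by (simp add: sum.cartesian_product split_def)
  have "L2_set (\<lambda>(i, s, j). cmod (A i s j + B i s j)) ?D
      \<le> L2_set (\<lambda>z. (case z of (i, s, j) \<Rightarrow> cmod (A i s j)) + (case z of (i, s, j) \<Rightarrow> cmod (B i s j))) ?D"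
    by (rule L2_set_mono) (auto simp: norm_triangle_ineq)
  also have "\<dots> \<le> L2_set (\<lambda>(i, s, j). cmod (A i s j)) ?D + L2_set (\<lambda>(i, s, j). cmod (B i s j)) ?D"
    by (rule L2_set_triangle_ineq)
  finally show ?thesis unfolding e .
qed

lemma sqn_triangle:
  "sqrt (sqn n N (\<lambda>s j. \<psi> s j + \<chi> s j)) \<le> sqrt (sqn n N \<psi>) + sqrt (sqn n N \<chi>)"
  using sqn_triangle_family[of "{0::nat}" n N "\<lambda>_. \<psi>" "\<lambda>_. \<chi>"] by simp

lemma sqn_mat_apply:
  "unitary_on N V \<Longrightarrow> sqn n N (\<lambda>s. mat_apply N V (\<psi> s)) = sqn n N \<psi>"
  by (simp add: sqn_def mat_apply_norm)

text \<open>A unitary that is the same for all s commutes with taking differences along a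
  flip.\<close>

lemma infl_mat_apply:
  "unitary_on N V \<Longrightarrow> infl n N (\<lambda>s. mat_apply N V (\<psi> s)) = infl n N \<psi>"
  unfolding infl_def
  by (intro sum.cong refl)
     (subst sqn_mat_apply[symmetric], assumption, simp add: mat_apply_diff)

lemma Jst_mat_apply: "Jst n (\<lambda>s. mat_apply N V (\<psi> s)) s = mat_apply N V (Jst n \<psi> s)"
  by (simp add: fun_eq_iff Jst_def mat_apply_def Jop_sum Jop_scale)

text \<open>The initial state does not depend on the signs, so the rotation leaves it alone.\<close>

lemma Jop_const: "Jop n (\<lambda>s. c) = (\<lambda>s. c)"
  by (induction n) (simp_all add: Jstep_def fun_eq_iff field_simps)

context purified_model
begin

lemma sqn_slices:
  "sqn n (2*d*m*k) \<psi> = (\<Sum>c<2. \<Sum>w<k. sqn n (d*m) (\<lambda>s x. \<psi> s (idx c w x)))"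
  unfolding sqn_def by (rule sum_idx_swap)

lemma infl_slices:
  "infl n (2*d*m*k) \<psi> = (\<Sum>c<2. \<Sum>w<k. infl n (d*m) (\<lambda>s x. \<psi> s (idx c w x)))"
  unfolding infl_def sqn_slices
  by (subst sum.swap, rule sum.cong[OF refl], subst sum.swap, rule refl)

end

context paired_model
begin

text \<open>Sum of \<open>slice_error\<close> over the slices; where the query is inactive both
  orders agree exactly.\<close>

lemma step_error:
  "sqn n (2*d*m*k) (\<lambda>s j. Jst n (\<lambda>s. mat_apply (2*d*m*k) (qop (amp_far s) q) (\<psi> s)) s j
        - mat_apply (2*d*m*k) (qop (amp_unif s) q) (Jst n \<psi> s) j)
    \<le> \<beta>\<^sup>2 * (24 * infl n (2*d*m*k) \<psi> + 96 * sqn n (2*d*m*k) \<psi>)" (is "sqn n ?N ?\<Delta> \<le> _")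
proof -
  have "sqn n (d*m) (\<lambda>s x. ?\<Delta> s (idx c w x))
      \<le> \<beta>\<^sup>2 * (24 * infl n (d*m) (\<lambda>s x. \<psi> s (idx c w x)) + 96 * sqn n (d*m) (\<lambda>s x. \<psi> s (idx c w x)))"
    if cw: "c < 2" "w < k" for c w
  proof (cases "active q c")
    case True
    have "sqn n (d*m) (\<lambda>s x. ?\<Delta> s (idx c w x))
      = sqn n (d*m) (\<lambda>s x. Jst n (\<lambda>s x. \<psi> s (idx c w x) - vec (amp_far s) x * ip (amp_far s) (\<lambda>x. \<psi> s (idx c w x))) s x
           - (Jst n (\<lambda>s x. \<psi> s (idx c w x)) s x
              - vec (amp_unif s) x * ip (amp_unif s) (Jst n (\<lambda>s x. \<psi> s (idx c w x)) s)))"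
      by (rule sqn_cong) (simp add: Jst_def[abs_def] qop_apply cw True)
    then show ?thesis using slice_error[of "\<lambda>s x. \<psi> s (idx c w x)"] by simp
  next
    case False
    have "sqn n (d*m) (\<lambda>s x. ?\<Delta> s (idx c w x)) = sqn n (d*m) (\<lambda>s x. 0)"
      by (rule sqn_cong) (simp add: Jst_def[abs_def] qop_apply cw False)
    then show ?thesis by (simp add: sqn_def infl_nonneg sum_nonneg)
  qed
  then have "sqn n ?N ?\<Delta> \<le> (\<Sum>c<2. \<Sum>w<k. \<beta>\<^sup>2 * (24 * infl n (d*m) (\<lambda>s x. \<psi> s (idx c w x))
      + 96 * sqn n (d*m) (\<lambda>s x. \<psi> s (idx c w x))))"
    unfolding sqn_slices[of n ?\<Delta>] by (intro sum_mono) auto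
  also have "\<dots> = \<beta>\<^sup>2 * (24 * infl n ?N \<psi> + 96 * sqn n ?N \<psi>)"
    unfolding sqn_slices[of n \<psi>] infl_slices by (simp add: sum.distrib sum_distrib_left distrib_left)
  finally show ?thesis .
qed

lemma step_growth:
  "(\<Sum>i<n. sqn n (2*d*m*k) (\<lambda>s j. mat_apply (2*d*m*k) (qop (amp_far s) q) (\<psi> (tog i s)) j
        - mat_apply (2*d*m*k) (qop (amp_far (tog i s)) q) (\<psi> (tog i s)) j))
    \<le> 36 * b\<^sup>2 * sqn n (2*d*m*k) \<psi>" (is "(\<Sum>i<n. sqn n ?N (?\<Delta> i)) \<le> _")
proof -
  have "(\<Sum>i<n. sqn n (d*m) (\<lambda>s x. ?\<Delta> i s (idx c w x))) \<le> 36 * b\<^sup>2 * sqn n (d*m) (\<lambda>s x. \<psi> s (idx c w x))"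
    if cw: "c < 2" "w < k" for c w
  proof (cases "active q c")
    case True
    let ?y = "\<lambda>s x. \<psi> s (idx c w x)"
    have "sqn n (d*m) (\<lambda>s x. ?\<Delta> i s (idx c w x))
       = sqn n (d*m) (\<lambda>s x. vec (amp_far s) x * ip (amp_far s) (?y (tog i s))
            - vec (amp_far (tog i s)) x * ip (amp_far (tog i s)) (?y (tog i s)))" for i
      unfolding sqn_def
      by (intro sum.cong refl arg_cong[of _ _ "\<lambda>z. z\<^sup>2"])
         (simp add: qop_apply cw True norm_minus_commute)
    then show ?thesis using slice_growth[of ?y] by simp
  next
    case False
    have "sqn n (d*m) (\<lambda>s x. ?\<Delta> i s (idx c w x)) = sqn n (d*m) (\<lambda>s x. 0)" for i
      by (rule sqn_cong) (simp add: qop_apply cw False)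
    then show ?thesis by (simp add: sqn_def sum_nonneg)
  qed
  then have "(\<Sum>c<2. \<Sum>w<k. \<Sum>i<n. sqn n (d*m) (\<lambda>s x. ?\<Delta> i s (idx c w x)))
      \<le> (\<Sum>c<2. \<Sum>w<k. 36 * b\<^sup>2 * sqn n (d*m) (\<lambda>s x. \<psi> s (idx c w x)))"
    by (intro sum_mono) auto
  also have "\<dots> = 36 * b\<^sup>2 * sqn n ?N \<psi>" by (simp add: sqn_slices[of n \<psi>] sum_distrib_left)
  also have "(\<Sum>c<2. \<Sum>w<k. \<Sum>i<n. sqn n (d*m) (\<lambda>s x. ?\<Delta> i s (idx c w x))) = (\<Sum>i<n. sqn n ?N (?\<Delta> i))"
    unfolding sqn_slices by (rule sym, rule trans[OF sum.swap], rule sum.cong[OF refl], rule sum.swap)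
  finally show ?thesis .
qed

text \<open>The difference along a flip splits into one oracle applied to the difference of the
  states, which keeps the influence, and a difference of oracles on one state, bounded by
  \<open>step_growth\<close>.\<close>

lemma infl_step:
  "sqrt (infl n (2*d*m*k) (\<lambda>s. mat_apply (2*d*m*k) (qop (amp_far s) q) (\<psi> s)))
    \<le> sqrt (infl n (2*d*m*k) \<psi>) + 6 * b * sqrt (sqn n (2*d*m*k) \<psi>)"
proof -
  let ?N = "2*d*m*k"
  let ?O = "\<lambda>s. mat_apply ?N (qop (amp_far s) q)"
  have "infl n ?N (\<lambda>s. ?O s (\<psi> s))
     = (\<Sum>i<n. sqn n ?N (\<lambda>s j. ?O s (\<lambda>j. \<psi> s j - \<psi> (tog i s) j) j
          + (?O s (\<psi> (tog i s)) j - ?O (tog i s) (\<psi> (tog i s)) j)))"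
    by (simp add: infl_def mat_apply_diff)
  then have "sqrt (infl n ?N (\<lambda>s. ?O s (\<psi> s)))
     \<le> sqrt (\<Sum>i<n. sqn n ?N (\<lambda>s. ?O s (\<lambda>j. \<psi> s j - \<psi> (tog i s) j)))
      + sqrt (\<Sum>i<n. sqn n ?N (\<lambda>s j. ?O s (\<psi> (tog i s)) j - ?O (tog i s) (\<psi> (tog i s)) j))"
    using sqn_triangle_family[of "{..<n}" n ?N "\<lambda>i s. ?O s (\<lambda>j. \<psi> s j - \<psi> (tog i s) j)"
        "\<lambda>i s j. ?O s (\<psi> (tog i s)) j - ?O (tog i s) (\<psi> (tog i s)) j"] by simp
  also have "(\<Sum>i<n. sqn n ?N (\<lambda>s. ?O s (\<lambda>j. \<psi> s j - \<psi> (tog i s) j))) = infl n ?N \<psi>"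
    by (simp add: infl_def sqn_def qop_norm far_oracle)
  also have "sqrt (\<Sum>i<n. sqn n ?N (\<lambda>s j. ?O s (\<psi> (tog i s)) j - ?O (tog i s) (\<psi> (tog i s)) j))
      \<le> sqrt (36 * b\<^sup>2 * sqn n ?N \<psi>)"
    using step_growth by (rule real_sqrt_le_mono)
  also have "sqrt (36 * b\<^sup>2 * sqn n ?N \<psi>) = 6 * b * sqrt (sqn n ?N \<psi>)"
    using b0 by (simp add: real_sqrt_mult)
  finally show ?thesis by simp
qed

text \<open>The root of the influence grows by at most 6b times the norm per query, and each query
  adds an error linear in that root; the accumulated error is therefore quadratic in the number of
  queries. Both starting states are arbitrary so that the induction can peel off the first
  query.\<close>

lemma run_error:
  assumes "\<forall>qV\<in>set steps. unitary_on (2*d*m*k) (snd qV)"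
  shows "sqrt (sqn n (2*d*m*k) (\<lambda>s j. Jst n (\<lambda>s. run_steps (2*d*m*k) (qop (amp_far s)) steps (\<psi> s)) s j
            - run_steps (2*d*m*k) (qop (amp_unif s)) steps (\<chi> s) j))
    \<le> sqrt (sqn n (2*d*m*k) (\<lambda>s j. Jst n \<psi> s j - \<chi> s j))
      + \<beta> * (5 * (real (length steps) * sqrt (infl n (2*d*m*k) \<psi>)
                + 6 * b * (real (length steps))\<^sup>2 * sqrt (sqn n (2*d*m*k) \<psi>))
           + 10 * real (length steps) * sqrt (sqn n (2*d*m*k) \<psi>))"
  using assms
proof (induction steps arbitrary: \<psi> \<chi>)
  case Nil
  show ?case by simp
next
  case (Cons qV rest)
  let ?N = "2*d*m*k"
  obtain q V where qV: "qV = (q, V)" by force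
  have V: "unitary_on ?N V" using Cons.prems qV by simp
  define O1 where "O1 s = mat_apply ?N (qop (amp_far s) q) (\<psi> s)" for s
  define O2 where "O2 s = mat_apply ?N (qop (amp_unif s) q)" for s
  define \<psi>' where "\<psi>' s = mat_apply ?N V (O1 s)" for s
  define \<chi>' where "\<chi>' s = mat_apply ?N V (O2 s (\<chi> s))" for s
  define T where "T = real (length rest)"
  define K where "K = sqrt (infl n ?N \<psi>)"
  define X where "X = sqrt (sqn n ?N \<psi>)"
  have X0: "0 \<le> X" and K0: "0 \<le> K" by (simp_all add: X_def K_def sqn_nonneg infl_nonneg)
  have T0: "0 \<le> T" by (simp add: T_def)
  have X': "sqrt (sqn n ?N \<psi>') = X"
    unfolding \<psi>'_def[abs_def] sqn_mat_apply[OF V]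
    by (simp add: O1_def[abs_def] sqn_def qop_norm far_oracle X_def)
  have K': "sqrt (infl n ?N \<psi>') \<le> K + 6 * b * X"
    unfolding \<psi>'_def[abs_def] infl_mat_apply[OF V] unfolding O1_def[abs_def] K_def X_def by (rule infl_step)
  have "sqrt (sqn n ?N (\<lambda>s j. Jst n \<psi>' s j - \<chi>' s j))
      \<le> sqrt (sqn n ?N (\<lambda>s j. Jst n \<psi> s j - \<chi> s j)) + \<beta> * (5 * K + 10 * X)"
  proof -
    have "sqn n ?N (\<lambda>s j. Jst n \<psi>' s j - \<chi>' s j) = sqn n ?N (\<lambda>s. mat_apply ?N V (\<lambda>j. Jst n O1 s j - O2 s (\<chi> s) j))"
      by (simp add: \<psi>'_def[abs_def] \<chi>'_def Jst_mat_apply mat_apply_diff)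
    also have "\<dots> = sqn n ?N (\<lambda>s j. (Jst n O1 s j - O2 s (Jst n \<psi> s) j) + O2 s (\<lambda>j. Jst n \<psi> s j - \<chi> s j) j)"
      unfolding sqn_mat_apply[OF V] by (simp add: O2_def mat_apply_diff)
    finally have "sqrt (sqn n ?N (\<lambda>s j. Jst n \<psi>' s j - \<chi>' s j))
      \<le> sqrt (sqn n ?N (\<lambda>s j. Jst n O1 s j - O2 s (Jst n \<psi> s) j))
       + sqrt (sqn n ?N (\<lambda>s. O2 s (\<lambda>j. Jst n \<psi> s j - \<chi> s j)))"
      using sqn_triangle[of n ?N "\<lambda>s j. Jst n O1 s j - O2 s (Jst n \<psi> s) j" "\<lambda>s. O2 s (\<lambda>j. Jst n \<psi> s j - \<chi> s j)"]
      by simp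
    also have "sqn n ?N (\<lambda>s. O2 s (\<lambda>j. Jst n \<psi> s j - \<chi> s j)) = sqn n ?N (\<lambda>s j. Jst n \<psi> s j - \<chi> s j)"
      by (simp add: O2_def sqn_def qop_norm unif_oracle)
    also have "sqrt (sqn n ?N (\<lambda>s j. Jst n O1 s j - O2 s (Jst n \<psi> s) j)) \<le> \<beta> * (5 * K + 10 * X)"
    proof (rule real_le_lsqrt)
      have "sqn n ?N (\<lambda>s j. Jst n O1 s j - O2 s (Jst n \<psi> s) j) \<le> \<beta>\<^sup>2 * (24 * infl n ?N \<psi> + 96 * sqn n ?N \<psi>)"
        unfolding O1_def[abs_def] O2_def by (rule step_error)
      also have "\<dots> = \<beta>\<^sup>2 * (24 * K\<^sup>2 + 96 * X\<^sup>2)" by (simp add: K_def X_def sqn_nonneg infl_nonneg)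
      \<comment> \<open>24 \<le> 5^2 and 96 \<le> 10^2, the origin of the constants 5 and
        10.\<close>
      also have "\<dots> \<le> \<beta>\<^sup>2 * (5 * K + 10 * X)\<^sup>2"
        using X0 K0 by (intro mult_left_mono) (simp_all add: power2_sum power_mult_distrib)
      finally show "sqn n ?N (\<lambda>s j. Jst n O1 s j - O2 s (Jst n \<psi> s) j) \<le> (\<beta> * (5 * K + 10 * X))\<^sup>2"
        by (simp add: power_mult_distrib)
    qed (use \<beta>_nonneg X0 K0 in simp)
    finally show ?thesis by simp
  qed
  moreover have "sqrt (sqn n ?N (\<lambda>s j. Jst n (\<lambda>s. run_steps ?N (qop (amp_far s)) (qV # rest) (\<psi> s)) s j
            - run_steps ?N (qop (amp_unif s)) (qV # rest) (\<chi> s) j))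
     \<le> sqrt (sqn n ?N (\<lambda>s j. Jst n \<psi>' s j - \<chi>' s j))
       + \<beta> * (5 * (T * sqrt (infl n ?N \<psi>') + 6 * b * T\<^sup>2 * X) + 10 * T * X)"
  proof -
    have "run_steps ?N (qop (amp_far s)) (qV # rest) (\<psi> s) = run_steps ?N (qop (amp_far s)) rest (\<psi>' s)"
      "run_steps ?N (qop (amp_unif s)) (qV # rest) (\<chi> s) = run_steps ?N (qop (amp_unif s)) rest (\<chi>' s)" for s
      by (simp_all add: qV \<psi>'_def \<chi>'_def O1_def O2_def)
    then show ?thesis using Cons.IH[of \<psi>' \<chi>'] Cons.prems unfolding X' T_def by simp
  qed
  moreover have "\<beta> * (5 * (T * sqrt (infl n ?N \<psi>') + 6 * b * T\<^sup>2 * X) + 10 * T * X)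
     \<le> \<beta> * (5 * (T * (K + 6 * b * X) + 6 * b * T\<^sup>2 * X) + 10 * T * X)"
    using K' T0 b0 X0 \<beta>_nonneg by (intro mult_left_mono add_right_mono) simp_all
  moreover have "\<beta> * (5 * K + 10 * X) + \<beta> * (5 * (T * (K + 6 * b * X) + 6 * b * T\<^sup>2 * X) + 10 * T * X)
     \<le> \<beta> * (5 * ((T + 1) * K + 6 * b * (T + 1)\<^sup>2 * X) + 10 * (T + 1) * X)"
  proof -
    \<comment> \<open>The slack between the two sides, as (T + 1)^2 - T^2 - T = T + 1.\<close>
    have "0 \<le> \<beta> * (30 * (b * (T + 1) * X))" using b0 T0 X0 \<beta>_nonneg by simp
    then show ?thesis by (simp add: power2_eq_square algebra_simps)
  qed
  ultimately show ?case by (simp add: K_def X_def T_def add.commute)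
qed

text \<open>The rotation acts on the sign register only, so for every outcome it preserves the
  squared modulus summed over all signs. On the accepting outcomes the two runs thus have norms at
  most sqrt(1/3) < 0.6 and at least sqrt(2/3) > 0.8, relative to sqrt(2^n), and must be at distance
  1/5 or more.\<close>

lemma hybrid_bound:
  assumes tester: "uniformity_tester d m k \<epsilon> V0 steps S" and \<epsilon>: "\<epsilon> \<le> a * b"
  shows "1 / 5 \<le> \<beta> * (30 * b * (real (length steps))\<^sup>2 + 10 * real (length steps))"
proof -
  let ?N = "2*d*m*k" let ?E = "Pow {..<n}"
  define T where "T = real (length steps)"
  define v where "v = mat_apply ?N V0 (basis_vec 0)"
  define F where "F s = run_steps ?N (qop (amp_far s)) steps v" for s
  define G where "G s = run_steps ?N (qop (amp_unif s)) steps v" for s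
  define X where "X = sqrt (2 ^ n)"
  have Xpos: "0 < X" by (simp add: X_def)
  have card: "card ?E = 2 ^ n" by (simp add: card_Pow)
  have uV0: "unitary_on ?N V0" and uV: "\<forall>qV\<in>set steps. unitary_on ?N (snd qV)"
    using tester by (auto simp: uniformity_tester_def)
  have accF: "(\<Sum>j\<in>S \<inter> {..<?N}. (cmod (F s j))\<^sup>2) \<le> 1/3" for s
  proof -
    have "\<epsilon> \<le> l1_dist_uniform d (p_far s)" using \<epsilon> p_far_l1 by (rule order_trans)
    then show ?thesis using tester p_far_dist[of s] far_oracle[of s]
      unfolding uniformity_tester_def accept_prob_def F_def v_def Let_def by blast
  qed
  have accG: "(\<Sum>j\<in>S \<inter> {..<?N}. (cmod (G s j))\<^sup>2) \<ge> 2/3" for s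
  proof -
    have "is_distribution d (\<lambda>e. 1 / real d)" using dpos by (simp add: is_distribution_def)
    then show ?thesis using tester unif_oracle[of s]
      unfolding uniformity_tester_def accept_prob_def G_def v_def Let_def by blast
  qed
  have v1: "(\<Sum>j<?N. (cmod (v j))\<^sup>2) = 1"
  proof -
    \<comment> \<open>For k = 0 the space would be empty and the acceptance probability 0, against
      the bound 2/3.\<close>
    have "?N \<noteq> 0"
    proof
      assume "?N = 0"
      then have "S \<inter> {..<?N} = {}" by (simp only: lessThan_0 Int_empty_right)
      then show False using accG[of "{}"] by (simp only: sum.empty)
    qed
    then have "(\<Sum>j<?N. (cmod (basis_vec 0 j))\<^sup>2) = 1"
      by (simp add: basis_vec_def if_distrib[of cmod] if_distrib[of "\<lambda>z. z\<^sup>2"] cong: if_cong)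
    then show ?thesis by (simp add: v_def mat_apply_norm[OF uV0])
  qed
  have J0: "Jst n (\<lambda>s. v) = (\<lambda>s. v)" by (simp add: Jst_def[abs_def] Jop_const)
  have "sqrt (sqn n ?N (\<lambda>s. v)) = X" by (simp add: sqn_def v1 card X_def)
  moreover have "infl n ?N (\<lambda>s. v) = 0" "sqn n ?N (\<lambda>s j. Jst n (\<lambda>s. v) s j - v j) = 0"
    by (simp_all add: infl_def sqn_def J0)
  ultimately have err: "sqrt (sqn n ?N (\<lambda>s j. Jst n F s j - G s j)) \<le> \<beta> * (30 * b * T\<^sup>2 + 10 * T) * X"
    using run_error[OF uV, of "\<lambda>s. v" "\<lambda>s. v"] by (simp add: F_def[abs_def] G_def T_def algebra_simps)
  define A where "A = S \<inter> {..<?N}"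
  have "sqrt (2/3) * X \<le> L2_set (\<lambda>(s, j). cmod (G s j)) (?E \<times> A)"
  proof -
    have "2 / 3 * 2 ^ n \<le> (\<Sum>s\<in>?E. \<Sum>j\<in>A. (cmod (G s j))\<^sup>2)"
      using sum_bounded_below[of ?E "2/3" "\<lambda>s. \<Sum>j\<in>A. (cmod (G s j))\<^sup>2"] accG by (simp add: A_def card)
    then have "sqrt (2 / 3 * 2 ^ n) \<le> sqrt (\<Sum>s\<in>?E. \<Sum>j\<in>A. (cmod (G s j))\<^sup>2)" by (rule real_sqrt_le_mono)
    then show ?thesis
      unfolding X_def real_sqrt_mult[symmetric] L2_set_def by (simp add: sum.cartesian_product split_def)
  qed
  also have "\<dots> \<le> L2_set (\<lambda>z. (case z of (s, j) \<Rightarrow> cmod (Jst n F s j)) + (case z of (s, j) \<Rightarrow> cmod (Jst n F s j - G s j))) (?E \<times> A)"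
  proof (rule L2_set_mono)
    have "cmod (G s j) \<le> cmod (Jst n F s j) + cmod (Jst n F s j - G s j)" for s j
      using norm_triangle_ineq4[of "Jst n F s j" "Jst n F s j - G s j"] by simp
    then show "(case z of (s, j) \<Rightarrow> cmod (G s j)) \<le> (case z of (s, j) \<Rightarrow> cmod (Jst n F s j)) + (case z of (s, j) \<Rightarrow> cmod (Jst n F s j - G s j))" for z
      by (cases z) simp
    show "0 \<le> (case z of (s, j) \<Rightarrow> cmod (G s j))" for z by (cases z) simp
  qed
  also have "\<dots> \<le> L2_set (\<lambda>(s, j). cmod (Jst n F s j)) (?E \<times> A) + L2_set (\<lambda>(s, j). cmod (Jst n F s j - G s j)) (?E \<times> A)"
    by (rule L2_set_triangle_ineq)
  also have "L2_set (\<lambda>(s, j). cmod (Jst n F s j)) (?E \<times> A) \<le> sqrt (1/3) * X"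
  proof -
    have "(\<Sum>s\<in>?E. \<Sum>j\<in>A. (cmod (Jst n F s j))\<^sup>2) = (\<Sum>s\<in>?E. \<Sum>j\<in>A. (cmod (F s j))\<^sup>2)"
      unfolding Jst_def by (subst (1 2) sum.swap) (simp add: Jop_norm)
    also have "\<dots> \<le> 1 / 3 * 2 ^ n"
      using sum_bounded_above[of ?E "\<lambda>s. \<Sum>j\<in>A. (cmod (F s j))\<^sup>2" "1/3"] accF by (simp add: A_def card)
    finally have "sqrt (\<Sum>s\<in>?E. \<Sum>j\<in>A. (cmod (Jst n F s j))\<^sup>2) \<le> sqrt (1 / 3 * 2 ^ n)" by (rule real_sqrt_le_mono)
    then show ?thesis
      unfolding X_def real_sqrt_mult[symmetric] L2_set_def by (simp add: sum.cartesian_product split_def)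
  qed
  also have "L2_set (\<lambda>(s, j). cmod (Jst n F s j - G s j)) (?E \<times> A) \<le> \<beta> * (30 * b * T\<^sup>2 + 10 * T) * X"
  proof -
    have "(\<Sum>s\<in>?E. \<Sum>j\<in>A. (cmod (Jst n F s j - G s j))\<^sup>2) \<le> sqn n ?N (\<lambda>s j. Jst n F s j - G s j)"
      unfolding sqn_def by (intro sum_mono sum_mono2) (auto simp: A_def)
    then have "sqrt (\<Sum>s\<in>?E. \<Sum>j\<in>A. (cmod (Jst n F s j - G s j))\<^sup>2) \<le> \<beta> * (30 * b * T\<^sup>2 + 10 * T) * X"
      by (rule order_trans[OF real_sqrt_le_mono err])
    then show ?thesis unfolding L2_set_def by (simp add: sum.cartesian_product split_def)
  qed
  finally have "sqrt (2/3) * X \<le> (sqrt (1/3) + \<beta> * (30 * b * T\<^sup>2 + 10 * T)) * X"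
    by (simp add: algebra_simps)
  then have "sqrt (2/3) \<le> sqrt (1/3) + \<beta> * (30 * b * T\<^sup>2 + 10 * T)"
    using Xpos by (simp only: mult_le_cancel_right_pos)
  moreover have "sqrt (1/3) \<le> (6/10::real)" by (rule real_le_lsqrt) (simp_all add: power2_eq_square)
  moreover have "(8/10::real) \<le> sqrt (2/3)" by (rule real_le_rsqrt) (simp_all add: power2_eq_square)
  ultimately show ?thesis by (simp add: T_def)
qed

end

section \<open>Derivation of the bound d^(1/4) / \<epsilon>\<close>

lemma tester_lower_bound_eps:
  assumes d2: "2 \<le> d" and dm: "d \<le> m" and \<epsilon>: "0 < \<epsilon>" "\<epsilon> \<le> 1/2"
    and tester: "uniformity_tester d m k \<epsilon> V0 steps S"
  shows "real d powr (1/4) / \<epsilon> \<le> 200 * real (length steps)"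
proof (rule ccontr)
  assume neg: "\<not> ?thesis"
  define T where "T = real (length steps)"
  define r where "r = real d powr (1/4)"
  \<comment> \<open>The aim is a \<plusminus> b = sqrt(1 \<plusminus> 2\<epsilon>), which yields ab
    = \<epsilon> and unit squares; the second root is why \<epsilon> must not exceed 1/2.\<close>
  define p q where "p = sqrt (1 + 2 * \<epsilon>)" and "q = sqrt (1 - 2 * \<epsilon>)"
  define a b where "a = (p + q) / 2" and "b = (p - q) / 2"
  have p2: "p\<^sup>2 = 1 + 2 * \<epsilon>" and q2: "q\<^sup>2 = 1 - 2 * \<epsilon>" using \<epsilon> by (simp_all add: p_def q_def)
  have pq: "q \<le> p" "0 \<le> q" "1 \<le> p" using \<epsilon> by (simp_all add: p_def q_def)
  have ab: "a * b = \<epsilon>"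
  proof -
    have "a * b = (p\<^sup>2 - q\<^sup>2) / 4" by (simp add: a_def b_def power2_eq_square algebra_simps)
    then show ?thesis by (simp add: p2 q2)
  qed
  have "a\<^sup>2 + b\<^sup>2 = (p\<^sup>2 + q\<^sup>2) / 2" by (simp add: a_def b_def power2_eq_square field_simps)
  then have ab1: "a\<^sup>2 + b\<^sup>2 = 1" by (simp add: p2 q2)
  have b0: "0 \<le> b" "b \<le> a" using pq by (simp_all add: a_def b_def)
  have b2: "b \<le> 2 * \<epsilon>"
  proof -
    have "1 / 2 * b \<le> a * b" using pq b0 by (intro mult_right_mono) (simp_all add: a_def)
    then show ?thesis using ab by simp
  qed
  interpret paired_model d m k a b using d2 dm ab1 b0 by unfold_locales
  have main: "1 / 5 \<le> \<beta> * (30 * b * T\<^sup>2 + 10 * T)"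
    unfolding T_def using hybrid_bound[OF tester] ab by simp
  have r1: "1 \<le> r" using d2 by (simp add: r_def ge_one_powr_ge_zero)
  have "r * r = real d powr (1/2)" by (simp add: r_def flip: powr_add)
  then have r2: "sqrt (real d) = r * r" by (simp add: powr_half_sqrt)
  \<comment> \<open>In terms of y the hybrid bound becomes 1/5 \<le> 120 y^2 + 20 y / r, which fails
    for y \<le> 1/200.\<close>
  define y where "y = \<epsilon> * T / r"
  have T0: "0 \<le> T" by (simp add: T_def)
  have y0: "0 \<le> y" using \<epsilon> T0 r1 by (simp add: y_def)
  have "200 * T < r / \<epsilon>" using neg by (simp add: T_def r_def)
  then have y1: "y \<le> 1 / 200" using \<epsilon> r1 by (simp add: y_def field_simps)
  have "\<beta> * (30 * b * T\<^sup>2 + 10 * T) \<le> (2 * \<epsilon> / (r * r)) * (30 * (2 * \<epsilon>) * T\<^sup>2 + 10 * T)"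
  proof (rule mult_mono)
    show "\<beta> \<le> 2 * \<epsilon> / (r * r)" unfolding \<beta>_def r2 using b2 by (intro divide_right_mono) simp_all
    show "30 * b * T\<^sup>2 + 10 * T \<le> 30 * (2 * \<epsilon>) * T\<^sup>2 + 10 * T"
      using b2 by (intro add_right_mono mult_right_mono) simp_all
  qed (use \<epsilon> T0 b0 in simp_all)
  also have "\<dots> = 120 * (y * y) + 20 * y * (1 / r)"
    using r1 by (simp add: y_def power2_eq_square field_simps)
  also have "\<dots> \<le> 120 * (1/200 * (1/200)) + 20 * (1/200) * 1"
    using y0 y1 r1 by (intro add_mono mult_mono) simp_all
  finally show False using main by simp
qed

section \<open>Bounded polynomials in 1/r\<close>

text \<open>Both sides are polynomials of degree at most D in z that agree at D + 1 distinct
  nodes.\<close>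

lemma lagrange_interpolation:
  fixes P :: "complex poly" and X :: "nat \<Rightarrow> real"
  assumes deg: "degree P \<le> D" and inj: "inj_on X {..D}"
  shows "poly P (of_real z)
    = (\<Sum>i\<le>D. poly P (of_real (X i)) * of_real (\<Prod>j\<in>{..D} - {i}. (z - X j) / (X i - X j)))"
proof -
  define Q where "Q = (\<Sum>i\<le>D. smult (poly P (of_real (X i)))
      (\<Prod>j\<in>{..D} - {i}. [:- of_real (X j) / of_real (X i - X j), 1 / of_real (X i - X j):]))"
  have Qp: "poly Q (of_real z)
    = (\<Sum>i\<le>D. poly P (of_real (X i)) * of_real (\<Prod>j\<in>{..D} - {i}. (z - X j) / (X i - X j)))" for z
    by (simp add: Q_def poly_sum poly_prod diff_divide_distrib)
  have "degree Q \<le> D"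
    unfolding Q_def
  proof (rule degree_sum_le)
    fix i assume i: "i \<in> {..D}"
    let ?p = "\<lambda>j. [:- complex_of_real (X j) / of_real (X i - X j), 1 / of_real (X i - X j):]"
    have "degree (\<Prod>j\<in>{..D} - {i}. ?p j) \<le> (\<Sum>j\<in>{..D} - {i}. degree (?p j))"
      by (rule degree_prod_sum_le[unfolded comp_def]) simp
    also have "\<dots> \<le> (\<Sum>j\<in>{..D} - {i}. 1)" by (intro sum_mono) simp
    also have "\<dots> = D" using i by simp
    finally show "degree (smult (poly P (of_real (X i))) (\<Prod>j\<in>{..D} - {i}. ?p j)) \<le> D"
      by (rule order_trans[OF degree_smult_le])
  qed simp
  have agree: "poly Q (of_real (X l)) = poly P (of_real (X l))" if l: "l \<le> D" for l
  proof -
    have "(\<Prod>j\<in>{..D} - {i}. (X l - X j) / (X i - X j)) = (if i = l then 1 else 0)" if i: "i \<le> D" for i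
    proof (cases "i = l")
      case True
      have "X l - X j \<noteq> 0" if "j \<in> {..D} - {l}" for j using inj that l by (auto dest: inj_onD)
      then show ?thesis using True by simp
    next
      case False
      then show ?thesis using l by (auto intro!: prod_zero bexI[of _ l])
    qed
    then have "poly Q (of_real (X l)) = (\<Sum>i\<le>D. if i = l then poly P (of_real (X i)) else 0)"
      unfolding Qp by (intro sum.cong refl) simp
    then show ?thesis using l by simp
  qed
  have "Q = P"
  proof (rule poly_eqI_degree)
    fix x assume "x \<in> (\<lambda>l. complex_of_real (X l)) ` {..D}"
    then show "poly Q x = poly P x" using agree by auto
  next
    have "inj_on (\<lambda>l. complex_of_real (X l)) {..D}" using inj by (auto simp: inj_on_def)
    then have "card ((\<lambda>l. complex_of_real (X l)) ` {..D}) = Suc D" by (simp add: card_image)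
    then show "degree Q < card ((\<lambda>l. complex_of_real (X l)) ` {..D})"
      and "degree P < card ((\<lambda>l. complex_of_real (X l)) ` {..D})"
      using \<open>degree Q \<le> D\<close> deg by simp_all
  qed
  then show ?thesis using Qp[of z] by simp
qed

section \<open>Lagrange coefficients at square nodes\<close>

lemma square_diff_nat:
  fixes i j :: nat
  assumes "i \<noteq> j"
  shows "real i \<le> \<bar>(real i)\<^sup>2 - (real j)\<^sup>2\<bar>"
proof -
  have "1 \<le> \<bar>real i - real j\<bar>" using assms by linarith
  then have "1 * (real i + real j) \<le> \<bar>real i - real j\<bar> * (real i + real j)"
    by (intro mult_right_mono) simp_all
  also have "\<dots> = \<bar>(real i)\<^sup>2 - (real j)\<^sup>2\<bar>"
    by (simp add: power2_eq_square square_diff_square_factored abs_mult)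
  finally show ?thesis by simp
qed

text \<open>The factorisation i^2 - j^2 = (i - j)(i + j) makes the product a quotient of factorials.
  The case l = i - 1 starts the induction in \<open>square_prod\<close>.\<close>

lemma square_prod_below:
  assumes "l < i"
  shows "(\<Prod>j\<in>{1..l}. (real j)\<^sup>2 / \<bar>(real i)\<^sup>2 - (real j)\<^sup>2\<bar>)
    = (fact l)\<^sup>2 * fact (i - 1 - l) * fact i / (fact (i - 1) * fact (i + l))"
  using assms
proof (induction l)
  case (Suc l)
  define t where "t = i - 1 - Suc l"
  have i: "i = t + l + 2" using Suc.prems by (simp add: t_def)
  have "\<bar>(real i)\<^sup>2 - (real (Suc l))\<^sup>2\<bar> = (real t + 1) * (real i + real l + 1)"
    by (simp add: i power2_eq_square algebra_simps)
  then have "(\<Prod>j\<in>{1..Suc l}. (real j)\<^sup>2 / \<bar>(real i)\<^sup>2 - (real j)\<^sup>2\<bar>)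
     = (fact l)\<^sup>2 * fact (i - 1 - l) * fact i / (fact (i - 1) * fact (i + l))
       * ((real (Suc l))\<^sup>2 / ((real t + 1) * (real i + real l + 1)))"
    using Suc by simp
  also have "fact (i - 1 - l) = (real t + 1) * fact t" by (simp add: i)
  also have "(fact l)\<^sup>2 * ((real t + 1) * fact t) * fact i / (fact (i - 1) * fact (i + l))
       * ((real (Suc l))\<^sup>2 / ((real t + 1) * (real i + real l + 1)))
     = (real (Suc l) * fact l)\<^sup>2 * fact t * fact i / (fact (i - 1) * ((real i + real l + 1) * fact (i + l)))"
  proof -
    have cancel: "L * (u * t') * F / (A * B) * (N / (u * w)) = N * L * t' * F / (A * (w * B))"
      if "u \<noteq> 0" for L u t' F A B N w :: real
      using that by (simp add: field_simps)
    show ?thesis unfolding power_mult_distrib by (rule cancel) simp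
  qed
  also have "(real i + real l + 1) * fact (i + l) = fact (i + Suc l)" by simp
  also have "real (Suc l) * fact l = fact (Suc l)" by simp
  finally show ?case unfolding t_def .
qed simp

text \<open>These are the absolute Lagrange coefficients at 0 for the nodes 1, 4, ..., D^2; the
  value is twice the ratio of the binomial coefficients (2D choose D - i) and (2D choose D). The
  induction on D starts at D = i.\<close>

lemma square_prod:
  assumes "1 \<le> i" "i \<le> D"
  shows "(\<Prod>j\<in>{1..D} - {i}. (real j)\<^sup>2 / \<bar>(real i)\<^sup>2 - (real j)\<^sup>2\<bar>)
    = 2 * (fact D)\<^sup>2 / (fact (D - i) * fact (D + i))"
  using assms(2)
proof (induction D rule: dec_induct)
  case base
  obtain l where l: "i = Suc l" using assms(1) by (cases i) auto
  have "{1..i} - {i} = {1..l}" by (auto simp: l)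
  then have "(\<Prod>j\<in>{1..i} - {i}. (real j)\<^sup>2 / \<bar>(real i)\<^sup>2 - (real j)\<^sup>2\<bar>)
     = (fact l)\<^sup>2 * fact 0 * fact i / (fact l * fact (i + l))"
    using square_prod_below[of l i] by (simp add: l)
  also have "\<dots> = 2 * (fact i)\<^sup>2 / fact (i + i)"
  proof -
    have "n > 0 \<Longrightarrow> L > 0 \<Longrightarrow> L\<^sup>2 * 1 * (n * L) / (L * G) = 2 * (n * L)\<^sup>2 / (2 * n * G)" for n L G :: real
      by (simp add: power2_eq_square)
    from this[of "real i" "fact l" "fact (i + l)"]
    have "(fact l)\<^sup>2 * 1 * (real i * fact l) / (fact l * fact (i + l)) = 2 * (real i * fact l)\<^sup>2 / (2 * real i * fact (i + l))"
      by (simp add: l del: fact_Suc)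
    moreover have "real i * fact l = fact i" by (simp add: l)
    moreover have "2 * real i * fact (i + l) = fact (i + i)"
    proof -
      have "i + i = Suc (i + l)" by (simp add: l)
      then show ?thesis by (simp only: fact_Suc) (simp add: l)
    qed
    ultimately show ?thesis by simp
  qed
  finally show ?case by simp
next
  case (step D)
  have "{1..Suc D} - {i} = insert (Suc D) ({1..D} - {i})" using step by auto
  moreover have "\<bar>(real i)\<^sup>2 - (real (Suc D))\<^sup>2\<bar> = (real (D - i) + 1) * (real D + real i + 1)"
  proof -
    obtain t where "D = i + t" using step(1) le_Suc_ex by blast
    then have "(real i)\<^sup>2 - (real (Suc D))\<^sup>2 = - ((real (D - i) + 1) * (real D + real i + 1))"
      by (simp add: power2_eq_square algebra_simps)
    then show ?thesis by (simp add: abs_mult)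
  qed
  ultimately have "(\<Prod>j\<in>{1..Suc D} - {i}. (real j)\<^sup>2 / \<bar>(real i)\<^sup>2 - (real j)\<^sup>2\<bar>)
     = (real (Suc D))\<^sup>2 / ((real (D - i) + 1) * (real D + real i + 1)) * (2 * (fact D)\<^sup>2 / (fact (D - i) * fact (D + i)))"
    using step by simp
  also have "\<dots> = 2 * (real (Suc D) * fact D)\<^sup>2 / (((real (D - i) + 1) * fact (D - i)) * ((real D + real i + 1) * fact (D + i)))"
    by (simp only: power_mult_distrib times_divide_times_eq mult_ac)
  also have "(real (D - i) + 1) * fact (D - i) = fact (Suc D - i)"
    using step by (simp add: Suc_diff_le)
  also have "(real D + real i + 1) * fact (D + i) = fact (Suc D + i)" by simp
  also have "real (Suc D) * fact D = fact (Suc D)" by simp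
  finally show ?case .
qed

text \<open>Passing from i to i + 1 multiplies the ratio by 1 - (2i + 1)/(D + i + 1) \<le> exp(-(2i
  + 1)/(2D)), and the odd numbers add up to squares.\<close>

lemma central_ratio_le:
  assumes "i \<le> D" "1 \<le> D"
  shows "(fact D)\<^sup>2 / (fact (D - i) * fact (D + i)) \<le> exp (- (real i)\<^sup>2 / (2 * real D))"
  using assms(1)
proof (induction i)
  case 0
  then show ?case by (simp add: power2_eq_square)
next
  case (Suc i)
  obtain t where t: "D = i + Suc t" using Suc.prems by (metis Suc_le_lessD less_iff_Suc_add add_Suc_right)
  have eq: "(fact D)\<^sup>2 / (fact (D - Suc i) * fact (D + Suc i))
     = (fact D)\<^sup>2 / (fact (D - i) * fact (D + i)) * ((real t + 1) / (real D + real i + 1))"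
  proof -
    have "u > 0 \<Longrightarrow> a / (A * (w * B)) = a / ((u * A) * B) * (u / w)" for u w a A B :: real
      by simp
    from this[of "real t + 1" "(fact D)\<^sup>2" "fact t" "real D + real i + 1" "fact (D + i)"]
    have "(fact D)\<^sup>2 / (fact t * ((real D + real i + 1) * fact (D + i)))
       = (fact D)\<^sup>2 / (((real t + 1) * fact t) * fact (D + i)) * ((real t + 1) / (real D + real i + 1))" by simp
    moreover have "(fact (D - Suc i) :: real) = fact t" by (simp add: t)
    moreover have "fact (D - i) = (real t + 1) * fact t" by (simp add: t)
    moreover have "fact (D + Suc i) = (real D + real i + 1) * fact (D + i)" by simp
    ultimately show ?thesis by (simp only:)
  qed
  have "(real t + 1) / (real D + real i + 1) = 1 + - (2 * real i + 1) / (real D + real i + 1)"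
    by (simp add: t field_simps)
  also have "\<dots> \<le> exp (- (2 * real i + 1) / (real D + real i + 1))" by (rule exp_ge_add_one_self)
  also have "\<dots> \<le> exp (- (2 * real i + 1) / (2 * real D))"
  proof -
    have "(2 * real i + 1) / (2 * real D) \<le> (2 * real i + 1) / (real D + real i + 1)"
      using Suc.prems by (intro frac_le) auto
    then show ?thesis by (simp only: exp_le_cancel_iff minus_divide_left[symmetric] neg_le_iff_le)
  qed
  finally have "(fact D)\<^sup>2 / (fact (D - Suc i) * fact (D + Suc i))
     \<le> (fact D)\<^sup>2 / (fact (D - i) * fact (D + i)) * exp (- (2 * real i + 1) / (2 * real D))"
    unfolding eq by (intro mult_left_mono) simp_all
  also have "\<dots> \<le> exp (- (real i)\<^sup>2 / (2 * real D)) * exp (- (2 * real i + 1) / (2 * real D))"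
    using Suc by (intro mult_right_mono) simp_all
  also have "\<dots> = exp (- (real (Suc i))\<^sup>2 / (2 * real D))"
    by (simp add: power2_eq_square algebra_simps flip: exp_add add_divide_distrib diff_divide_distrib)
  finally show ?case .
qed

lemma sum_inverse_squares_le: "(\<Sum>i\<in>{1..D}. 1 / (real i)\<^sup>2) \<le> 2"
proof -
  \<comment> \<open>The subtracted term makes the induction telescope through 1/(x + 1)^2 \<le> 1/x
    - 1/(x + 1).\<close>
  have "(\<Sum>i\<in>{1..Suc D}. 1 / (real i)\<^sup>2) \<le> 2 - 1 / real (Suc D)" for D
  proof (induction D)
    case (Suc D)
    have "1 / (real (Suc (Suc D)))\<^sup>2 \<le> 1 / real (Suc D) - 1 / real (Suc (Suc D))"
    proof -
      have "1 / (x + 1)\<^sup>2 \<le> 1 / x - 1 / (x + 1)" if "0 < x" for x :: real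
      proof -
        have "1 / (x + 1)\<^sup>2 \<le> 1 / (x * (x + 1))" using that by (intro frac_le) (simp_all add: power2_eq_square)
        also have "\<dots> = 1 / x - 1 / (x + 1)" using that by (simp add: field_simps)
        finally show ?thesis .
      qed
      from this[of "real (Suc D)"] show ?thesis by (simp add: add.commute)
    qed
    then show ?case using Suc by simp
  qed simp
  then show ?thesis by (cases D) (simp, smt (verit) divide_nonneg_nonneg of_nat_0_le_iff)
qed

text \<open>Rounding to integer ranges moves the node \<open>1 + 100 j\<^sup>2\<close> upwards by at most \<open>j\<^sup>4 / D\<^sup>3\<close>. For exact
  square nodes the \<open>i\<close>-th Lagrange coefficient carries a factor \<open>exp (- i\<^sup>2 / 2 D)\<close>, which
  absorbs the accumulated effect of these perturbations.\<close>
locale perturbed_square_nodes =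
  fixes d D :: nat
  assumes D1: "1 \<le> D" and dD: "80000 * D^3 \<le> d"
begin

text \<open>A support size r, hence an integer, with the corresponding node d/r; j = 0 gives r = d,
  the uniform distribution.\<close>

definition node_size :: "nat \<Rightarrow> nat" where "node_size j = d div (1 + 100 * j\<^sup>2)"
definition X :: "nat \<Rightarrow> real" where "X j = real d / real (node_size j)"

lemma dD': "80000 * (real D)^3 \<le> real d"
  using dD by (metis of_nat_le_iff of_nat_mult of_nat_numeral of_nat_power)

lemma D_square_le: "real j \<le> real D \<Longrightarrow> (real j)\<^sup>2 \<le> (real D)^3"
proof -
  assume "real j \<le> real D"
  then have "(real j)\<^sup>2 \<le> (real D)\<^sup>2" by (simp add: power_mono)
  also have "\<dots> \<le> (real D)^3" using D1 by (simp add: power_increasing)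
  finally show ?thesis .
qed

lemma node_half:
  assumes "j \<le> D"
  shows "2 * (1 + 100 * (real j)\<^sup>2) \<le> real d"
proof -
  have "1 \<le> (real D)^3" using D1 by simp
  then show ?thesis using D_square_le[of j] dD' assms by simp
qed

lemma node_size_range:
  assumes "j \<le> D"
  shows "1 \<le> node_size j" "node_size j \<le> d"
proof -
  have "real (2 * (1 + 100 * j\<^sup>2)) \<le> real d" using node_half[OF assms] by simp
  then have "2 * (1 + 100 * j\<^sup>2) \<le> d" by (simp only: of_nat_le_iff)
  then have "1 + 100 * j\<^sup>2 \<le> d" by simp
  then show "1 \<le> node_size j" unfolding node_size_def by (simp add: div_greater_zero_iff Suc_leI)
  show "node_size j \<le> d" by (simp add: node_size_def)
qed

lemma X_0: "X 0 = 1"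
  using node_half[of 0] by (simp add: X_def node_size_def)

lemma X_lower:
  assumes "j \<le> D"
  shows "1 + 100 * (real j)\<^sup>2 \<le> X j"
proof -
  have "node_size j * (1 + 100 * j\<^sup>2) \<le> d" unfolding node_size_def by (rule div_times_less_eq_dividend)
  then have "real (node_size j * (1 + 100 * j\<^sup>2)) \<le> real d" by (simp only: of_nat_le_iff)
  then have "real (node_size j) * (1 + 100 * (real j)\<^sup>2) \<le> real d" by (simp add: distrib_left)
  then show ?thesis using node_size_range[OF assms] by (simp add: X_def field_simps)
qed

text \<open>Rounding r down loses less than 1, so for the ideal node y the actual one is at most
  dy/(d - y), and this is at most y + 2y^2/d because 2y \<le> d.\<close>

lemma X_upper:
  assumes "1 \<le> j" "j \<le> D"
  shows "X j \<le> 1 + 100 * (real j)\<^sup>2 + (real j)^4 / (real D)^3"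
proof -
  define y where "y = 1 + 100 * (real j)\<^sup>2"
  have j1: "1 \<le> (real j)\<^sup>2" using assms by simp
  then have y: "1 \<le> y" "y \<le> 200 * (real j)\<^sup>2" "2 * y \<le> real d" using node_half[OF assms(2)] by (simp_all add: y_def)
  have dpos: "0 < real d" using y by linarith
  have D3: "0 < (real D)^3" using D1 by simp
  have "d < (node_size j + 1) * (1 + 100 * j\<^sup>2)"
    using dividend_less_div_times[of "1 + 100 * j\<^sup>2" d] by (simp add: node_size_def algebra_simps)
  then have "real d < real ((node_size j + 1) * (1 + 100 * j\<^sup>2))" by (simp only: of_nat_less_iff)
  then have "real d < (real (node_size j) + 1) * y" by (simp add: y_def algebra_simps)
  then have "real d - y \<le> real (node_size j) * y" by (simp add: algebra_simps)
  moreover have rpos: "0 < real (node_size j)" using node_size_range[OF assms(2)] by simp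
  ultimately have "X j * (real d - y) \<le> X j * (real (node_size j) * y)"
    by (intro mult_left_mono) (simp_all add: X_def)
  also have "\<dots> = real d * y" using rpos by (simp add: X_def)
  finally have 1: "X j * (real d - y) \<le> real d * y" .
  have "real d * y \<le> (y + 2 * y\<^sup>2 / real d) * (real d - y)"
  proof -
    have "0 \<le> y\<^sup>2 * (1 - 2 * y / real d)" using y dpos by (intro mult_nonneg_nonneg) (simp_all add: field_simps)
    also have "\<dots> = (y + 2 * y\<^sup>2 / real d) * (real d - y) - real d * y"
      using dpos by (simp add: power2_eq_square field_simps)
    finally show ?thesis by simp
  qed
  with 1 have "X j * (real d - y) \<le> (y + 2 * y\<^sup>2 / real d) * (real d - y)" by linarith
  moreover have "0 < real d - y" using y by linarith
  ultimately have "X j \<le> y + 2 * y\<^sup>2 / real d" by (simp only: mult_le_cancel_right_pos)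
  \<comment> \<open>The constant 80000 of the locale is 2 * 200^2.\<close>
  also have "2 * y\<^sup>2 / real d \<le> 2 * (200 * (real j)\<^sup>2)\<^sup>2 / (80000 * (real D)^3)"
    using y D3 dD' by (intro frac_le mult_left_mono power_mono) simp_all
  also have "\<dots> = (real j)^4 / (real D)^3" by (simp add: power_mult_distrib)
  finally show ?thesis by (simp add: y_def)
qed

text \<open>Nodes only move upwards, so a gap can shrink only through its smaller node, by at most
  i^4/D^3. As the gap of the squares is at least i, this is a relative loss of i^3/(100
  D^3).\<close>

lemma X_gap:
  assumes i: "1 \<le> i" "i \<le> D" and j: "1 \<le> j" "j \<le> D" and ij: "i \<noteq> j"
  shows "100 * \<bar>(real i)\<^sup>2 - (real j)\<^sup>2\<bar> * (1 - (real i)^3 / (100 * (real D)^3)) \<le> \<bar>X i - X j\<bar>"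
proof -
  define s where "s = \<bar>(real i)\<^sup>2 - (real j)\<^sup>2\<bar>"
  have D3: "0 < (real D)^3" using D1 by simp
  have main: "100 * s - (real (min i j))^4 / (real D)^3 \<le> \<bar>X i - X j\<bar>"
  proof (cases "i < j")
    case True
    then have "s = (real j)\<^sup>2 - (real i)\<^sup>2" by (simp add: s_def power_mono)
    then show ?thesis using X_lower[of j] X_upper[of i] i j True by simp
  next
    case False
    then have "s = (real i)\<^sup>2 - (real j)\<^sup>2" by (simp add: s_def power_mono)
    then show ?thesis using X_lower[of i] X_upper[of j] i j False by simp
  qed
  have "(real (min i j))^4 / (real D)^3 \<le> (real i)^4 / (real D)^3"
    using D3 by (intro divide_right_mono power_mono) simp_all
  also have "\<dots> = (real i)^3 / (real D)^3 * real i" by (simp add: power_numeral_reduce)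
  also have "\<dots> \<le> (real i)^3 / (real D)^3 * s"
    unfolding s_def by (intro mult_left_mono square_diff_nat ij) simp
  finally show ?thesis using main unfolding s_def[symmetric] by (simp add: algebra_simps)
qed

lemma X_inj: "inj_on X {..D}"
proof (rule inj_onI, rule ccontr)
  fix i j assume ij: "i \<in> {..D}" "j \<in> {..D}" "X i = X j" "i \<noteq> j"
  have big: "101 \<le> X l" if "1 \<le> l" "l \<le> D" for l
  proof -
    have "1 \<le> (real l)\<^sup>2" using that by simp
    then show ?thesis using X_lower[OF that(2)] by linarith
  qed
  show False
  proof (cases "i = 0 \<or> j = 0")
    case True
    then show False using ij big[of i] big[of j] X_0 by (cases "i = 0"; cases "j = 0") simp_all
  next
    case False
    have D3: "0 < (real D)^3" using D1 by simp
    have "(real i)^3 \<le> (real D)^3" using ij by (simp add: power_mono)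
    then have "(real i)^3 / (100 * (real D)^3) \<le> 1 / 100" using D3 by (simp add: field_simps)
    moreover have "0 < \<bar>(real i)\<^sup>2 - (real j)\<^sup>2\<bar>" using ij(4) by simp
    ultimately have "0 < 100 * \<bar>(real i)\<^sup>2 - (real j)\<^sup>2\<bar> * (1 - (real i)^3 / (100 * (real D)^3))"
      by (intro mult_pos_pos) simp_all
    then show False using X_gap[of i j] ij False by simp
  qed
qed

text \<open>The node for j = 0 contributes 2/(100 i^2), the decay that makes the coefficients
  summable. The other factors are those of exact squares up to perturbations, whose product 2
  exp(i^2/(2D)) is cancelled up to a constant by \<open>central_ratio_le\<close>.\<close>

lemma lagrange_coeff_bound:
  assumes z: "2 \<le> z" "z \<le> 3" and i: "1 \<le> i" "i \<le> D"
  shows "\<bar>\<Prod>j\<in>{..D} - {i}. (z - X j) / (X i - X j)\<bar> \<le> 8 / (100 * (real i)\<^sup>2)"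
proof -
  \<comment> \<open>\<eta> bounds the relative loss in the denominators, \<theta> the relative
    excess in the numerators.\<close>
  define \<eta> where "\<eta> = (real i)^3 / (100 * (real D)^3)"
  define \<theta> where "\<theta> = 1 / (100 * real D)"
  have Dp: "0 < real D" using D1 by simp
  have D3: "0 < (real D)^3" using D1 by simp
  have \<theta>0: "0 \<le> \<theta>" by (simp add: \<theta>_def)
  have "(real i)^3 \<le> (real D)^3" using i by (simp add: power_mono)
  then have \<eta>: "0 \<le> \<eta>" "\<eta> \<le> 1 / 100" using D3 by (simp_all add: \<eta>_def field_simps)
  have i2: "1 \<le> (real i)\<^sup>2" using i by simp
  have "{..D} - {i} = insert 0 ({1..D} - {i})" using i by auto
  then have "\<bar>\<Prod>j\<in>{..D} - {i}. (z - X j) / (X i - X j)\<bar>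
     = \<bar>z - X 0\<bar> / \<bar>X i - X 0\<bar> * (\<Prod>j\<in>{1..D} - {i}. \<bar>z - X j\<bar> / \<bar>X i - X j\<bar>)"
    by (simp add: abs_mult abs_prod)
  also have "\<dots> \<le> 2 / (100 * (real i)\<^sup>2) *
     (\<Prod>j\<in>{1..D} - {i}. (real j)\<^sup>2 / \<bar>(real i)\<^sup>2 - (real j)\<^sup>2\<bar> * ((1 + \<theta>) * exp (2 * \<eta>)))"
  proof (intro mult_mono prod_mono conjI)
    show "\<bar>z - X 0\<bar> / \<bar>X i - X 0\<bar> \<le> 2 / (100 * (real i)\<^sup>2)"
      using z X_lower[of i] i i2 by (intro frac_le) (simp_all add: X_0)
    fix j assume j: "j \<in> {1..D} - {i}"
    have j2: "1 \<le> (real j)\<^sup>2" using j by simp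
    define s where "s = \<bar>(real i)\<^sup>2 - (real j)\<^sup>2\<bar>"
    have s: "0 < s" using square_diff_nat[of i j] i j by (auto simp: s_def)
    have num: "\<bar>z - X j\<bar> \<le> 100 * (real j)\<^sup>2 * (1 + \<theta>)"
    proof -
      have "(real j)^4 / (real D)^3 = (real j)\<^sup>2 * ((real j)\<^sup>2 / (real D)^3)" by (simp add: power_numeral_reduce)
      also have "\<dots> \<le> (real j)\<^sup>2 * ((real D)\<^sup>2 / (real D)^3)"
        using j by (intro mult_left_mono divide_right_mono power_mono) simp_all
      also have "\<dots> = (real j)\<^sup>2 * (100 * \<theta>)" using Dp by (simp add: \<theta>_def power_numeral_reduce field_simps)
      finally have "X j \<le> 1 + 100 * (real j)\<^sup>2 + (real j)\<^sup>2 * (100 * \<theta>)"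
        using X_upper[of j] j by simp
      moreover have "1 + 100 * (real j)\<^sup>2 \<le> X j" using j by (intro X_lower) simp
      moreover have "100 * (real j)\<^sup>2 * (1 + \<theta>) = 100 * (real j)\<^sup>2 + (real j)\<^sup>2 * (100 * \<theta>)"
        by (simp add: algebra_simps)
      ultimately show ?thesis using z j2 by linarith
    qed
    have den: "100 * s * (1 - \<eta>) \<le> \<bar>X i - X j\<bar>"
      unfolding s_def \<eta>_def using X_gap[of i j] i j by auto
    have "\<bar>z - X j\<bar> / \<bar>X i - X j\<bar> \<le> 100 * (real j)\<^sup>2 * (1 + \<theta>) / (100 * s * (1 - \<eta>))"
      using num den s \<eta> \<theta>0 by (intro frac_le) simp_all
    also have "\<dots> = (real j)\<^sup>2 / s * ((1 + \<theta>) * (1 / (1 - \<eta>)))" by simp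
    also have "\<dots> \<le> (real j)\<^sup>2 / s * ((1 + \<theta>) * exp (2 * \<eta>))"
    proof (intro mult_left_mono)
      have "1 \<le> (1 + 2 * \<eta>) * (1 - \<eta>)" using \<eta> mult_left_mono[of "2 * \<eta>" 1 \<eta>] by (simp add: algebra_simps)
      then have "1 / (1 - \<eta>) \<le> 1 + 2 * \<eta>" using \<eta> by (simp add: field_simps)
      then show "1 / (1 - \<eta>) \<le> exp (2 * \<eta>)" using exp_ge_add_one_self[of "2 * \<eta>"] by linarith
    qed (use \<theta>0 s in simp_all)
    finally show "\<bar>z - X j\<bar> / \<bar>X i - X j\<bar>
        \<le> (real j)\<^sup>2 / \<bar>(real i)\<^sup>2 - (real j)\<^sup>2\<bar> * ((1 + \<theta>) * exp (2 * \<eta>))" by (simp add: s_def)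
  qed (auto intro!: prod_nonneg)
  finally have main: "\<bar>\<Prod>j\<in>{..D} - {i}. (z - X j) / (X i - X j)\<bar> \<le> 2 / (100 * (real i)\<^sup>2) *
     (\<Prod>j\<in>{1..D} - {i}. (real j)\<^sup>2 / \<bar>(real i)\<^sup>2 - (real j)\<^sup>2\<bar> * ((1 + \<theta>) * exp (2 * \<eta>)))" .
  have "(\<Prod>j\<in>{1..D} - {i}. (real j)\<^sup>2 / \<bar>(real i)\<^sup>2 - (real j)\<^sup>2\<bar> * ((1 + \<theta>) * exp (2 * \<eta>)))
     = 2 * ((fact D)\<^sup>2 / (fact (D - i) * fact (D + i))) * ((1 + \<theta>) * exp (2 * \<eta>)) ^ (D - 1)"
  proof -
    have "card ({1..D} - {i}) = D - 1" using i by simp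
    then show ?thesis unfolding prod.distrib square_prod[OF i] by (simp add: power_mult_distrib)
  qed
  also have "\<dots> \<le> 2 * exp (- (real i)\<^sup>2 / (2 * real D)) * (2 * exp ((real i)\<^sup>2 / (2 * real D)))"
  proof (intro mult_mono mult_left_mono central_ratio_le)
    have ge1: "1 \<le> (1 + \<theta>) * exp (2 * \<eta>)"
      using mult_mono[of 1 "1 + \<theta>" 1 "exp (2 * \<eta>)"] \<eta> Dp by (simp add: \<theta>_def)
    then have "((1 + \<theta>) * exp (2 * \<eta>)) ^ (D - 1) \<le> ((1 + \<theta>) * exp (2 * \<eta>)) ^ D"
      by (intro power_increasing) simp_all
    also have "\<dots> = (1 + \<theta>) ^ D * exp (real D * (2 * \<eta>))" by (simp add: power_mult_distrib exp_of_nat_mult)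
    also have "\<dots> \<le> 2 * exp ((real i)\<^sup>2 / (2 * real D))"
    proof (intro mult_mono)
      have "(1 + \<theta>) ^ D \<le> exp \<theta> ^ D"
        using exp_ge_add_one_self[of \<theta>] Dp by (intro power_mono) (simp_all add: \<theta>_def)
      also have "\<dots> = exp (1 / 100)" using Dp by (simp add: \<theta>_def flip: exp_of_nat_mult)
      also have "\<dots> \<le> 2" using exp_bound[of "1/100::real"] by (simp add: power2_eq_square)
      finally show "(1 + \<theta>) ^ D \<le> 2" .
      have "real D * (2 * \<eta>) = (real i)\<^sup>2 * (real i / (real D)\<^sup>2) / 50"
        using Dp by (simp add: \<eta>_def power_numeral_reduce field_simps)
      also have "\<dots> \<le> (real i)\<^sup>2 * (real D / (real D)\<^sup>2) / 50"
        using i by (intro divide_right_mono mult_left_mono) simp_all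
      also have "\<dots> \<le> (real i)\<^sup>2 / (2 * real D)"
        using Dp by (simp add: power2_eq_square field_simps)
      finally show "exp (real D * (2 * \<eta>)) \<le> exp ((real i)\<^sup>2 / (2 * real D))" by simp
    qed simp_all
    finally show "((1 + \<theta>) * exp (2 * \<eta>)) ^ (D - 1) \<le> 2 * exp ((real i)\<^sup>2 / (2 * real D))" .
  qed (use i D1 in \<open>auto simp: \<theta>_def\<close>)
  also have "\<dots> = 4" by (simp add: exp_minus)
  finally have "2 / (100 * (real i)\<^sup>2) *
     (\<Prod>j\<in>{1..D} - {i}. (real j)\<^sup>2 / \<bar>(real i)\<^sup>2 - (real j)\<^sup>2\<bar> * ((1 + \<theta>) * exp (2 * \<eta>)))
     \<le> 2 / (100 * (real i)\<^sup>2) * 4" by (rule mult_left_mono) simp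
  then show ?thesis using main by simp
qed

text \<open>The coefficients sum to 1, so the difference from the value at \<open>X 0\<close> is a
  combination of differences of size at most 2, in which the coefficient of \<open>X 0\<close>
  itself drops out. The result 2 * 8/100 * 2 lies below 1/3.\<close>

lemma small_range_bound:
  fixes P :: "complex poly"
  assumes deg: "degree P \<le> D" and bd: "\<And>r. 1 \<le> r \<Longrightarrow> r \<le> d \<Longrightarrow> cmod (poly P (1 / of_nat r)) \<le> 1"
  shows "cmod (poly P (1 / of_nat (d div 2)) - poly P (1 / of_nat d)) \<le> 32 / 100"
proof -
  define z where "z = real d / real (d div 2)"
  have d4: "4 \<le> d"
  proof -
    have "1 \<le> D ^ 3" using D1 by simp
    then show ?thesis using dD by linarith
  qed
  have h: "0 < real (d div 2)" "2 * real (d div 2) \<le> real d" "real d \<le> 3 * real (d div 2)"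
    using d4 by linarith+
  then have z: "2 \<le> z" "z \<le> 3" by (simp_all add: z_def field_simps)
  have dp: "0 < real d" using d4 by simp
  \<comment> \<open>Rescaling by d turns the argument 1/r into the node d/r.\<close>
  define Q where "Q = pcompose P [:0, 1 / of_nat d:]"
  have degQ: "degree Q \<le> D" unfolding Q_def using deg by (simp add: degree_pcompose)
  have Qe: "poly Q (of_real (real d / real r)) = poly P (1 / of_nat r)" for r
    using dp by (simp add: Q_def poly_pcompose)
  define c where "c i = (\<Prod>j\<in>{..D} - {i}. (z - X j) / (X i - X j))" for i
  \<comment> \<open>Interpolation of the constant polynomial 1.\<close>
  have one: "(\<Sum>i\<le>D. complex_of_real (c i)) = 1"
    using lagrange_interpolation[of 1 D X z] X_inj by (simp add: c_def)
  have split: "{..D} = insert 0 {1..D}" by auto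
  have "poly Q (of_real z) - poly Q (of_real (X 0))
     = (\<Sum>i\<le>D. poly Q (of_real (X i)) * of_real (c i)) - poly Q (of_real (X 0)) * (\<Sum>i\<le>D. of_real (c i))"
    using lagrange_interpolation[OF degQ X_inj, of z, folded c_def] unfolding one by simp
  also have "\<dots> = (\<Sum>i\<le>D. (poly Q (of_real (X i)) - poly Q (of_real (X 0))) * of_real (c i))"
    by (simp add: sum_subtractf left_diff_distrib sum_distrib_left)
  also have "\<dots> = (\<Sum>i\<in>{1..D}. (poly Q (of_real (X i)) - poly Q (of_real (X 0))) * of_real (c i))"
    unfolding split by simp
  finally have "cmod (poly Q (of_real z) - poly Q (of_real (X 0)))
     \<le> (\<Sum>i\<in>{1..D}. cmod ((poly Q (of_real (X i)) - poly Q (of_real (X 0))) * of_real (c i)))"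
    by (simp only: norm_sum)
  also have "\<dots> \<le> (\<Sum>i\<in>{1..D}. 2 * (8 / (100 * (real i)\<^sup>2)))"
  proof (intro sum_mono)
    fix i assume i: "i \<in> {1..D}"
    have b: "cmod (poly Q (of_real (X l))) \<le> 1" if "l \<le> D" for l
      unfolding X_def Qe using node_size_range[OF that] by (intro bd)
    have "cmod (poly Q (of_real (X i)) - poly Q (of_real (X 0))) \<le> 2"
      using norm_triangle_ineq4[of "poly Q (of_real (X i))" "poly Q (of_real (X 0))"] b[of i] b[of 0] i by simp
    moreover have "\<bar>c i\<bar> \<le> 8 / (100 * (real i)\<^sup>2)"
      unfolding c_def using z i by (intro lagrange_coeff_bound) simp_all
    ultimately show "cmod ((poly Q (of_real (X i)) - poly Q (of_real (X 0))) * of_real (c i)) \<le> 2 * (8 / (100 * (real i)\<^sup>2))"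
      unfolding norm_mult norm_of_real by (intro mult_mono) simp_all
  qed
  also have "\<dots> = 16 / 100 * (\<Sum>i\<in>{1..D}. 1 / (real i)\<^sup>2)" by (simp add: sum_distrib_left)
  also have "\<dots> \<le> 16 / 100 * 2" by (intro mult_left_mono sum_inverse_squares_le) simp
  finally have "cmod (poly Q (of_real z) - poly Q (of_real (X 0))) \<le> 32 / 100" by simp
  moreover have "poly Q (of_real z) = poly P (1 / of_nat (d div 2))" unfolding z_def by (rule Qe)
  moreover have "poly Q (of_real (X 0)) = poly P (1 / of_nat d)"
    using Qe[of d] dp by (simp add: X_0)
  ultimately show ?thesis by simp
qed

end

section \<open>Averaging over supports and signs\<close>

text \<open>Polynomials in the real amplitudes, with monomials as lists of variables; rule induction
  reduces linear statements such as \<open>avg_poly\<close> to monomials.\<close>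

inductive deg_le :: "nat \<Rightarrow> nat \<Rightarrow> ((nat \<Rightarrow> real) \<Rightarrow> complex) \<Rightarrow> bool" for d l where
  deg_zero: "deg_le d l (\<lambda>x. 0)"
| deg_monom: "set es \<subseteq> {..<d} \<Longrightarrow> length es \<le> l \<Longrightarrow> deg_le d l (\<lambda>x. c * of_real (prod_list (map x es)))"
| deg_add: "deg_le d l f \<Longrightarrow> deg_le d l g \<Longrightarrow> deg_le d l (\<lambda>x. f x + g x)"

lemma deg_const: "deg_le d l (\<lambda>x. c)"
  using deg_monom[of "[]" d l c] by simp

lemma deg_var: "e < d \<Longrightarrow> 1 \<le> l \<Longrightarrow> deg_le d l (\<lambda>x. of_real (x e))"
  using deg_monom[of "[e]" d l 1] by simp

lemma deg_monom_mult:
  assumes "deg_le d l g" "set es \<subseteq> {..<d}" "length es + l \<le> l'"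
  shows "deg_le d l' (\<lambda>x. c * of_real (prod_list (map x es)) * g x)"
  using assms(1)
proof (induction rule: deg_le.induct)
  case (deg_monom es' c')
  have "deg_le d l' (\<lambda>x. c * c' * of_real (prod_list (map x (es @ es'))))"
    using deg_monom assms by (intro deg_le.deg_monom) auto
  then show ?case by (simp add: mult_ac)
next
  case (deg_add f g)
  then show ?case using deg_le.deg_add[OF deg_add.IH] by (simp add: distrib_left)
qed (simp add: deg_zero)

lemma deg_mult:
  assumes "deg_le d l f" "deg_le d l' g"
  shows "deg_le d (l + l') (\<lambda>x. f x * g x)"
  using assms(1)
proof (induction rule: deg_le.induct)
  case (deg_add f h)
  then show ?case using deg_le.deg_add[OF deg_add.IH] by (simp add: distrib_right)
qed (auto intro: deg_zero deg_monom_mult[OF assms(2)])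

lemma deg_scale: "deg_le d l f \<Longrightarrow> deg_le d l (\<lambda>x. c * f x)"
  using deg_mult[OF deg_const[of d 0 c]] by simp

lemma deg_diff: "deg_le d l f \<Longrightarrow> deg_le d l g \<Longrightarrow> deg_le d l (\<lambda>x. f x - g x)"
  using deg_add[of d l f "\<lambda>x. - 1 * g x"] deg_scale[of d l g "-1"] by simp

lemma deg_cnj: "deg_le d l f \<Longrightarrow> deg_le d l (\<lambda>x. cnj (f x))"
  by (induction rule: deg_le.induct) (auto intro: deg_le.intros)

lemma deg_sum: "(\<And>a. a \<in> A \<Longrightarrow> deg_le d l (F a)) \<Longrightarrow> deg_le d l (\<lambda>x. \<Sum>a\<in>A. F a x)"
  by (induction A rule: infinite_finite_induct) (auto intro: deg_zero deg_add)

section \<open>Averages of monomials over supports and signs\<close>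

definition signed_pt :: "nat \<Rightarrow> nat set \<Rightarrow> nat set \<Rightarrow> nat \<Rightarrow> real" where
  "signed_pt r R \<tau> e = (if e \<in> R then (if e \<in> \<tau> then 1 else - 1) / sqrt (real r) else 0)"

definition avg :: "nat \<Rightarrow> nat \<Rightarrow> ((nat \<Rightarrow> real) \<Rightarrow> complex) \<Rightarrow> complex" where
  "avg d r f = (\<Sum>R\<in>{R. R \<subseteq> {..<d} \<and> card R = r}. \<Sum>\<tau>\<in>Pow {..<d}. f (signed_pt r R \<tau>))
      / (2 ^ d * of_nat (d choose r))"

lemma finite_subsets: "finite {R. R \<subseteq> {..<d::nat} \<and> card R = r}"
  by (rule finite_subset[of _ "Pow {..<d}"]) auto

lemma avg_add: "avg d r (\<lambda>x. f x + g x) = avg d r f + avg d r g"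
  by (simp add: avg_def sum.distrib add_divide_distrib)

text \<open>Removing K leaves an arbitrary (r - |K|)-subset of the complement. After division, the
  fraction of r-sets containing K depends on r only through r choose |K|; for |K| > r both sides
  vanish.\<close>

lemma card_supersets:
  assumes K: "K \<subseteq> {..<d}" and r: "r \<le> d"
  shows "card {R. R \<subseteq> {..<d} \<and> card R = r \<and> K \<subseteq> R} * (d choose card K) = (d choose r) * (r choose card K)"
proof (cases "card K \<le> r")
  case True
  have fK: "finite K" using K finite_subset by blast
  have "bij_betw (\<lambda>B. B \<union> K) {B. B \<subseteq> {..<d} - K \<and> card B = r - card K} {R. R \<subseteq> {..<d} \<and> card R = r \<and> K \<subseteq> R}"
  proof (rule bij_betw_byWitness[where f' = "\<lambda>R. R - K"])
    show "(\<lambda>B. B \<union> K) ` {B. B \<subseteq> {..<d} - K \<and> card B = r - card K} \<subseteq> {R. R \<subseteq> {..<d} \<and> card R = r \<and> K \<subseteq> R}"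
    proof clarify
      fix B assume B: "B \<subseteq> {..<d} - K" "card B = r - card K"
      have "finite B" using B(1) finite_subset by blast
      then have "card (B \<union> K) = card B + card K" using B(1) fK by (intro card_Un_disjoint) auto
      then show "B \<union> K \<subseteq> {..<d} \<and> card (B \<union> K) = r \<and> K \<subseteq> B \<union> K" using B K True by auto
    qed
    show "(\<lambda>R. R - K) ` {R. R \<subseteq> {..<d} \<and> card R = r \<and> K \<subseteq> R} \<subseteq> {B. B \<subseteq> {..<d} - K \<and> card B = r - card K}"
      using fK by (auto simp: card_Diff_subset)
  qed auto
  then have "card {R. R \<subseteq> {..<d} \<and> card R = r \<and> K \<subseteq> R} = card {B. B \<subseteq> {..<d} - K \<and> card B = r - card K}"
    by (rule bij_betw_same_card[symmetric])
  also have "\<dots> = (card ({..<d} - K) choose (r - card K))" by (rule n_subsets) simp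
  also have "card ({..<d} - K) = d - card K" using K fK by (simp add: card_Diff_subset)
  finally show ?thesis using choose_mult[OF True r] by (simp add: mult.commute)
next
  case False
  have "\<not> (R \<subseteq> {..<d} \<and> card R = r \<and> K \<subseteq> R)" for R
  proof clarify
    assume R: "R \<subseteq> {..<d}" "K \<subseteq> R" "r = card R"
    have "finite R" using R(1) finite_subset by blast
    then show False using False R card_mono[of R K] by simp
  qed
  then have "{R. R \<subseteq> {..<d} \<and> card R = r \<and> K \<subseteq> R} = {}" by blast
  then show ?thesis using False by (simp add: binomial_eq_0 del: Collect_empty_eq)
qed

definition sgr :: "nat set \<Rightarrow> nat \<Rightarrow> real" where "sgr \<tau> e = (if e \<in> \<tau> then 1 else - 1)"

lemma signed_pt_monom:
  "prod_list (map (signed_pt r R \<tau>) es)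
     = (if set es \<subseteq> R then (1 / sqrt (real r)) ^ length es * prod_list (map (sgr \<tau>) es) else 0)"
proof -
  have "signed_pt r R \<tau> e = (if e \<in> R then 1 / sqrt (real r) * sgr \<tau> e else 0)" for e
    by (simp add: signed_pt_def sgr_def)
  then show ?thesis by (induction es) simp_all
qed

lemma sgr_tog: "prod_list (map (sgr (tog e \<tau>)) es) = (- 1) ^ count_list es e * prod_list (map (sgr \<tau>) es)"
proof -
  have "sgr (tog e \<tau>) a = (if a = e then - sgr \<tau> a else sgr \<tau> a)" for a
    by (cases "a = e"; cases "e \<in> \<tau>"; cases "a \<in> \<tau>") (simp_all add: sgr_def tog_def)
  then show ?thesis by (induction es) simp_all
qed

lemma sgr_even:
  assumes "\<And>e. even (count_list es e)"
  shows "prod_list (map (sgr \<tau>) es) = 1"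
proof -
  have "prod_list (map (sgr \<tau>) es) = (\<Prod>e\<in>set es. sgr \<tau> e ^ count_list es e)" for es
  proof (induction es)
    case (Cons a es)
    show ?case
    proof (cases "a \<in> set es")
      case True
      have "(\<Prod>e\<in>set es. sgr \<tau> e ^ count_list (a # es) e)
          = (\<Prod>e\<in>set es. sgr \<tau> e ^ count_list es e * (if e = a then sgr \<tau> e else 1))"
        by (intro prod.cong) auto
      also have "\<dots> = (\<Prod>e\<in>set es. sgr \<tau> e ^ count_list es e) * sgr \<tau> a"
        using True by (simp add: prod.distrib)
      finally show ?thesis using True Cons by (simp add: insert_absorb mult.commute)
    next
      case False
      then have "(\<Prod>e\<in>set es. sgr \<tau> e ^ count_list (a # es) e) = (\<Prod>e\<in>set es. sgr \<tau> e ^ count_list es e)"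
        by (intro prod.cong) auto
      then show ?thesis using False Cons count_notin[OF False] by simp
    qed
  qed simp
  moreover have "sgr \<tau> e ^ count_list es e = 1" for e
    using assms[of e] by (simp add: sgr_def)
  ultimately show ?thesis by simp
qed

text \<open>Flipping a sign of odd exponent negates the monomial, so the sum equals its own
  negative.\<close>

lemma sum_sgr:
  assumes "set es \<subseteq> {..<d}"
  shows "(\<Sum>\<tau>\<in>Pow {..<d}. prod_list (map (sgr \<tau>) es)) = (if \<forall>e. even (count_list es e) then 2 ^ d else 0)"
proof (cases "\<forall>e. even (count_list es e)")
  case True
  then show ?thesis by (simp add: sgr_even card_Pow)
next
  case False
  then obtain e where e: "odd (count_list es e)" by blast
  then have "e \<in> set es" by (metis count_notin even_zero)
  then have "e < d" using assms by auto
  then have "(\<Sum>\<tau>\<in>Pow {..<d}. prod_list (map (sgr \<tau>) es)) = (\<Sum>\<tau>\<in>Pow {..<d}. prod_list (map (sgr (tog e \<tau>)) es))"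
    by (subst sum_tog[of e d "\<lambda>\<tau>. prod_list (map (sgr \<tau>) es)"]) simp_all
  also have "\<dots> = - (\<Sum>\<tau>\<in>Pow {..<d}. prod_list (map (sgr \<tau>) es))"
    unfolding sgr_tog using e by (simp add: sum_negf)
  finally show ?thesis using False by simp
qed

text \<open>Every variable that occurs does so at least twice. This halving turns degree 2h in the
  amplitudes into degree h in 1/r.\<close>

lemma even_counts:
  assumes "\<forall>e. even (count_list es e)"
  shows "even (length es)" and "2 * card (set es) \<le> length es"
proof -
  have len: "length es = (\<Sum>e\<in>set es. count_list es e)"
    by (rule sum_count_set[symmetric]) simp_all
  then show "even (length es)" using assms by (simp add: dvd_sum)
  have "2 \<le> count_list es e" if "e \<in> set es" for e
  proof -
    have "count_list es e \<noteq> 0" using that by (simp add: count_list_0_iff)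
    then show ?thesis using assms[rule_format, of e] by (auto elim!: evenE)
  qed
  then have "(\<Sum>e\<in>set es. 2) \<le> (\<Sum>e\<in>set es. count_list es e)" by (intro sum_mono)
  then show "2 * card (set es) \<le> length es" using len by simp
qed

text \<open>The falling factorial r(r - 1)...(r - k + 1), divided by r^k, is a polynomial in 1/r;
  \<open>k \<le> h\<close> leaves a nonnegative power of 1/r over.\<close>

lemma choose_as_prod:
  assumes "1 \<le> r" "k \<le> h"
  shows "(1 / of_nat r) ^ h * of_nat (r choose k) * (fact k :: complex)
    = (1 / of_nat r) ^ (h - k) * (\<Prod>s<k. 1 - of_nat s * (1 / of_nat r))"
proof -
  have "(of_nat (r choose k) :: complex) * fact k = (\<Prod>s<k. of_nat r - of_nat s)"
    using gbinomial_mult_fact[of k "of_nat r :: complex"]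
    by (simp add: binomial_gbinomial mult.commute lessThan_atLeast0)
  moreover have "(1 / of_nat r :: complex) ^ k * (\<Prod>s<k. of_nat r - of_nat s) = (\<Prod>s<k. 1 - of_nat s * (1 / of_nat r))"
  proof -
    have "(\<Prod>s<k. 1 - of_nat s * (1 / of_nat r)) = (\<Prod>s<k. (1 / of_nat r :: complex) * (of_nat r - of_nat s))"
      using assms(1) by (intro prod.cong refl) (simp add: right_diff_distrib)
    then show ?thesis by (simp only: prod.distrib prod_constant card_lessThan)
  qed
  moreover have "(1 / of_nat r :: complex) ^ h = (1 / of_nat r) ^ (h - k) * (1 / of_nat r) ^ k"
    using assms(2) by (simp flip: power_add)
  ultimately show ?thesis by (simp add: mult.assoc)
qed

lemma avg_monom:
  assumes es: "set es \<subseteq> {..<d}" and r: "1 \<le> r" "r \<le> d"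
  shows "avg d r (\<lambda>x. c * of_real (prod_list (map x es)))
    = (if \<forall>e. even (count_list es e)
       then c * (1 / of_nat r) ^ (length es div 2) * of_nat (r choose card (set es)) / of_nat (d choose card (set es)) else 0)"
proof -
  let ?\<R> = "{R. R \<subseteq> {..<d} \<and> card R = r}"
  let ?ev = "\<forall>e. even (count_list es e)"
  define A where "A = (1 / sqrt (real r)) ^ length es"
  have "(\<Sum>\<tau>\<in>Pow {..<d}. c * of_real (prod_list (map (signed_pt r R \<tau>) es)))
      = (if set es \<subseteq> R then c * of_real A * (if ?ev then 2 ^ d else 0) else 0)" for R
  proof (cases "set es \<subseteq> R")
    case True
    then have "(\<Sum>\<tau>\<in>Pow {..<d}. c * of_real (prod_list (map (signed_pt r R \<tau>) es)))
       = (\<Sum>\<tau>\<in>Pow {..<d}. c * of_real (A * prod_list (map (sgr \<tau>) es)))"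
      by (simp add: signed_pt_monom A_def)
    also have "\<dots> = c * of_real (A * (\<Sum>\<tau>\<in>Pow {..<d}. prod_list (map (sgr \<tau>) es)))"
      by (simp add: sum_distrib_left)
    finally show ?thesis using True by (simp add: sum_sgr[OF es])
  qed (simp add: signed_pt_monom)
  then have "(\<Sum>R\<in>?\<R>. \<Sum>\<tau>\<in>Pow {..<d}. c * of_real (prod_list (map (signed_pt r R \<tau>) es)))
     = (\<Sum>R\<in>?\<R>. if set es \<subseteq> R then c * of_real A * (if ?ev then 2 ^ d else 0) else 0)" by simp
  also have "\<dots> = of_nat (card {R\<in>?\<R>. set es \<subseteq> R}) * (c * of_real A * (if ?ev then 2 ^ d else 0))"
    by (subst sum.inter_filter[symmetric]) (simp_all add: finite_subsets)
  also have "{R\<in>?\<R>. set es \<subseteq> R} = {R. R \<subseteq> {..<d} \<and> card R = r \<and> set es \<subseteq> R}" by auto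
  finally have S: "avg d r (\<lambda>x. c * of_real (prod_list (map x es)))
    = of_nat (card {R. R \<subseteq> {..<d} \<and> card R = r \<and> set es \<subseteq> R}) / of_nat (d choose r)
      * (c * of_real A * (if ?ev then 1 else 0))"
    by (simp add: avg_def)
  have "card (set es) \<le> d" using card_mono[OF _ es] by simp
  then have nz: "(of_nat (d choose card (set es)) :: complex) \<noteq> 0" "(of_nat (d choose r) :: complex) \<noteq> 0"
    using r by (simp_all add: binomial_eq_0_iff)
  have "(of_nat (card {R. R \<subseteq> {..<d} \<and> card R = r \<and> set es \<subseteq> R}) :: complex) * of_nat (d choose card (set es))
      = of_nat (d choose r) * of_nat (r choose card (set es))"
    unfolding of_nat_mult[symmetric] card_supersets[OF es r(2)] ..
  then have ratio: "(of_nat (card {R. R \<subseteq> {..<d} \<and> card R = r \<and> set es \<subseteq> R}) :: complex) / of_nat (d choose r)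
      = of_nat (r choose card (set es)) / of_nat (d choose card (set es))"
    using nz by (simp add: field_simps)
  have A: "complex_of_real A = (1 / of_nat r) ^ (length es div 2)" if ev: ?ev
  proof -
    obtain h where h: "length es = 2 * h" using even_counts(1)[OF ev] by blast
    have "A = (1 / real r) ^ h" by (simp add: A_def h power_mult power_divide)
    then show ?thesis by (simp add: h)
  qed
  show ?thesis unfolding S ratio using A by simp
qed

lemma avg_poly:
  assumes "deg_le d (2 * h) f"
  shows "\<exists>P. degree P \<le> h \<and> (\<forall>r. 1 \<le> r \<and> r \<le> d \<longrightarrow> avg d r f = poly P (1 / of_nat r))"
  using assms
proof (induction rule: deg_le.induct)
  case deg_zero
  show ?case by (rule exI[of _ 0]) (simp add: avg_def)
next
  case (deg_add f g)
  then obtain P Q where "degree P \<le> h" "\<forall>r. 1 \<le> r \<and> r \<le> d \<longrightarrow> avg d r f = poly P (1 / of_nat r)"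
    and "degree Q \<le> h" "\<forall>r. 1 \<le> r \<and> r \<le> d \<longrightarrow> avg d r g = poly Q (1 / of_nat r)" by blast
  then show ?case by (intro exI[of _ "P + Q"]) (simp add: avg_add degree_add_le)
next
  case (deg_monom es c)
  show ?case
  proof (cases "\<forall>e. even (count_list es e)")
    case False
    have "avg d r (\<lambda>x. c * of_real (prod_list (map x es))) = 0" if "1 \<le> r" "r \<le> d" for r
      unfolding avg_monom[OF deg_monom(1) that] using False by (simp only: if_False)
    then show ?thesis by (intro exI[of _ 0]) simp
  next
    case True
    define k l where "k = card (set es)" and "l = length es div 2"
    have kl: "k \<le> l" "l \<le> h" using even_counts(2)[OF True] deg_monom(2) by (simp_all add: k_def l_def)
    define Q where "Q = monom 1 (l - k) * (\<Prod>s<k. [:1, - complex_of_nat s:])"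
    define P where "P = smult (c / (of_nat (d choose k) * fact k)) Q"
    have "degree Q \<le> (l - k) + k"
    proof -
      have "degree (\<Prod>s<k. [:1, - complex_of_nat s:]) \<le> (\<Sum>s<k. degree [:1, - complex_of_nat s:])"
        by (rule degree_prod_sum_le[unfolded comp_def]) simp
      also have "\<dots> \<le> (\<Sum>s<k. 1)" by (intro sum_mono) simp
      finally show ?thesis unfolding Q_def
        by (intro order_trans[OF degree_mult_le] add_mono) (simp_all add: degree_monom_eq)
    qed
    then have "degree P \<le> h" unfolding P_def using kl by (intro order_trans[OF degree_smult_le]) simp
    moreover have "avg d r (\<lambda>x. c * of_real (prod_list (map x es))) = poly P (1 / of_nat r)" if r: "1 \<le> r" "r \<le> d" for r
    proof -
      have "poly Q (1 / of_nat r) = (1 / of_nat r) ^ (l - k) * (\<Prod>s<k. 1 - of_nat s * (1 / of_nat r))"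
        by (simp add: Q_def poly_monom poly_prod algebra_simps)
      also have "\<dots> = (1 / of_nat r) ^ l * of_nat (r choose k) * fact k"
        using choose_as_prod[OF r(1) kl(1)] by simp
      finally have "poly P (1 / of_nat r) = c * (1 / of_nat r) ^ l * of_nat (r choose k) / of_nat (d choose k)"
        by (simp add: P_def)
      then show ?thesis unfolding avg_monom[OF deg_monom(1) r] k_def l_def using True by (simp only: if_True simp_thms)
    qed
    ultimately show ?thesis by blast
  qed
qed


section \<open>The acceptance probability as a polynomial\<close>

context purified_model
begin

lemma run_norm:
  assumes "unit_amp \<Phi>" "\<forall>qV\<in>set steps. unitary_on (2*d*m*k) (snd qV)"
  shows "(\<Sum>j<2*d*m*k. (cmod (run_steps (2*d*m*k) (qop \<Phi>) steps \<psi> j))\<^sup>2) = (\<Sum>j<2*d*m*k. (cmod (\<psi> j))\<^sup>2)"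
  using assms(2)
proof (induction steps arbitrary: \<psi>)
  case (Cons qV rest)
  obtain q V where "qV = (q, V)" by force
  then show ?case using Cons by (simp add: mat_apply_norm qop_norm[OF assms(1)])
qed simp

lemma accept_prob_range:
  assumes "unit_amp \<Phi>" "unitary_on (2*d*m*k) V0" "\<forall>qV\<in>set steps. unitary_on (2*d*m*k) (snd qV)"
  shows "0 \<le> accept_prob d m k (refl_mat \<Phi>) V0 steps S" "accept_prob d m k (refl_mat \<Phi>) V0 steps S \<le> 1"
proof -
  let ?N = "2*d*m*k"
  show "0 \<le> accept_prob d m k (refl_mat \<Phi>) V0 steps S"
    by (simp add: accept_prob_def Let_def sum_nonneg)
  have "accept_prob d m k (refl_mat \<Phi>) V0 steps S
      \<le> (\<Sum>j<?N. (cmod (run_steps ?N (qop \<Phi>) steps (mat_apply ?N V0 (basis_vec 0)) j))\<^sup>2)"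
    unfolding accept_prob_def Let_def by (rule sum_mono2) auto
  also have "\<dots> = (\<Sum>j<?N. (cmod (basis_vec 0 j))\<^sup>2)"
    by (simp only: run_norm[OF assms(1,3)] mat_apply_norm[OF assms(2)])
  also have "\<dots> = (\<Sum>j<?N. if j = 0 then 1 else 0)"
    by (intro sum.cong) (auto simp: basis_vec_def)
  \<comment> \<open>Only an inequality, because the space is empty for k = 0.\<close>
  also have "\<dots> \<le> 1" by (simp only: sum.delta finite_lessThan) simp
  finally show "accept_prob d m k (refl_mat \<Phi>) V0 steps S \<le> 1" .
qed

abbreviation qamp :: "(nat \<Rightarrow> real) \<Rightarrow> nat \<Rightarrow> complex" where
  "qamp x \<equiv> (\<lambda>e. of_real (x e))"

lemma deg_vec: "deg_le d 1 (\<lambda>x. vec (qamp x) y)"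
proof -
  consider "y = 0" | e where "e < d" "y = pos e" | "y \<noteq> 0" "y \<notin> pos ` {..<d}" by auto
  then show ?thesis
  proof cases
    case 2
    then show ?thesis using deg_scale[OF deg_var[of e d 1], of "-1"] by (simp add: vec_simps)
  qed (simp_all add: vec_simps vec_zero deg_const)
qed

lemma deg_refl_mat: "deg_le d 2 (\<lambda>x. refl_mat (qamp x) y z)"
  unfolding refl_mat_def
  by (rule deg_diff[OF deg_const]) (use deg_mult[OF deg_vec deg_cnj[OF deg_vec]] in \<open>simp add: numeral_2_eq_2\<close>)

lemma deg_qop: "deg_le d 2 (\<lambda>x. qop (qamp x) q i j)"
proof (cases "i div (d * m * k) = j div (d * m * k) \<and> i mod k = j mod k")
  case True
  then show ?thesis
    by (cases q; cases "j div (d * m * k) = Suc 0") (simp_all add: oracle_op_def Let_def deg_refl_mat deg_cnj deg_const)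
next
  case False
  then have "qop (qamp x) q i j = 0" for x by (simp only: oracle_op_def if_False)
  then show ?thesis by (simp add: deg_const)
qed

text \<open>The entries of the reflection are at most quadratic in the amplitudes, so each query
  raises the degree by at most 2.\<close>

lemma deg_run:
  assumes "\<And>j. deg_le d l (\<lambda>x. \<psi> x j)"
  shows "deg_le d (l + 2 * length steps) (\<lambda>x. run_steps (2*d*m*k) (qop (qamp x)) steps (\<psi> x) j)"
  using assms
proof (induction steps arbitrary: \<psi> l)
  case (Cons qV rest)
  obtain q V where qV: "qV = (q, V)" by force
  have "deg_le d (2 + l) (\<lambda>x. mat_apply (2*d*m*k) V (mat_apply (2*d*m*k) (qop (qamp x) q) (\<psi> x)) j)" for j
    unfolding mat_apply_def by (intro deg_sum deg_scale deg_mult deg_qop Cons.prems)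
  from Cons.IH[OF this] show ?case by (simp add: qV add_ac)
qed simp

text \<open>Taking squared moduli doubles the degree; it is written as twice an even number to fit
  \<open>avg_poly\<close>.\<close>

lemma deg_accept:
  "deg_le d (2 * (2 * length steps)) (\<lambda>x. of_real (accept_prob d m k (refl_mat (qamp x)) V0 steps S))"
proof -
  let ?f = "\<lambda>x. run_steps (2*d*m*k) (qop (qamp x)) steps (mat_apply (2*d*m*k) V0 (basis_vec 0))"
  have "deg_le d (0 + 2 * length steps) (\<lambda>x. ?f x j)" for j
    by (rule deg_run[OF deg_const])
  then have "deg_le d (2 * length steps + 2 * length steps) (\<lambda>x. \<Sum>j\<in>S \<inter> {..<2*d*m*k}. ?f x j * cnj (?f x j))"
    by (intro deg_sum deg_mult deg_cnj) simp_all
  then show ?thesis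
    by (simp add: accept_prob_def Let_def complex_norm_square mult_2 del: of_real_power)
qed

lemma signed_pt_oracle:
  assumes R: "R \<subseteq> {..<d}" "card R = r" and r: "1 \<le> r"
  defines "p \<equiv> (\<lambda>e. if e \<in> R then 1 / real r else 0)"
  shows "is_distribution d p" "purified_oracle d m p (refl_mat (qamp (signed_pt r R \<tau>)))"
    "unit_amp (qamp (signed_pt r R \<tau>))"
proof -
  have "(\<Sum>e<d. p e) = (\<Sum>e\<in>R. 1 / real r)"
    unfolding p_def using R(1) by (simp add: sum.If_cases Int_absorb1)
  also have "\<dots> = 1" using R r by simp
  finally show dist: "is_distribution d p" by (simp add: is_distribution_def p_def)
  have "qamp (signed_pt r R \<tau>) e = complex_of_real (sqrt (p e)) * (if e \<in> \<tau> then 1 else -1)" for e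
    by (simp add: signed_pt_def p_def real_sqrt_divide)
  then show "purified_oracle d m p (refl_mat (qamp (signed_pt r R \<tau>)))" "unit_amp (qamp (signed_pt r R \<tau>))"
    by (intro refl_mat_purified_oracle[OF dist, of _ "\<lambda>e. if e \<in> \<tau> then 1 else -1"]; simp)+
qed

lemma avg_bounds:
  assumes r: "1 \<le> r" "r \<le> d"
    and f: "\<And>R \<tau>. R \<subseteq> {..<d} \<Longrightarrow> card R = r \<Longrightarrow> a \<le> g (signed_pt r R \<tau>) \<and> g (signed_pt r R \<tau>) \<le> b"
  obtains y where "avg d r (\<lambda>x. of_real (g x)) = of_real y" "a \<le> y" "y \<le> (b::real)"
proof -
  let ?\<R> = "{R. R \<subseteq> {..<d} \<and> card R = r}"
  define s where "s = (\<Sum>R\<in>?\<R>. \<Sum>\<tau>\<in>Pow {..<d}. g (signed_pt r R \<tau>))"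
  define c where "c = real (2 ^ d * (d choose r))"
  have cpos: "0 < c" using r by (simp add: c_def)
  have card: "card ?\<R> = (d choose r)" by (simp add: n_subsets)
  have "(\<Sum>R\<in>?\<R>. \<Sum>\<tau>\<in>Pow {..<d}. a) \<le> s" "s \<le> (\<Sum>R\<in>?\<R>. \<Sum>\<tau>\<in>Pow {..<d}. b)"
    unfolding s_def by (intro sum_mono, use f in blast)+
  then have "c * a \<le> s" "s \<le> c * b" by (simp_all add: card card_Pow c_def mult_ac)
  then have "a \<le> s / c" "s / c \<le> b" using cpos by (simp_all add: field_simps)
  moreover have "avg d r (\<lambda>x. of_real (g x)) = of_real (s / c)" by (simp add: avg_def s_def c_def)
  ultimately show ?thesis using that by blast
qed

text \<open>Full support r = d is the uniform distribution, while r = d div 2 is at distance at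
  least 1 from it. The averaged acceptance probabilities must differ by 1/3, more than the 32/100
  that \<open>small_range_bound\<close> allows.\<close>

lemma collision_bound:
  assumes tester: "uniformity_tester d m k \<epsilon> V0 steps S" and \<epsilon>: "\<epsilon> \<le> 1"
  shows "d < 80000 * (2 * length steps + 1) ^ 3"
proof (rule ccontr)
  assume "\<not> ?thesis"
  \<comment> \<open>The added 1 keeps the degree bound positive when no query is made.\<close>
  then interpret nodes: perturbed_square_nodes d "2 * length steps + 1" by unfold_locales simp_all
  define g where "g x = accept_prob d m k (refl_mat (qamp x)) V0 steps S" for x
  have uV: "unitary_on (2*d*m*k) V0" "\<forall>qV\<in>set steps. unitary_on (2*d*m*k) (snd qV)"
    using tester by (simp_all add: uniformity_tester_def)
  obtain P where P: "degree P \<le> 2 * length steps"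
    "\<And>r. 1 \<le> r \<Longrightarrow> r \<le> d \<Longrightarrow> avg d r (\<lambda>x. of_real (g x)) = poly P (1 / of_nat r)"
    using avg_poly[OF deg_accept[of steps V0 S]] unfolding g_def by blast
  have range: "0 \<le> g (signed_pt r R \<tau>) \<and> g (signed_pt r R \<tau>) \<le> 1"
    if "1 \<le> r" "R \<subseteq> {..<d}" "card R = r" for r R \<tau>
    unfolding g_def using accept_prob_range[OF signed_pt_oracle(3) uV] that by blast
  have bd: "cmod (poly P (1 / of_nat r)) \<le> 1" if "1 \<le> r" "r \<le> d" for r
    using avg_bounds[OF that, of 0 g 1] range[OF that(1)] P(2)[OF that]
    by (metis abs_of_nonneg norm_of_real)
  have close: "cmod (poly P (1 / of_nat (d div 2)) - poly P (1 / of_nat d)) \<le> 32 / 100"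
    using P(1) by (intro nodes.small_range_bound bd) simp_all
  have h: "1 \<le> d div 2" "d div 2 \<le> d" using d2 by simp_all
  obtain y0 where y0: "poly P (1 / of_nat d) = of_real y0" "2 / 3 \<le> y0"
  proof (rule avg_bounds[of d "2/3" g 1])
    fix R \<tau> assume R: "R \<subseteq> {..<d}" "card R = d"
    then have "R = {..<d}" by (simp add: card_subset_eq)
    then have "\<forall>e<d. (if e \<in> R then 1 / real d else 0) = 1 / real d" by simp
    moreover have "1 \<le> d" using d2 by simp
    ultimately have "2 / 3 \<le> g (signed_pt d R \<tau>)"
      using tester signed_pt_oracle(1)[OF R] signed_pt_oracle(2)[OF R, of \<tau>]
      unfolding uniformity_tester_def g_def by blast
    then show "2 / 3 \<le> g (signed_pt d R \<tau>) \<and> g (signed_pt d R \<tau>) \<le> 1"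
      using range[OF _ R] d2 by simp
  qed (use P(2)[of d] d2 that in simp_all)
  obtain y1 where y1: "poly P (1 / of_nat (d div 2)) = of_real y1" "y1 \<le> 1 / 3"
  proof (rule avg_bounds[OF h, of 0 g "1/3"])
    fix R \<tau> assume R: "R \<subseteq> {..<d}" "card R = d div 2"
    define r where "r = d div 2"
    define p where "p e = (if e \<in> R then 1 / real r else 0)" for e
    have r: "1 \<le> real r" "2 * real r \<le> real d" using h(1) by (simp_all add: r_def)
    have "l1_dist_uniform d p = (\<Sum>e<d. if e \<in> R then 1 / real r - 1 / real d else 1 / real d)"
      unfolding l1_dist_uniform_def p_def using r by (intro sum.cong) (auto simp: field_simps)
    also have "\<dots> = real r * (1 / real r - 1 / real d) + (real d - real r) * (1 / real d)"
    proof -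
      have "finite R" using R(1) finite_subset by blast
      then have "card ({..<d} - R) = d - r" using R by (simp add: card_Diff_subset r_def)
      then show ?thesis using R r_def h by (simp add: sum.If_cases Int_absorb1 Diff_eq[symmetric] of_nat_diff)
    qed
    also have "\<dots> = 2 - 2 * real r / real d" using r by (simp add: field_simps)
    also have "\<dots> \<ge> 1" using r by (simp add: field_simps)
    finally have "\<epsilon> \<le> l1_dist_uniform d p" using \<epsilon> by linarith
    then have "g (signed_pt r R \<tau>) \<le> 1 / 3"
      using tester signed_pt_oracle(1)[OF R h(1)] signed_pt_oracle(2)[OF R h(1), of \<tau>]
      unfolding uniformity_tester_def g_def p_def r_def by blast
    then show "0 \<le> g (signed_pt (d div 2) R \<tau>) \<and> g (signed_pt (d div 2) R \<tau>) \<le> 1 / 3"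
      using range[OF h(1) R] by (simp add: r_def)
  qed (use P(2)[OF h] that in simp_all)
  have "\<bar>y1 - y0\<bar> \<le> 32 / 100"
    using close unfolding y0 y1 of_real_diff[symmetric] norm_of_real .
  then show False using y0(2) y1(2) by linarith
qed

end

section \<open>Combination of the two bounds\<close>

lemma tester_lower_bound_cube_root:
  assumes d: "80000 \<le> d" and dm: "d \<le> m" and \<epsilon>: "\<epsilon> \<le> 1"
    and tester: "uniformity_tester d m k \<epsilon> V0 steps S"
  shows "real d powr (1/3) \<le> 132 * real (length steps)"
proof -
  interpret purified_model d m k using d dm by unfold_locales simp_all
  define T where "T = length steps"
  have b: "d < 80000 * (2 * T + 1) ^ 3" unfolding T_def by (rule collision_bound[OF tester \<epsilon>])
  \<comment> \<open>Without queries the bound would read d < 80000, against the assumption on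
    d.\<close>
  have "T \<noteq> 0" using b d by (auto simp: T_def)
  then have "2 * T + 1 \<le> 3 * T" by simp
  then have "(2 * T + 1) ^ 3 \<le> (3 * T) ^ 3" by (rule power_mono) simp
  then have "d \<le> 80000 * (3 * T) ^ 3" using b by linarith
  \<comment> \<open>80000 * 27 = 2160000 \<le> 2299968 = 132^3.\<close>
  also have "\<dots> \<le> (132 * T) ^ 3" by (simp add: power_mult_distrib)
  finally have "real d \<le> real ((132 * T) ^ 3)" by (simp only: of_nat_le_iff)
  then have "real d powr (1/3) \<le> ((132 * real T) ^ 3) powr (1/3)"
    by (intro powr_mono2) simp_all
  also have "\<dots> = 132 * real T"
  proof -
    have "0 < 132 * real T" using \<open>T \<noteq> 0\<close> by simp
    then have "(132 * real T) ^ 3 = (132 * real T) powr 3" by (simp only: powr_numeral)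
    then have "((132 * real T) ^ 3) powr (1/3) = (132 * real T) powr (3 * (1/3))" by (simp only: powr_powr)
    then show ?thesis by simp
  qed
  finally show ?thesis by (simp add: T_def)
qed

theorem theorem2p5:
  shows "\<exists>c>0. \<exists>d0::nat. \<forall>d\<ge>d0. \<forall>\<epsilon>::real. 0 < \<epsilon> \<and> \<epsilon> \<le> 1 \<longrightarrow>
           (\<forall>m k V0 steps S. d \<le> m \<and> uniformity_tester d m k \<epsilon> V0 steps S \<longrightarrow>
              real (length steps) \<ge> c * (real d powr (1/3) + real d powr (1/4) / \<epsilon>))"
\<comment> \<open>The constant works because 132 + 264 \<le> 400; the threshold is that of the cube
  root bound.\<close>
proof (rule exI[of _ "1/400"], intro conjI exI[of _ 80000] allI impI)
  fix d :: nat and \<epsilon> :: real and m k V0 steps S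
  assume d: "80000 \<le> d" and \<epsilon>: "0 < \<epsilon> \<and> \<epsilon> \<le> 1"
    and t: "d \<le> m \<and> uniformity_tester d m k \<epsilon> V0 steps S"
  have c: "real d powr (1/3) \<le> 132 * real (length steps)"
    using tester_lower_bound_cube_root[OF d] \<epsilon> t by blast
  have "real d powr (1/4) / \<epsilon> \<le> 264 * real (length steps)"
  proof (cases "\<epsilon> \<le> 1 / 2")
    case True
    then have "real d powr (1/4) / \<epsilon> \<le> 200 * real (length steps)"
      using tester_lower_bound_eps[of d m \<epsilon> k V0 steps S] \<epsilon> t d by simp
    then show ?thesis by simp
  next
    case False
    \<comment> \<open>For \<epsilon> > 1/2 the second term is at most twice the first, whence 264 =
      2 * 132.\<close>
    have "real d powr (1/4) / \<epsilon> \<le> real d powr (1/3) / (1/2)"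
      using False d by (intro frac_le powr_mono) simp_all
    then show ?thesis using c by simp
  qed
  then show "1/400 * (real d powr (1/3) + real d powr (1/4) / \<epsilon>) \<le> real (length steps)"
    using c by simp
qed simp

end
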